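(* Let $(M,\gamma)$ be a complex contact manifold of complex dimension $2n+1$ with associated line bundle $L$, and let $k$ be an integer with $1\le k\le 2n+1$. Then the short exact sequence of sheaves \[ 0\to \mathcal{O}(\textstyle\bigwedge^k \operatorname{Ker}\gamma) \to \mathcal{O}(\bigwedge^k \mathbb{T}) \xrightarrow{\ \gamma\ } \mathcal{O}(L\otimes \bigwedge^{k-1} \operatorname{Ker}\gamma) \to 0 \] splits as a sequence of sheaves of $\mathbb{C}$-modules. In particular, the sequence \[ 0\to H^i(\textstyle\bigwedge^k \operatorname{Ker}\gamma) \to H^i(\bigwedge^k \mathbb{T}) \to H^i(L\otimes \bigwedge^{k-1} \operatorname{Ker}\gamma) \to 0 \] is exact for each $i=0,\dots,2n+1$.
   Context: A complex contact structure $\gamma=\{(U_i,\gamma_i)\}$ on a complex manifold $M$ of dimension $2n+1$ is (an equivalence class of) an open covering $\{U_i\}$ of $M$ with holomorphic $1$-forms $\gamma_i$ on $U_i$ such that $(d\gamma_i)^n\wedge\gamma_i$ is nowhere zero on $U_i$ and $\gamma_i=f_{ij}\gamma_j$ on $U_i\cap U_j$ for holomorphic functions $f_{ij}$. Two such systems $\{(U_i,\gamma_i)\}$ and $\{(U'_{i'},\gamma'_{i'})\}$ are equivalent if $\gamma_i=g_{ii'}\gamma'_{i'}$ on each $U_i\cap U'_{i'}$ for a holomorphic function $g_{ii'}$. The pair $(M,\gamma)$ is called a complex contact manifold. The associated line bundle $L$ is the holomorphic line bundle with transition functions $\{f_{ij}\}$, so that $\gamma$ is an $L$-valued holomorphic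 $1$-form, i.e. a bundle map $\gamma:\mathbb{T}\to L$, where $\mathbb{T}$ is the holomorphic tangent bundle of $M$; $\operatorname{Ker}\gamma\subset\mathbb{T}$ is its kernel. The map $\gamma$ is extended to the bundle map $\gamma:\bigwedge^k\mathbb{T}\to L\otimes\bigwedge^{k-1}\operatorname{Ker}\gamma$, \[ v_{1}\wedge\dots \wedge v_{k}\mapsto \sum_{j=1}^k (-1)^{j-1}\gamma(v_{j})\otimes v_{1}\wedge\dots\wedge v_{j-1}\wedge v_{j+1} \wedge\dots \wedge v_{k}, \] whose kernel is $\bigwedge^k\operatorname{Ker}\gamma$. $\mathcal{O}(E)$ is the sheaf of holomorphic sections of a holomorphic vector bundle $E$ and $H^i(E)=H^i(M,\mathcal{O}(E))$. The maps in cohomology are those induced by the maps of sheaves. *)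

theory Defs
  imports
    "Jordan_Normal_Form.Determinant"
    "HOL-Analysis.Analysis"
    "HOL-Combinatorics.Permutations"
    "HOL-Library.Function_Algebras"
begin

no_notation vec_index (infixl "$" 100)
hide_const (open) Determinants.det Finite_Cartesian_Product.mat


section \<open>Sheaves of complex vector spaces\<close>

text \<open>
  All sheaves below are sheaves of functions with values in a space of functions into the
  complex numbers (a section of a vector bundle is the family of its components).  A section over
  \<open>U\<close> is a function on the whole type that is 0 outside \<open>U\<close>, so that equality of sections is
  equality of functions.  Addition and 0 are pointwise (\<open>HOL-Library.Function_Algebras\<close>).
\<close>

type_synonym ('a, 'b) sect = "'a \<Rightarrow> 'b \<Rightarrow> complex"
type_synonym ('a, 'b) presheaf = "'a set \<Rightarrow> ('a, 'b) sect set"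
type_synonym ('a, 'b, 'c) presheaf_map = "'a set \<Rightarrow> ('a, 'b) sect \<Rightarrow> ('a, 'c) sect"

definition cscale :: "complex \<Rightarrow> ('b \<Rightarrow> complex) \<Rightarrow> 'b \<Rightarrow> complex" where
  "cscale c v = (\<lambda>b. c * v b)"

interpretation cfun: vector_space "cscale :: complex \<Rightarrow> ('b \<Rightarrow> complex) \<Rightarrow> 'b \<Rightarrow> complex"
  by unfold_locales (auto simp: cscale_def fun_eq_iff algebra_simps)

definition sscale :: "complex \<Rightarrow> ('a, 'b) sect \<Rightarrow> ('a, 'b) sect" where
  "sscale c s = (\<lambda>x. cscale c (s x))"

definition restr :: "'a set \<Rightarrow> ('a, 'b) sect \<Rightarrow> ('a, 'b) sect" where
  "restr V s = (\<lambda>x. if x \<in> V then s x else 0)"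

text \<open>
  In the last clause, a compatible family \<open>s\<^sub>U \<in> F U\<close>, \<open>U \<in> \<U>\<close>, is the same thing as a function \<open>s\<close>
  supported in \<open>\<Union>\<U>\<close> all of whose restrictions to members of \<open>\<U>\<close> are sections; uniqueness of the
  glued section is automatic for functions.
\<close>

definition csheaf :: "'a topology \<Rightarrow> ('a, 'b) presheaf \<Rightarrow> bool" where
  "csheaf M F \<longleftrightarrow>
    (\<forall>U. openin M U \<longrightarrow>
      (\<forall>s\<in>F U. \<forall>x. x \<notin> U \<longrightarrow> s x = 0) \<and>
      0 \<in> F U \<and> (\<forall>s\<in>F U. \<forall>t\<in>F U. s + t \<in> F U) \<and> (\<forall>c. \<forall>s\<in>F U. sscale c s \<in> F U) \<and>
      (\<forall>V. openin M V \<and> V \<subseteq> U \<longrightarrow> restr V ` F U \<subseteq> F V)) \<and>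
    (\<forall>\<U> s. (\<forall>U\<in>\<U>. openin M U) \<and> (\<forall>x. x \<notin> \<Union>\<U> \<longrightarrow> s x = 0) \<and> (\<forall>U\<in>\<U>. restr U s \<in> F U)
      \<longrightarrow> s \<in> F (\<Union>\<U>))"

definition sheaf_hom ::
  "'a topology \<Rightarrow> ('a, 'b) presheaf \<Rightarrow> ('a, 'c) presheaf \<Rightarrow> ('a, 'b, 'c) presheaf_map \<Rightarrow> bool" where
  "sheaf_hom M F G \<Phi> \<longleftrightarrow>
    (\<forall>U. openin M U \<longrightarrow>
      \<Phi> U ` F U \<subseteq> G U \<and>
      (\<forall>s\<in>F U. \<forall>t\<in>F U. \<Phi> U (s + t) = \<Phi> U s + \<Phi> U t) \<and>
      (\<forall>c. \<forall>s\<in>F U. \<Phi> U (sscale c s) = sscale c (\<Phi> U s)) \<and>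
      (\<forall>V. openin M V \<and> V \<subseteq> U \<longrightarrow> (\<forall>s\<in>F U. \<Phi> V (restr V s) = restr V (\<Phi> U s))))"

definition sheaf_kernel ::
  "('a, 'b) presheaf \<Rightarrow> ('a, 'b, 'c) presheaf_map \<Rightarrow> ('a, 'b) presheaf" where
  "sheaf_kernel F \<Phi> U = {s \<in> F U. \<Phi> U s = 0}"

text \<open>The image sheaf: sections that are locally of the form \<open>\<Phi> s\<close>.\<close>

definition sheaf_image :: "'a topology \<Rightarrow> ('a, 'b) presheaf \<Rightarrow> ('a, 'c) presheaf \<Rightarrow>
    ('a, 'b, 'c) presheaf_map \<Rightarrow> ('a, 'c) presheaf" where
  "sheaf_image M F G \<Phi> U =
    {t \<in> G U. \<forall>x\<in>U. \<exists>V. openin M V \<and> x \<in> V \<and> V \<subseteq> U \<and> restr V t \<in> \<Phi> V ` F V}"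

definition short_exact_sheaf_sequence :: "'a topology \<Rightarrow>
    ('a, 'b) presheaf \<Rightarrow> ('a, 'b, 'c) presheaf_map \<Rightarrow> ('a, 'c) presheaf \<Rightarrow>
    ('a, 'c, 'd) presheaf_map \<Rightarrow> ('a, 'd) presheaf \<Rightarrow> bool" where
  "short_exact_sheaf_sequence M F \<Phi> G \<Psi> H \<longleftrightarrow>
    csheaf M F \<and> csheaf M G \<and> csheaf M H \<and> sheaf_hom M F G \<Phi> \<and> sheaf_hom M G H \<Psi> \<and>
    (\<forall>U. openin M U \<longrightarrow>
      sheaf_kernel F \<Phi> U = {0} \<and>
      sheaf_image M F G \<Phi> U = sheaf_kernel G \<Psi> U \<and>
      sheaf_image M G H \<Psi> U = H U)"

definition split_short_exact_sheaf_sequence :: "'a topology \<Rightarrow>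
    ('a, 'b) presheaf \<Rightarrow> ('a, 'b, 'c) presheaf_map \<Rightarrow> ('a, 'c) presheaf \<Rightarrow>
    ('a, 'c, 'd) presheaf_map \<Rightarrow> ('a, 'd) presheaf \<Rightarrow> bool" where
  "split_short_exact_sheaf_sequence M F \<Phi> G \<Psi> H \<longleftrightarrow>
    short_exact_sheaf_sequence M F \<Phi> G \<Psi> H \<and>
    (\<exists>\<Sigma>. sheaf_hom M H G \<Sigma> \<and> (\<forall>U. openin M U \<longrightarrow> (\<forall>h\<in>H U. \<Psi> U (\<Sigma> U h) = h)))"


section \<open>Sheaf cohomology\<close>

text \<open>
  Cech cohomology, i.e. the direct limit of the cohomology of open covers, which on paracompact
  Hausdorff spaces is sheaf cohomology.  As usual (Godement) the limit is taken over the cofinal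
  system of covers \<open>(U\<^sub>x)\<close> indexed by the points of the space with \<open>x \<in> U\<^sub>x\<close>: there \<open>W\<close> refines \<open>U\<close>
  when \<open>W\<^sub>x \<subseteq> U\<^sub>x\<close> for all \<open>x\<close>, and the refinement map on cochains is restriction.
  A cochain of degree \<open>p\<close> is a function of \<open>p + 1\<close> points, set to 0 on all other lists.
\<close>

definition pointed_cover :: "'a topology \<Rightarrow> ('a \<Rightarrow> 'a set) \<Rightarrow> bool" where
  "pointed_cover M U \<longleftrightarrow> (\<forall>x\<in>topspace M. openin M (U x) \<and> x \<in> U x)"

definition simplices :: "'a topology \<Rightarrow> nat \<Rightarrow> 'a list set" where
  "simplices M p = {xs. length xs = Suc p \<and> set xs \<subseteq> topspace M}"

definition supp :: "('a \<Rightarrow> 'a set) \<Rightarrow> 'a list \<Rightarrow> 'a set" where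
  "supp U xs = (\<Inter>x\<in>set xs. U x)"

definition remove_nth :: "nat \<Rightarrow> 'b list \<Rightarrow> 'b list" where
  "remove_nth j xs = take j xs @ drop (Suc j) xs"

definition cochains ::
  "'a topology \<Rightarrow> ('a, 'b) presheaf \<Rightarrow> nat \<Rightarrow> ('a \<Rightarrow> 'a set) \<Rightarrow> ('a list \<Rightarrow> ('a, 'b) sect) set" where
  "cochains M F p U =
    {c. (\<forall>xs\<in>simplices M p. c xs \<in> F (supp U xs)) \<and> (\<forall>xs. xs \<notin> simplices M p \<longrightarrow> c xs = 0)}"

definition coboundary :: "'a topology \<Rightarrow> nat \<Rightarrow> ('a \<Rightarrow> 'a set) \<Rightarrow>
    ('a list \<Rightarrow> ('a, 'b) sect) \<Rightarrow> 'a list \<Rightarrow> ('a, 'b) sect" where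
  "coboundary M p U c = (\<lambda>xs. if xs \<in> simplices M (Suc p)
     then \<Sum>j<p + 2. sscale ((-1) ^ j) (restr (supp U xs) (c (remove_nth j xs))) else 0)"

definition cocycles ::
  "'a topology \<Rightarrow> ('a, 'b) presheaf \<Rightarrow> nat \<Rightarrow> ('a \<Rightarrow> 'a set) \<Rightarrow> ('a list \<Rightarrow> ('a, 'b) sect) set" where
  "cocycles M F p U = {c \<in> cochains M F p U. coboundary M p U c = 0}"

definition coboundaries ::
  "'a topology \<Rightarrow> ('a, 'b) presheaf \<Rightarrow> nat \<Rightarrow> ('a \<Rightarrow> 'a set) \<Rightarrow> ('a list \<Rightarrow> ('a, 'b) sect) set" where
  "coboundaries M F p U =
    (case p of 0 \<Rightarrow> {0} | Suc q \<Rightarrow> coboundary M q U ` cochains M F q U)"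

definition refine ::
  "('a \<Rightarrow> 'a set) \<Rightarrow> ('a list \<Rightarrow> ('a, 'b) sect) \<Rightarrow> 'a list \<Rightarrow> ('a, 'b) sect" where
  "refine W c = (\<lambda>xs. restr (supp W xs) (c xs))"

type_synonym ('a, 'b) cech_rep = "('a \<Rightarrow> 'a set) \<times> ('a list \<Rightarrow> ('a, 'b) sect)"

definition cech_reps ::
  "'a topology \<Rightarrow> ('a, 'b) presheaf \<Rightarrow> nat \<Rightarrow> ('a, 'b) cech_rep set" where
  "cech_reps M F p = {(U, c). pointed_cover M U \<and> c \<in> cocycles M F p U}"

definition cech_rel ::
  "'a topology \<Rightarrow> ('a, 'b) presheaf \<Rightarrow> nat \<Rightarrow> ('a, 'b) cech_rep rel" where
  "cech_rel M F p = {((U, c), (V, d)).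
     (U, c) \<in> cech_reps M F p \<and> (V, d) \<in> cech_reps M F p \<and>
     (\<exists>W. pointed_cover M W \<and> (\<forall>x\<in>topspace M. W x \<subseteq> U x \<inter> V x) \<and>
          refine W c - refine W d \<in> coboundaries M F p W)}"

definition cohomology ::
  "'a topology \<Rightarrow> ('a, 'b) presheaf \<Rightarrow> nat \<Rightarrow> ('a, 'b) cech_rep set set" where
  "cohomology M F p = cech_reps M F p // cech_rel M F p"

definition cohomology_zero ::
  "'a topology \<Rightarrow> ('a, 'b) presheaf \<Rightarrow> nat \<Rightarrow> ('a, 'b) cech_rep set" where
  "cohomology_zero M F p = cech_rel M F p `` {(\<lambda>_. topspace M, 0)}"

definition cochain_map :: "'a topology \<Rightarrow> nat \<Rightarrow> ('a, 'b, 'c) presheaf_map \<Rightarrow>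
    ('a \<Rightarrow> 'a set) \<Rightarrow> ('a list \<Rightarrow> ('a, 'b) sect) \<Rightarrow> 'a list \<Rightarrow> ('a, 'c) sect" where
  "cochain_map M p \<Phi> U c = (\<lambda>xs. if xs \<in> simplices M p then \<Phi> (supp U xs) (c xs) else 0)"

text \<open>The induced map \<open>H\<^sup>p(M, F) \<rightarrow> H\<^sup>p(M, G)\<close>.\<close>

definition cohomology_map :: "'a topology \<Rightarrow> ('a, 'c) presheaf \<Rightarrow> ('a, 'b, 'c) presheaf_map \<Rightarrow>
    nat \<Rightarrow> ('a, 'b) cech_rep set \<Rightarrow> ('a, 'c) cech_rep set" where
  "cohomology_map M G \<Phi> p X =
    (\<Union>(U, c)\<in>X. cech_rel M G p `` {(U, cochain_map M p \<Phi> U c)})"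

definition short_exact_in_cohomology :: "'a topology \<Rightarrow> nat \<Rightarrow>
    ('a, 'b) presheaf \<Rightarrow> ('a, 'b, 'c) presheaf_map \<Rightarrow> ('a, 'c) presheaf \<Rightarrow>
    ('a, 'c, 'd) presheaf_map \<Rightarrow> ('a, 'd) presheaf \<Rightarrow> bool" where
  "short_exact_in_cohomology M p F \<Phi> G \<Psi> H \<longleftrightarrow>
    inj_on (cohomology_map M G \<Phi> p) (cohomology M F p) \<and>
    cohomology_map M G \<Phi> p ` cohomology M F p =
      {X \<in> cohomology M G p. cohomology_map M H \<Psi> p X = cohomology_zero M H p} \<and>
    cohomology_map M H \<Psi> p ` cohomology M G p = cohomology M H p"


section \<open>Complex manifolds and their tangent bundles\<close>

definition holo_on :: "(complex ^ 'm \<Rightarrow> complex) \<Rightarrow> (complex ^ 'm) set \<Rightarrow> bool" where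
  "holo_on f S \<longleftrightarrow>
    (\<forall>z\<in>S. \<exists>D. (f has_derivative D) (at z) \<and> (\<forall>c v. D (c *s v) = c * D v))"

text \<open>A chart is its domain together with the coordinate map (arbitrary outside the domain).\<close>

type_synonym ('a, 'm) chart = "'a set \<times> ('a \<Rightarrow> complex ^ 'm)"

definition chart_inv :: "('a, 'm) chart \<Rightarrow> complex ^ 'm \<Rightarrow> 'a" where
  "chart_inv c = inv_into (fst c) (snd c)"

definition transition :: "('a, 'm) chart \<Rightarrow> ('a, 'm) chart \<Rightarrow> complex ^ 'm \<Rightarrow> complex ^ 'm" where
  "transition c d = snd d \<circ> chart_inv c"

definition complex_manifold :: "'a topology \<Rightarrow> ('a, 'm::finite) chart set \<Rightarrow> bool" where
  "complex_manifold M \<A> \<longleftrightarrow>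
    Hausdorff_space M \<and> second_countable M \<and> (\<Union>c\<in>\<A>. fst c) = topspace M \<and>
    (\<forall>c\<in>\<A>. openin M (fst c) \<and> open (snd c ` fst c) \<and>
       homeomorphic_map (subtopology M (fst c)) (top_of_set (snd c ` fst c)) (snd c)) \<and>
    (\<forall>c\<in>\<A>. \<forall>d\<in>\<A>. \<forall>a. holo_on (\<lambda>z. transition c d z $ a) (snd c ` (fst c \<inter> fst d)))"

definition charts_at :: "('a, 'm) chart set \<Rightarrow> 'a \<Rightarrow> ('a, 'm) chart set" where
  "charts_at \<A> p = {c \<in> \<A>. p \<in> fst c}"

definition holo_fun_on :: "('a, 'm::finite) chart set \<Rightarrow> ('a \<Rightarrow> complex) \<Rightarrow> 'a set \<Rightarrow> bool" where
  "holo_fun_on \<A> g W \<longleftrightarrow> (\<forall>c\<in>\<A>. holo_on (\<lambda>z. g (chart_inv c z)) (snd c ` (W \<inter> fst c)))"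

text \<open>
  A holomorphic tangent vector at \<open>p\<close> is the family of its component vectors in the charts at \<open>p\<close>,
  which transform by the derivatives of the coordinate changes.  Covectors are given by components
  in the same way.
\<close>

type_synonym ('a, 'm) tvec = "('a, 'm) chart \<Rightarrow> complex ^ 'm"

definition transition_deriv ::
  "('a, 'm::finite) chart \<Rightarrow> ('a, 'm) chart \<Rightarrow> 'a \<Rightarrow> complex ^ 'm \<Rightarrow> complex ^ 'm" where
  "transition_deriv c d p = frechet_derivative (transition c d) (at (snd c p))"

definition tangent_space :: "('a, 'm::finite) chart set \<Rightarrow> 'a \<Rightarrow> ('a, 'm) tvec set" where
  "tangent_space \<A> p = {v.
     (\<forall>c. c \<notin> charts_at \<A> p \<longrightarrow> v c = 0) \<and>
     (\<forall>c\<in>charts_at \<A> p. \<forall>d\<in>charts_at \<A> p. v d = transition_deriv c d p (v c))}"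

definition pairing :: "complex ^ 'm \<Rightarrow> complex ^ 'm::finite \<Rightarrow> complex" where
  "pairing \<alpha> v = (\<Sum>a\<in>UNIV. \<alpha> $ a * v $ a)"

definition covector_at :: "('a, 'm::finite) chart set \<Rightarrow> 'a \<Rightarrow> ('a, 'm) tvec \<Rightarrow> bool" where
  "covector_at \<A> p \<alpha> \<longleftrightarrow>
    (\<forall>c\<in>charts_at \<A> p. \<forall>d\<in>charts_at \<A> p. \<forall>v.
       pairing (\<alpha> c) v = pairing (\<alpha> d) (transition_deriv c d p v))"

definition holo_one_form_on ::
  "('a, 'm::finite) chart set \<Rightarrow> ('a \<Rightarrow> ('a, 'm) tvec) \<Rightarrow> 'a set \<Rightarrow> bool" where
  "holo_one_form_on \<A> \<alpha> W \<longleftrightarrow>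
    (\<forall>p\<in>W. covector_at \<A> p (\<alpha> p)) \<and>
    (\<forall>c\<in>\<A>. \<forall>a. holo_on (\<lambda>z. \<alpha> (chart_inv c z) c $ a) (snd c ` (W \<inter> fst c)))"


section \<open>Exterior powers of the tangent bundle\<close>

text \<open>
  The exterior power \<open>\<And>\<^sup>k V\<close> of a subspace \<open>V\<close> of the tangent space is realised by antisymmetric
  contravariant tensors, with
  \<open>v\<^sub>1 \<and> \<dots> \<and> v\<^sub>k = \<Sum>\<^sub>\<sigma> sgn \<sigma> \<cdot> v\<^bsub>\<sigma> 1\<^esub> \<otimes> \<dots> \<otimes> v\<^bsub>\<sigma> k\<^esub>\<close>;
  the component of a tensor in the chart \<open>c\<close> with indices \<open>is\<close> is its value at \<open>(c, is)\<close>.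
\<close>

type_synonym ('a, 'm) tensor_index = "('a, 'm) chart \<times> 'm list"

definition wedge ::
  "('a, 'm::finite) chart set \<Rightarrow> 'a \<Rightarrow> ('a, 'm) tvec list \<Rightarrow> ('a, 'm) tensor_index \<Rightarrow> complex" where
  "wedge \<A> p vs = (\<lambda>(c, is). if c \<in> charts_at \<A> p \<and> length is = length vs
     then Determinant.det (Matrix.mat (length vs) (length vs) (\<lambda>(i, j). (vs ! j) c $ (is ! i)))
     else 0)"

definition ext_power :: "('a, 'm::finite) chart set \<Rightarrow> 'a \<Rightarrow> nat \<Rightarrow> ('a, 'm) tvec set \<Rightarrow>
    (('a, 'm) tensor_index \<Rightarrow> complex) set" where
  "ext_power \<A> p k V = cfun.span {wedge \<A> p vs |vs. length vs = k \<and> set vs \<subseteq> V}"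

text \<open>
  The linear extension of a covector \<open>\<alpha>\<close> to the exterior power; the lemma below is the defining
  formula on decomposable elements.
\<close>

definition contract :: "('a, 'm::finite) tvec \<Rightarrow> (('a, 'm) tensor_index \<Rightarrow> complex) \<Rightarrow>
    ('a, 'm) tensor_index \<Rightarrow> complex" where
  "contract \<alpha> t = (\<lambda>(c, is). \<Sum>a\<in>UNIV. \<alpha> c $ a * t (c, a # is))"

lemma contract_linear:
  "contract \<alpha> (s + t) = contract \<alpha> s + contract \<alpha> t"
  "contract \<alpha> (cscale x t) = cscale x (contract \<alpha> t)"
  by (simp_all add: contract_def cscale_def fun_eq_iff distrib_left sum.distrib sum_distrib_left mult_ac)

lemma length_remove_nth: "j < length xs \<Longrightarrow> length (remove_nth j xs) = length xs - 1"
  by (auto simp: remove_nth_def)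

lemma nth_remove_nth:
  "j < length xs \<Longrightarrow> i < length xs - 1 \<Longrightarrow>
    remove_nth j xs ! i = xs ! (if i < j then i else Suc i)"
  by (auto simp: remove_nth_def nth_append min_def)

lemma contract_wedge:
  assumes "c \<in> charts_at \<A> p"
  shows "contract \<alpha> (wedge \<A> p vs) (c, is) =
    (\<Sum>j<length vs. (-1) ^ j * pairing (\<alpha> c) ((vs ! j) c) * wedge \<A> p (remove_nth j vs) (c, is))"
proof (cases "Suc (length is) = length vs")
  case False
  then show ?thesis
    by (auto simp: contract_def wedge_def length_remove_nth intro!: sum.neutral sum.neutral[symmetric])
next
  case True
  define k where "k = length vs"
  define A where "A = (\<lambda>a. Matrix.mat k k (\<lambda>(i, j). (vs ! j) c $ ((a # is) ! i)))"
  define B where "B = (\<lambda>j. wedge \<A> p (remove_nth j vs) (c, is))"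
  have k: "k = Suc (length is)" using True by (simp add: k_def)
  have del: "Determinant.det (mat_delete (A a) 0 j) = B j" if j: "j < k" for a j
  proof -
    have "mat_delete (A a) 0 j =
        Matrix.mat (length is) (length is) (\<lambda>(i, l). (remove_nth j vs ! l) c $ (is ! i))"
      using j k True
      by (intro eq_matI) (auto simp: mat_delete_def A_def k_def nth_remove_nth)
    then show ?thesis
      using assms j k True by (simp add: B_def wedge_def length_remove_nth k_def)
  qed
  have "wedge \<A> p vs (c, a # is) = (\<Sum>j<k. (vs ! j) c $ a * ((-1) ^ j * B j))" for a
  proof -
    have "wedge \<A> p vs (c, a # is) = Determinant.det (A a)"
      using assms True by (simp add: wedge_def A_def k_def)
    also have "\<dots> = (\<Sum>j<k. A a $$ (0, j) * cofactor (A a) 0 j)"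
      by (rule laplace_expansion_row) (auto simp: A_def k)
    also have "\<dots> = (\<Sum>j<k. (vs ! j) c $ a * ((-1) ^ j * B j))"
      using del by (intro sum.cong) (auto simp: cofactor_def A_def k)
    finally show ?thesis .
  qed
  then have "contract \<alpha> (wedge \<A> p vs) (c, is) =
      (\<Sum>a\<in>UNIV. \<Sum>j<k. \<alpha> c $ a * ((vs ! j) c $ a * ((-1) ^ j * B j)))"
    by (simp add: contract_def sum_distrib_left)
  also have "\<dots> = (\<Sum>j<k. \<Sum>a\<in>UNIV. \<alpha> c $ a * ((vs ! j) c $ a * ((-1) ^ j * B j)))"
    by (rule sum.swap)
  also have "\<dots> = (\<Sum>j<k. (-1) ^ j * pairing (\<alpha> c) ((vs ! j) c) * B j)"
    by (simp add: pairing_def sum_distrib_left sum_distrib_right mult_ac)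
  finally show ?thesis by (simp add: k_def B_def)
qed


section \<open>Contact structures\<close>

text \<open>
  Differential forms in a chart are given by their components, i.e. a form of degree \<open>p\<close> at a point
  is an antisymmetric function of \<open>p\<close> indices.
\<close>

type_synonym 'm form = "'m list \<Rightarrow> complex"

definition form_wedge :: "nat \<Rightarrow> nat \<Rightarrow> 'm form \<Rightarrow> 'm form \<Rightarrow> 'm form" where
  "form_wedge p q \<omega> \<eta> = (\<lambda>is. if length is = p + q
     then (\<Sum>\<sigma> | \<sigma> permutes {..<p + q}. of_int (sign \<sigma>) *
             \<omega> (map (\<lambda>i. is ! \<sigma> i) [0..<p]) * \<eta> (map (\<lambda>i. is ! \<sigma> i) [p..<p + q]))
          / (fact p * fact q)
     else 0)"

definition one_form_at :: "('a \<Rightarrow> ('a, 'm::finite) tvec) \<Rightarrow> ('a, 'm) chart \<Rightarrow> 'a \<Rightarrow> 'm form" where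
  "one_form_at \<alpha> c p = (\<lambda>is. case is of [a] \<Rightarrow> \<alpha> p c $ a | _ \<Rightarrow> 0)"

text \<open>Components \<open>\<partial>\<^sub>a \<alpha>\<^sub>b - \<partial>\<^sub>b \<alpha>\<^sub>a\<close> of \<open>d\<alpha>\<close>.\<close>

definition d_one_form_at ::
  "('a \<Rightarrow> ('a, 'm::finite) tvec) \<Rightarrow> ('a, 'm) chart \<Rightarrow> 'a \<Rightarrow> 'm form" where
  "d_one_form_at \<alpha> c p =
    (let D = (\<lambda>a b. frechet_derivative (\<lambda>z. \<alpha> (chart_inv c z) c $ b) (at (snd c p)) (axis a 1))
     in (\<lambda>is. case is of [a, b] \<Rightarrow> D a b - D b a | _ \<Rightarrow> 0))"

text \<open>The \<open>n\<close>-th exterior power of a form of degree 2.\<close>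

fun two_form_power :: "'m form \<Rightarrow> nat \<Rightarrow> 'm form" where
  "two_form_power \<omega> 0 = (\<lambda>is. if is = [] then 1 else 0)"
| "two_form_power \<omega> (Suc n) = form_wedge 2 (2 * n) \<omega> (two_form_power \<omega> n)"

text \<open>
  \<open>(M, \<gamma>)\<close> is a complex contact manifold of dimension \<open>2n + 1\<close>, where the contact structure is
  represented by the system \<open>{(U\<^sub>i, \<gamma>\<^sub>i)}\<close>, \<open>i \<in> I\<close>.  The \<open>f\<^sub>i\<^sub>j\<close> are determined by the \<open>\<gamma>\<^sub>i\<close>, since
  these vanish nowhere; they are the transition functions of the line bundle \<open>L\<close>.
\<close>

definition complex_contact_manifold :: "'a topology \<Rightarrow> ('a, 'm::finite) chart set \<Rightarrow> nat \<Rightarrow>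
    'i set \<Rightarrow> ('i \<Rightarrow> 'a set) \<Rightarrow> ('i \<Rightarrow> 'a \<Rightarrow> ('a, 'm) tvec) \<Rightarrow> ('i \<Rightarrow> 'i \<Rightarrow> 'a \<Rightarrow> complex) \<Rightarrow> bool"
  where
  "complex_contact_manifold M \<A> n I U \<gamma> f \<longleftrightarrow>
    complex_manifold M \<A> \<and> CARD('m) = 2 * n + 1 \<and>
    (\<forall>i\<in>I. openin M (U i)) \<and> (\<Union>i\<in>I. U i) = topspace M \<and>
    (\<forall>i\<in>I. holo_one_form_on \<A> (\<gamma> i) (U i) \<and>
       (\<forall>p\<in>U i. \<forall>c\<in>charts_at \<A> p.
          form_wedge (2 * n) 1 (two_form_power (d_one_form_at (\<gamma> i) c p) n) (one_form_at (\<gamma> i) c p)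
            \<noteq> (\<lambda>_. 0))) \<and>
    (\<forall>i\<in>I. \<forall>j\<in>I. holo_fun_on \<A> (f i j) (U i \<inter> U j) \<and>
       (\<forall>p\<in>U i \<inter> U j. \<forall>c\<in>charts_at \<A> p. \<gamma> i p c = f i j p *s \<gamma> j p c))"

definition contact_kernel :: "('a, 'm::finite) chart set \<Rightarrow>
    'i set \<Rightarrow> ('i \<Rightarrow> 'a set) \<Rightarrow> ('i \<Rightarrow> 'a \<Rightarrow> ('a, 'm) tvec) \<Rightarrow> 'a \<Rightarrow> ('a, 'm) tvec set" where
  "contact_kernel \<A> I U \<gamma> p = {v \<in> tangent_space \<A> p.
     \<forall>i\<in>I. p \<in> U i \<longrightarrow> (\<forall>c\<in>charts_at \<A> p. pairing (\<gamma> i p c) (v c) = 0)}"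

text \<open>
  \<open>\<O>(E)\<close> for a holomorphic subbundle \<open>E\<close> of an exterior power of the tangent bundle, given by its
  fibres.
\<close>

definition holo_sections :: "('a, 'm::finite) chart set \<Rightarrow>
    ('a \<Rightarrow> (('a, 'm) tensor_index \<Rightarrow> complex) set) \<Rightarrow> ('a, ('a, 'm) tensor_index) presheaf" where
  "holo_sections \<A> E W = {s.
     (\<forall>p\<in>W. s p \<in> E p) \<and> (\<forall>p. p \<notin> W \<longrightarrow> s p = 0) \<and>
     (\<forall>c\<in>\<A>. \<forall>is. holo_on (\<lambda>z. s (chart_inv c z) (c, is)) (snd c ` (W \<inter> fst c)))}"

text \<open>
  The fibre of \<open>L \<otimes> E\<close> consists of the families \<open>(u\<^sub>i)\<close> in \<open>E\<close>, indexed by the \<open>i\<close> with \<open>p \<in> U\<^sub>i\<close>,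
  that satisfy \<open>u\<^sub>i = f\<^sub>i\<^sub>j u\<^sub>j\<close>; the component of \<open>u\<^sub>i\<close> with index \<open>b\<close> is \<open>u (i, b)\<close>.
\<close>

definition twisted_fibre :: "'i set \<Rightarrow> ('i \<Rightarrow> 'a set) \<Rightarrow> ('i \<Rightarrow> 'i \<Rightarrow> 'a \<Rightarrow> complex) \<Rightarrow>
    ('a \<Rightarrow> ('b \<Rightarrow> complex) set) \<Rightarrow> 'a \<Rightarrow> ('i \<times> 'b \<Rightarrow> complex) set" where
  "twisted_fibre I U f E p = {u.
     (\<forall>i\<in>I. p \<in> U i \<longrightarrow> (\<lambda>b. u (i, b)) \<in> E p) \<and>
     (\<forall>i b. \<not> (i \<in> I \<and> p \<in> U i) \<longrightarrow> u (i, b) = 0) \<and>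
     (\<forall>i\<in>I. \<forall>j\<in>I. p \<in> U i \<inter> U j \<longrightarrow> (\<forall>b. u (i, b) = f i j p * u (j, b)))}"

definition holo_twisted_sections :: "('a, 'm::finite) chart set \<Rightarrow>
    'i set \<Rightarrow> ('i \<Rightarrow> 'a set) \<Rightarrow> ('i \<Rightarrow> 'i \<Rightarrow> 'a \<Rightarrow> complex) \<Rightarrow>
    ('a \<Rightarrow> (('a, 'm) tensor_index \<Rightarrow> complex) set) \<Rightarrow>
    ('a, 'i \<times> ('a, 'm) tensor_index) presheaf" where
  "holo_twisted_sections \<A> I U f E W = {s.
     (\<forall>p\<in>W. s p \<in> twisted_fibre I U f E p) \<and> (\<forall>p. p \<notin> W \<longrightarrow> s p = 0) \<and>
     (\<forall>i\<in>I. \<forall>c\<in>\<A>. \<forall>is.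
        holo_on (\<lambda>z. s (chart_inv c z) (i, c, is)) (snd c ` (W \<inter> U i \<inter> fst c)))}"

text \<open>
  The three sheaves and two maps of the sequence.  The argument \<open>k\<close> of the third sheaf is the degree
  of the exterior power.
\<close>

definition O_ext_kernel :: "('a, 'm::finite) chart set \<Rightarrow> 'i set \<Rightarrow> ('i \<Rightarrow> 'a set) \<Rightarrow>
    ('i \<Rightarrow> 'a \<Rightarrow> ('a, 'm) tvec) \<Rightarrow> nat \<Rightarrow> ('a, ('a, 'm) tensor_index) presheaf" where
  "O_ext_kernel \<A> I U \<gamma> k =
    holo_sections \<A> (\<lambda>p. ext_power \<A> p k (contact_kernel \<A> I U \<gamma> p))"

definition O_ext_tangent ::
  "('a, 'm::finite) chart set \<Rightarrow> nat \<Rightarrow> ('a, ('a, 'm) tensor_index) presheaf" where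
  "O_ext_tangent \<A> k = holo_sections \<A> (\<lambda>p. ext_power \<A> p k (tangent_space \<A> p))"

definition O_L_ext_kernel :: "('a, 'm::finite) chart set \<Rightarrow> 'i set \<Rightarrow> ('i \<Rightarrow> 'a set) \<Rightarrow>
    ('i \<Rightarrow> 'a \<Rightarrow> ('a, 'm) tvec) \<Rightarrow> ('i \<Rightarrow> 'i \<Rightarrow> 'a \<Rightarrow> complex) \<Rightarrow> nat \<Rightarrow>
    ('a, 'i \<times> ('a, 'm) tensor_index) presheaf" where
  "O_L_ext_kernel \<A> I U \<gamma> f k =
    holo_twisted_sections \<A> I U f (\<lambda>p. ext_power \<A> p k (contact_kernel \<A> I U \<gamma> p))"

definition inclusion_map :: "('a, 'b, 'b) presheaf_map" where
  "inclusion_map W s = s"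

definition contact_map :: "'i set \<Rightarrow> ('i \<Rightarrow> 'a set) \<Rightarrow> ('i \<Rightarrow> 'a \<Rightarrow> ('a, 'm::finite) tvec) \<Rightarrow>
    ('a, ('a, 'm) tensor_index, 'i \<times> ('a, 'm) tensor_index) presheaf_map" where
  "contact_map I U \<gamma> W s =
    (\<lambda>p (i, b). if i \<in> I \<and> p \<in> U i then contract (\<gamma> i p) (s p) b else 0)"

end

theory Submission
  imports Defs "HOL-Complex_Analysis.Cauchy_Integral_Formula"
begin

text \<open>
  The splitting is a first-order differential operator.  Choose a chart and a local contact form
  \<open>\<gamma>\<close>; let \<open>E\<close> be its Reeb field, \<open>\<pi>\<close> the bivector inverse to \<open>d\<gamma>\<close> on \<open>Ker \<gamma>\<close>, \<open>P\<close> the wedge product with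
  \<open>\<pi>\<close>, \<open>\<Lambda>\<close> the contraction with \<open>d\<gamma>\<close>, \<open>div\<close> the coordinate divergence of multivector fields and
  \<open>V = div \<pi>\<close>.  For a section \<open>x\<close> of \<open>\<And>\<^sup>q Ker \<gamma>\<close> put
  \<open>S x = (n + 2) (div (P x) - V \<and> x + E \<and> x) - P ((n + 1) div x + d\<gamma>(-, V) \<lrcorner> x)\<close>.
  This depends neither on the chart nor, when \<open>x\<close> is rescaled together with \<open>\<gamma>\<close>, on the contact form,
  so that \<open>S\<close> is defined on sections of \<open>L \<otimes> \<And>\<^sup>q Ker \<gamma>\<close>.  Moreover \<open>\<gamma> (S x) = A x\<close> for
  \<open>A = P \<Lambda> + (n + 2) (q + 1)\<close>.  Since \<open>[\<Lambda>, P] = q - n\<close> in degree \<open>q\<close>, the eigenvalues of \<open>A\<close> are among the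
  numbers \<open>(n + 2) (q + 1) - r (n - q + r + 1)\<close> with \<open>2 r \<le> q\<close>, which are positive.  Hence
  \<open>u \<mapsto> S (A\<^sup>-\<^sup>1 u)\<close> is a global right inverse of \<open>\<gamma>\<close>.  Exactness in cohomology follows because maps of
  sheaves act functorially on Cech cohomology.
\<close>

section \<open>Cech cohomology of a split sequence\<close>

text \<open>Locally the wedge product with the Reeb field is a right inverse of the contact map.
  Passing from \<gamma> to h \<gamma> subtracts from it the wedge product with the vector that the
  bivector makes of dh / h, so these local inverses do not glue. A divergence of a rescaled tensor
  also produces dh / h and can absorb the defect; this is where derivatives enter and why the
  splitting is linear only over the constants. Two groups of terms are each insensitive to
  rescaling: \<open>div (P x) - V \<and> x + E \<and> x\<close>, and \<open>P\<close> applied to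
  \<open>(n + 1) div x\<close> plus the contraction with d\<gamma>(-, V). A coordinate change alters
  divergences by the logarithmic derivative \<tau> of the Jacobian determinant. It adds
  \<open>P\<close> of the contraction of \<open>x\<close> with \<tau> once to the first group and
  \<open>n + 2\<close> times to the second, which fixes the ratio of the two. Although
  \<open>S\<close> differentiates, \<gamma> after \<open>S\<close> does not: if \<gamma> annihilates
  \<open>x\<close>, contracting \<gamma> with a divergence only leaves a contraction with d\<gamma>.
  So the remaining correction is pointwise linear algebra.\<close>

lemma restr_add: "restr V (s + t) = restr V s + restr V t"
  and restr_diff: "restr V (s - t) = restr V s - restr V t"
  and restr_zero [simp]: "restr V 0 = 0"
  and restr_sscale: "restr V (sscale c s) = sscale c (restr V s)"
  and restr_restr: "restr V (restr W s) = restr (V \<inter> W) s"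
  by (auto simp: restr_def sscale_def cscale_def fun_eq_iff)

lemma restr_sum: "restr V (\<Sum>j\<in>J. s j) = (\<Sum>j\<in>J. restr V (s j))"
  by (induction J rule: infinite_finite_induct)
    (simp_all only: sum.infinite sum.empty sum.insert restr_zero restr_add not_False_eq_True)

lemma sscale_add: "sscale c (s + t) = sscale c s + sscale c t"
  and sscale_diff: "sscale c (s - t) = sscale c s - sscale c t"
  and sscale_zero [simp]: "sscale c 0 = 0" "sscale 0 s = 0"
  and sscale_minus_one: "sscale (- 1) s = - s"
  by (simp_all add: sscale_def cscale_def fun_eq_iff algebra_simps)

lemma
  assumes "csheaf M F" "openin M U"
  shows csheaf_add: "s \<in> F U \<Longrightarrow> t \<in> F U \<Longrightarrow> s + t \<in> F U"
    and csheaf_zero: "0 \<in> F U"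
    and csheaf_sscale: "s \<in> F U \<Longrightarrow> sscale c s \<in> F U"
    and csheaf_restr: "openin M V \<Longrightarrow> V \<subseteq> U \<Longrightarrow> s \<in> F U \<Longrightarrow> restr V s \<in> F V"
    and csheaf_support: "s \<in> F U \<Longrightarrow> x \<notin> U \<Longrightarrow> s x = 0"
proof -
  note U = conjunct1[OF assms(1)[unfolded csheaf_def], THEN spec, THEN mp, OF assms(2)]
  show "s \<in> F U \<Longrightarrow> t \<in> F U \<Longrightarrow> s + t \<in> F U" "0 \<in> F U" "s \<in> F U \<Longrightarrow> sscale c s \<in> F U"
    "s \<in> F U \<Longrightarrow> x \<notin> U \<Longrightarrow> s x = 0"
    using U by (elim conjE, blast)+
  show "openin M V \<Longrightarrow> V \<subseteq> U \<Longrightarrow> s \<in> F U \<Longrightarrow> restr V s \<in> F V"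
    using U by (elim conjE, blast)
qed

lemma csheafI:
  assumes "\<And>U s x. openin M U \<Longrightarrow> s \<in> F U \<Longrightarrow> x \<notin> U \<Longrightarrow> s x = 0"
    and "\<And>U. openin M U \<Longrightarrow> 0 \<in> F U"
    and "\<And>U s t. openin M U \<Longrightarrow> s \<in> F U \<Longrightarrow> t \<in> F U \<Longrightarrow> s + t \<in> F U"
    and "\<And>U c s. openin M U \<Longrightarrow> s \<in> F U \<Longrightarrow> sscale c s \<in> F U"
    and "\<And>U V s. openin M U \<Longrightarrow> openin M V \<Longrightarrow> V \<subseteq> U \<Longrightarrow> s \<in> F U \<Longrightarrow> restr V s \<in> F V"
    and "\<And>\<U> s. \<forall>U\<in>\<U>. openin M U \<Longrightarrow> \<forall>x. x \<notin> \<Union>\<U> \<longrightarrow> s x = 0 \<Longrightarrow>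
      \<forall>U\<in>\<U>. restr U s \<in> F U \<Longrightarrow> s \<in> F (\<Union>\<U>)"
  shows "csheaf M F"
  unfolding csheaf_def image_subset_iff using assms by auto

lemma csheaf_diff:
  assumes "csheaf M F" "openin M U" "s \<in> F U" "t \<in> F U" shows "s - t \<in> F U"
  using csheaf_add[OF assms(1,2,3) csheaf_sscale[OF assms(1,2,4), of "- 1"]]
  unfolding sscale_minus_one diff_conv_add_uminus .

lemma csheaf_sum:
  assumes "csheaf M F" "openin M U" "\<And>j. j \<in> J \<Longrightarrow> s j \<in> F U" shows "(\<Sum>j\<in>J. s j) \<in> F U"
  using assms(3)
  by (induction J rule: infinite_finite_induct) (auto intro: csheaf_zero csheaf_add assms)

lemma restr_id: "csheaf M F \<Longrightarrow> openin M U \<Longrightarrow> s \<in> F U \<Longrightarrow> restr U s = s"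
  using csheaf_support by (fastforce simp: restr_def)

context
  fixes M :: "'a topology" and F :: "('a, 'b) presheaf" and G :: "('a, 'c) presheaf" and \<Phi>
  assumes F: "csheaf M F" and G: "csheaf M G" and hom: "sheaf_hom M F G \<Phi>"
begin

lemma
  assumes U: "openin M U" and s: "s \<in> F U"
  shows hom_in: "\<Phi> U s \<in> G U"
    and hom_add: "t \<in> F U \<Longrightarrow> \<Phi> U (s + t) = \<Phi> U s + \<Phi> U t"
    and hom_sscale: "\<Phi> U (sscale c s) = sscale c (\<Phi> U s)"
    and hom_restr: "openin M V \<Longrightarrow> V \<subseteq> U \<Longrightarrow> \<Phi> V (restr V s) = restr V (\<Phi> U s)"
proof -
  note U = hom[unfolded sheaf_hom_def, THEN spec, THEN mp, OF U]
  show "\<Phi> U s \<in> G U" "t \<in> F U \<Longrightarrow> \<Phi> U (s + t) = \<Phi> U s + \<Phi> U t"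
    "\<Phi> U (sscale c s) = sscale c (\<Phi> U s)"
    "openin M V \<Longrightarrow> V \<subseteq> U \<Longrightarrow> \<Phi> V (restr V s) = restr V (\<Phi> U s)"
    using U s by auto
qed

lemma hom_zero: "openin M U \<Longrightarrow> \<Phi> U 0 = 0"
  using hom_sscale[of U 0 0] csheaf_zero[OF F, of U] by simp

lemma hom_diff:
  assumes "openin M U" "s \<in> F U" "t \<in> F U" shows "\<Phi> U (s - t) = \<Phi> U s - \<Phi> U t"
  using hom_add[OF assms(1,2) csheaf_sscale[OF F assms(1,3), of "- 1"]]
    hom_sscale[OF assms(1,3), of "- 1"]
  by (simp add: sscale_minus_one)

lemma hom_sum:
  assumes "openin M U" "\<And>j. j \<in> J \<Longrightarrow> s j \<in> F U" shows "\<Phi> U (\<Sum>j\<in>J. s j) = (\<Sum>j\<in>J. \<Phi> U (s j))"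
  using assms(2)
  by (induction J rule: infinite_finite_induct)
    (auto simp: hom_zero hom_add csheaf_sum[OF F] assms(1))

end

lemma openin_supp:
  assumes "pointed_cover M U" "xs \<in> simplices M p" shows "openin M (supp U xs)"
  unfolding supp_def using assms
  by (intro openin_Inter[of "U ` set xs" M, simplified]) (auto simp: pointed_cover_def simplices_def)

lemma remove_nth_simplex: "xs \<in> simplices M (Suc p) \<Longrightarrow> j < p + 2 \<Longrightarrow> remove_nth j xs \<in> simplices M p"
  by (auto simp: simplices_def length_remove_nth) (auto simp: remove_nth_def dest: in_set_takeD in_set_dropD)

lemma supp_remove_nth: "supp U xs \<subseteq> supp U (remove_nth j xs)"
  by (auto simp: supp_def remove_nth_def dest: in_set_takeD in_set_dropD)

lemma supp_mono: "\<forall>x\<in>topspace M. W x \<subseteq> U x \<Longrightarrow> xs \<in> simplices M p \<Longrightarrow> supp W xs \<subseteq> supp U xs"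
  unfolding supp_def simplices_def by blast

lemma cochains_in: "c \<in> cochains M F p U \<Longrightarrow> xs \<in> simplices M p \<Longrightarrow> c xs \<in> F (supp U xs)"
  and cochains_outside: "c \<in> cochains M F p U \<Longrightarrow> xs \<notin> simplices M p \<Longrightarrow> c xs = 0"
  by (auto simp: cochains_def)

lemma coboundary_add: "coboundary M p U (c + d) = coboundary M p U c + coboundary M p U d"
  and coboundary_diff: "coboundary M p U (c - d) = coboundary M p U c - coboundary M p U d"
  and coboundary_zero: "coboundary M p U 0 = 0"
  by (auto simp: coboundary_def fun_eq_iff restr_add restr_diff sscale_add sscale_diff sum.distrib sum_subtractf)

lemma refine_diff: "refine W (c - d) = refine W c - refine W d"
  and refine_zero: "refine W 0 = 0"
  by (auto simp: refine_def fun_eq_iff restr_def)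

context
  fixes M :: "'a topology" and F :: "('a, 'b) presheaf"
  assumes F: "csheaf M F"
begin

lemma cochains_zero: "pointed_cover M U \<Longrightarrow> 0 \<in> cochains M F p U"
  using csheaf_zero[OF F openin_supp] by (auto simp: cochains_def)

lemma cochains_add: "pointed_cover M U \<Longrightarrow> c \<in> cochains M F p U \<Longrightarrow> d \<in> cochains M F p U \<Longrightarrow> c + d \<in> cochains M F p U"
  and cochains_diff: "pointed_cover M U \<Longrightarrow> c \<in> cochains M F p U \<Longrightarrow> d \<in> cochains M F p U \<Longrightarrow> c - d \<in> cochains M F p U"
  using csheaf_add[OF F openin_supp] csheaf_diff[OF F openin_supp] by (auto simp: cochains_def)

lemma refine_in:
  assumes "pointed_cover M U" "pointed_cover M W" "\<forall>x\<in>topspace M. W x \<subseteq> U x" "c \<in> cochains M F p U"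
  shows "refine W c \<in> cochains M F p W"
proof -
  have "restr (supp W xs) (c xs) \<in> F (supp W xs)" if "xs \<in> simplices M p" for xs
    using csheaf_restr[OF F openin_supp[OF assms(1) that] openin_supp[OF assms(2) that]
        supp_mono[OF assms(3) that] cochains_in[OF assms(4) that]] .
  then show ?thesis using assms(4) by (auto simp: cochains_def refine_def)
qed

lemma coboundary_refine:
  assumes "\<forall>x\<in>topspace M. W x \<subseteq> U x"
  shows "coboundary M p W (refine W c) = refine W (coboundary M p U c)"
proof
  fix xs
  show "coboundary M p W (refine W c) xs = refine W (coboundary M p U c) xs"
  proof (cases "xs \<in> simplices M (Suc p)")
    case True
    \<comment> \<open>Every term ends up restricted to \<open>supp W xs\<close>, so the intermediate
      restriction to the support of a face leaves no trace.\<close>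
    have "supp W xs \<inter> supp W (remove_nth j xs) = supp W xs \<inter> supp U xs" for j
      using supp_remove_nth[of W xs j] supp_mono[OF assms True] by auto
    then show ?thesis
      using True by (simp add: coboundary_def refine_def restr_sum restr_restr restr_sscale del: sum.lessThan_Suc)
  qed (simp add: coboundary_def refine_def)
qed

lemma refine_refine:
  assumes "\<forall>x\<in>topspace M. W' x \<subseteq> W x" "c \<in> cochains M F p U"
  shows "refine W' (refine W c) = refine W' c"
proof
  fix xs
  show "refine W' (refine W c) xs = refine W' c xs"
  proof (cases "xs \<in> simplices M p")
    case True
    then have "supp W' xs \<inter> supp W xs = supp W' xs" using supp_mono[OF assms(1)] by blast
    then show ?thesis by (simp add: refine_def restr_restr)
  next
    case False
    then have "c xs = 0" by (rule cochains_outside[OF assms(2)])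
    then show ?thesis by (simp add: refine_def restr_def fun_eq_iff)
  qed
qed

lemma coboundaries_zero: "pointed_cover M U \<Longrightarrow> 0 \<in> coboundaries M F p U"
  using cochains_zero coboundary_zero by (auto simp: coboundaries_def split: nat.split intro!: rev_image_eqI)

lemma coboundaries_add:
  "pointed_cover M U \<Longrightarrow> c \<in> coboundaries M F p U \<Longrightarrow> d \<in> coboundaries M F p U \<Longrightarrow> c + d \<in> coboundaries M F p U"
  and coboundaries_diff:
  "pointed_cover M U \<Longrightarrow> c \<in> coboundaries M F p U \<Longrightarrow> d \<in> coboundaries M F p U \<Longrightarrow> c - d \<in> coboundaries M F p U"
  using cochains_add cochains_diff
  by (auto simp: coboundaries_def split: nat.splits simp flip: coboundary_add coboundary_diff)

lemma coboundaries_refine: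
  assumes "pointed_cover M U" "pointed_cover M W" "\<forall>x\<in>topspace M. W x \<subseteq> U x" "c \<in> coboundaries M F p U"
  shows "refine W c \<in> coboundaries M F p W"
proof (cases p)
  case 0
  then show ?thesis using assms(4) by (simp add: coboundaries_def refine_zero)
next
  case (Suc q)
  then obtain e where "e \<in> cochains M F q U" "c = coboundary M q U e"
    using assms(4) by (auto simp: coboundaries_def)
  then have "refine W c = coboundary M q W (refine W e)" "refine W e \<in> cochains M F q W"
    using refine_in[OF assms(1,2,3)] coboundary_refine[OF assms(3), of q e] by (metis, metis)
  then show ?thesis by (simp add: Suc coboundaries_def)
qed

lemma cech_relI:
  assumes "(U, c) \<in> cech_reps M F p" "(V, d) \<in> cech_reps M F p" "pointed_cover M W"
    "\<forall>x\<in>topspace M. W x \<subseteq> U x \<inter> V x" "refine W c - refine W d \<in> coboundaries M F p W"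
  shows "((U, c), (V, d)) \<in> cech_rel M F p"
  using assms by (auto simp: cech_rel_def)

text \<open>Transitivity passes to the pointwise intersection of the two refining covers. Since
  covers are indexed by points, refinement is plain restriction and composes strictly; no refinement
  map has to be chosen.\<close>

lemma equiv_cech_rel: "equiv (cech_reps M F p) (cech_rel M F p)"
proof (rule equivI)
  show "cech_rel M F p \<subseteq> cech_reps M F p \<times> cech_reps M F p" by (auto simp: cech_rel_def)
  show "refl_on (cech_reps M F p) (cech_rel M F p)"
  proof (rule refl_onI)
    fix r assume r: "r \<in> cech_reps M F p"
    obtain U c where [simp]: "r = (U, c)" by (cases r)
    have "pointed_cover M U" using r by (simp add: cech_reps_def)
    then show "(r, r) \<in> cech_rel M F p"
      using r coboundaries_zero[of U p] by (auto intro!: cech_relI[of U c p U c U])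
  qed
  show "sym (cech_rel M F p)"
  proof (rule symI)
    fix r s assume "(r, s) \<in> cech_rel M F p"
    then obtain U c V d W where rs: "r = (U, c)" "s = (V, d)" "r \<in> cech_reps M F p" "s \<in> cech_reps M F p"
      "pointed_cover M W" "\<forall>x\<in>topspace M. W x \<subseteq> U x \<inter> V x" "refine W c - refine W d \<in> coboundaries M F p W"
      by (auto simp: cech_rel_def)
    then have "refine W d - refine W c \<in> coboundaries M F p W"
      using coboundaries_diff[OF _ coboundaries_zero] by fastforce
    then show "(s, r) \<in> cech_rel M F p"
      using rs by (auto intro!: cech_relI[of V d p U c W])
  qed
  show "trans (cech_rel M F p)"
  proof (rule transI)
    fix r s t assume "(r, s) \<in> cech_rel M F p" "(s, t) \<in> cech_rel M F p"
    then obtain U c V d X e W W' where rs: "r = (U, c)" "s = (V, d)" "t = (X, e)"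
      "r \<in> cech_reps M F p" "s \<in> cech_reps M F p" "t \<in> cech_reps M F p"
      "pointed_cover M W" "\<forall>x\<in>topspace M. W x \<subseteq> U x \<inter> V x" "refine W c - refine W d \<in> coboundaries M F p W"
      "pointed_cover M W'" "\<forall>x\<in>topspace M. W' x \<subseteq> V x \<inter> X x" "refine W' d - refine W' e \<in> coboundaries M F p W'"
      by (auto simp: cech_rel_def)
    define Y where "Y = (\<lambda>x. W x \<inter> W' x)"
    have Y: "pointed_cover M Y" using rs by (auto simp: pointed_cover_def Y_def)
    have coch: "c \<in> cochains M F p U" "d \<in> cochains M F p V" "e \<in> cochains M F p X"
      using rs by (auto simp: cech_reps_def cocycles_def)
    have "refine Y (refine W c - refine W d) + refine Y (refine W' d - refine W' e) \<in> coboundaries M F p Y"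
      using rs Y by (intro coboundaries_add coboundaries_refine[of W] coboundaries_refine[of W']) (auto simp: Y_def)
    also have "refine Y (refine W c - refine W d) + refine Y (refine W' d - refine W' e) = refine Y c - refine Y e"
      using refine_refine[OF _ coch(1), of Y W] refine_refine[OF _ coch(2), of Y W]
        refine_refine[OF _ coch(2), of Y W'] refine_refine[OF _ coch(3), of Y W']
      by (simp add: refine_diff Y_def)
    finally have "refine Y c - refine Y e \<in> coboundaries M F p Y" .
    moreover have "\<forall>x\<in>topspace M. Y x \<subseteq> U x \<inter> X x"
      using rs(8,11) unfolding Y_def by blast
    ultimately show "(r, t) \<in> cech_rel M F p"
      using rs(4,6) Y unfolding rs(1,3) by (intro cech_relI)
  qed
qed

end

section \<open>Functoriality of Cech cohomology\<close>

context
  fixes M :: "'a topology" and F :: "('a, 'b) presheaf" and G :: "('a, 'c) presheaf" and \<Phi>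
  assumes F: "csheaf M F" and G: "csheaf M G" and hom: "sheaf_hom M F G \<Phi>"
begin

lemma cochain_map_in:
  assumes "pointed_cover M U" "c \<in> cochains M F p U"
  shows "cochain_map M p \<Phi> U c \<in> cochains M G p U"
  using hom_in[OF F G hom openin_supp[OF assms(1)] cochains_in[OF assms(2)]]
  by (auto simp: cochain_map_def cochains_def)

lemma cochain_map_diff:
  assumes "pointed_cover M U" "c \<in> cochains M F p U" "d \<in> cochains M F p U"
  shows "cochain_map M p \<Phi> U (c - d) = cochain_map M p \<Phi> U c - cochain_map M p \<Phi> U d"
  using hom_diff[OF F G hom openin_supp[OF assms(1)] cochains_in[OF assms(2)] cochains_in[OF assms(3)]]
  by (auto simp: cochain_map_def fun_eq_iff)

lemma cochain_map_zero: "pointed_cover M U \<Longrightarrow> cochain_map M p \<Phi> U 0 = 0"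
  using hom_zero[OF F G hom openin_supp] by (auto simp: cochain_map_def fun_eq_iff)

lemma cochain_map_coboundary:
  assumes U: "pointed_cover M U" and c: "c \<in> cochains M F p U"
  shows "cochain_map M (Suc p) \<Phi> U (coboundary M p U c) = coboundary M p U (cochain_map M p \<Phi> U c)"
proof
  fix xs
  show "cochain_map M (Suc p) \<Phi> U (coboundary M p U c) xs = coboundary M p U (cochain_map M p \<Phi> U c) xs"
  proof (cases "xs \<in> simplices M (Suc p)")
    case True
    note op = openin_supp[OF U True] openin_supp[OF U remove_nth_simplex[OF True]]
    have r: "restr (supp U xs) (c (remove_nth j xs)) \<in> F (supp U xs)" if "j < p + 2" for j
      using that op supp_remove_nth[of U xs j] cochains_in[OF c remove_nth_simplex[OF True that]]
      by (intro csheaf_restr[OF F]) auto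
    have "\<Phi> (supp U xs) (\<Sum>j<p + 2. sscale ((-1) ^ j) (restr (supp U xs) (c (remove_nth j xs)))) =
        (\<Sum>j<p + 2. \<Phi> (supp U xs) (sscale ((-1) ^ j) (restr (supp U xs) (c (remove_nth j xs)))))"
      using op r by (intro hom_sum[OF F G hom] csheaf_sscale[OF F]) auto
    also have "\<dots> = (\<Sum>j<p + 2. sscale ((-1) ^ j) (restr (supp U xs) (\<Phi> (supp U (remove_nth j xs)) (c (remove_nth j xs)))))"
      using op r supp_remove_nth[of U xs] cochains_in[OF c remove_nth_simplex[OF True]]
      by (intro sum.cong refl) (simp add: hom_sscale[OF F G hom] hom_restr[OF F G hom op(2)])
    finally show ?thesis
      using True remove_nth_simplex[OF True] by (simp add: cochain_map_def coboundary_def)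
  qed (simp add: cochain_map_def coboundary_def)
qed

lemma cochain_map_refine:
  assumes "pointed_cover M U" "pointed_cover M W" "\<forall>x\<in>topspace M. W x \<subseteq> U x" "c \<in> cochains M F p U"
  shows "cochain_map M p \<Phi> W (refine W c) = refine W (cochain_map M p \<Phi> U c)"
proof
  fix xs
  show "cochain_map M p \<Phi> W (refine W c) xs = refine W (cochain_map M p \<Phi> U c) xs"
  proof (cases "xs \<in> simplices M p")
    case True
    then show ?thesis
      using hom_restr[OF F G hom openin_supp[OF assms(1) True] cochains_in[OF assms(4) True]
          openin_supp[OF assms(2) True] supp_mono[OF assms(3) True]]
      by (simp add: cochain_map_def refine_def)
  qed (simp add: cochain_map_def refine_def restr_def fun_eq_iff)
qed

lemma cochain_map_coboundaries:
  assumes "pointed_cover M U" "c \<in> coboundaries M F p U"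
  shows "cochain_map M p \<Phi> U c \<in> coboundaries M G p U"
proof (cases p)
  case 0
  then show ?thesis using assms by (simp add: coboundaries_def cochain_map_zero)
next
  case (Suc q)
  then show ?thesis
    using assms cochain_map_coboundary[OF assms(1)] cochain_map_in[OF assms(1)]
    by (auto simp: coboundaries_def)
qed

lemma cochain_map_reps:
  assumes "(U, c) \<in> cech_reps M F p" shows "(U, cochain_map M p \<Phi> U c) \<in> cech_reps M G p"
proof -
  have "pointed_cover M U" "c \<in> cochains M F p U" "coboundary M p U c = 0"
    using assms by (auto simp: cech_reps_def cocycles_def)
  then show ?thesis
    using cochain_map_in[of U c p] cochain_map_coboundary[of U c p] cochain_map_zero[of U "Suc p"]
    by (simp add: cech_reps_def cocycles_def)
qed

lemma cochain_map_rel: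
  assumes "((U, c), (V, d)) \<in> cech_rel M F p"
  shows "((U, cochain_map M p \<Phi> U c), (V, cochain_map M p \<Phi> V d)) \<in> cech_rel M G p"
proof -
  obtain W where W: "pointed_cover M W" "\<forall>x\<in>topspace M. W x \<subseteq> U x \<inter> V x"
    "refine W c - refine W d \<in> coboundaries M F p W"
    and reps: "(U, c) \<in> cech_reps M F p" "(V, d) \<in> cech_reps M F p"
    using assms by (auto simp: cech_rel_def)
  have cd: "pointed_cover M U" "c \<in> cochains M F p U" "pointed_cover M V" "d \<in> cochains M F p V"
    using reps by (auto simp: cech_reps_def cocycles_def)
  have "refine W (cochain_map M p \<Phi> U c) - refine W (cochain_map M p \<Phi> V d) =
      cochain_map M p \<Phi> W (refine W c - refine W d)"
    using cd W refine_in[OF F cd(1) W(1) _ cd(2)] refine_in[OF F cd(3) W(1) _ cd(4)]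
      cochain_map_refine[OF cd(1) W(1) _ cd(2)] cochain_map_refine[OF cd(3) W(1) _ cd(4)]
    by (subst cochain_map_diff) auto
  also have "\<dots> \<in> coboundaries M G p W" by (rule cochain_map_coboundaries[OF W(1,3)])
  finally show ?thesis using W cochain_map_reps reps by (intro cech_relI[OF G]) auto
qed

text \<open>\<open>cohomology_map\<close> is a union over all representatives of a class. By
  \<open>cochain_map_rel\<close> their images lie in one class, so any single representative
  computes it.\<close>

lemma cohomology_map_class:
  assumes "(U, c) \<in> cech_reps M F p"
  shows "cohomology_map M G \<Phi> p (cech_rel M F p `` {(U, c)}) = cech_rel M G p `` {(U, cochain_map M p \<Phi> U c)}"
proof -
  have "cech_rel M G p `` {(V, cochain_map M p \<Phi> V d)} = cech_rel M G p `` {(U, cochain_map M p \<Phi> U c)}"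
    if "((U, c), (V, d)) \<in> cech_rel M F p" for V d
    using equiv_class_eq[OF equiv_cech_rel[OF G] cochain_map_rel[OF that]] by simp
  moreover have "((U, c), (U, c)) \<in> cech_rel M F p"
    using equiv_class_self[OF equiv_cech_rel[OF F] assms] by simp
  ultimately show ?thesis unfolding cohomology_map_def by fast
qed

lemma cohomology_map_in: "X \<in> cohomology M F p \<Longrightarrow> cohomology_map M G \<Phi> p X \<in> cohomology M G p"
  unfolding cohomology_def
  by (erule quotientE) (auto simp: cohomology_map_class intro!: quotientI cochain_map_reps)

end

section \<open>Split sequences in cohomology\<close>

lemma cohomology_cases:
  assumes "X \<in> cohomology M F p"
  obtains U c where "(U, c) \<in> cech_reps M F p" "X = cech_rel M F p `` {(U, c)}"
  using assms unfolding cohomology_def by (auto elim: quotientE)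

text \<open>A section \<open>\<Sigma>\<close> of \<open>\<Psi>\<close> also yields a retraction of
  the middle sheaf onto \<open>F\<close>. All maps of the split sequence then induce maps on
  cohomology, and exactness follows in each degree without a connecting homomorphism.\<close>

theorem split_short_exact_in_cohomology:
  fixes F :: "('a, 'b) presheaf" and H :: "('a, 'd) presheaf"
  assumes F: "csheaf M F" and G: "csheaf M G" and H: "csheaf M H"
    and ker: "\<And>U. openin M U \<Longrightarrow> F U = sheaf_kernel G \<Psi> U"
    and \<Psi>: "sheaf_hom M G H \<Psi>" and \<Sigma>: "sheaf_hom M H G \<Sigma>"
    and split: "\<And>U h. openin M U \<Longrightarrow> h \<in> H U \<Longrightarrow> \<Psi> U (\<Sigma> U h) = h"
  shows "split_short_exact_sheaf_sequence M F inclusion_map G \<Psi> H"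
    and "short_exact_in_cohomology M p F inclusion_map G \<Psi> H"
proof -
  have \<Phi>: "sheaf_hom M F G inclusion_map"
    using ker by (auto simp: sheaf_hom_def inclusion_map_def sheaf_kernel_def)
  \<comment> \<open>The complementary projection: \<open>\<Psi>\<close> vanishes on its values, so
    it lands in \<open>F\<close>, and it fixes the sections of \<open>F\<close> because
    \<open>\<Psi>\<close> vanishes on them.\<close>
  define \<rho> where "\<rho> = (\<lambda>U g. g - \<Sigma> U (\<Psi> U g))"
  have \<rho>_in: "\<rho> U g \<in> F U" if "openin M U" "g \<in> G U" for U g
  proof -
    have \<Psi>g: "\<Psi> U g \<in> H U" by (rule hom_in[OF G H \<Psi> that])
    have "\<Sigma> U (\<Psi> U g) \<in> G U" by (rule hom_in[OF H G \<Sigma> that(1) \<Psi>g])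
    then show ?thesis
      using that csheaf_diff[OF G] split[OF that(1) \<Psi>g]
      by (simp add: ker sheaf_kernel_def \<rho>_def hom_diff[OF G H \<Psi>])
  qed
  have \<rho>: "sheaf_hom M G F \<rho>"
    unfolding sheaf_hom_def
  proof (intro allI impI conjI ballI)
    fix U assume U: "openin M U"
    show "\<rho> U ` G U \<subseteq> F U" using \<rho>_in[OF U] by blast
    fix s assume s: "s \<in> G U"
    note \<Psi>in = hom_in[OF G H \<Psi> U]
    show "\<rho> U (s + t) = \<rho> U s + \<rho> U t" if "t \<in> G U" for t
      using s that \<Psi>in by (simp add: \<rho>_def hom_add[OF G H \<Psi> U] hom_add[OF H G \<Sigma> U])
    show "\<rho> U (sscale c s) = sscale c (\<rho> U s)" for c
      using s \<Psi>in by (simp add: \<rho>_def hom_sscale[OF G H \<Psi> U] hom_sscale[OF H G \<Sigma> U] sscale_diff)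
    show "\<rho> V (restr V s) = restr V (\<rho> U s)" if "openin M V \<and> V \<subseteq> U" for V
      using s \<Psi>in that by (simp add: \<rho>_def hom_restr[OF G H \<Psi> U] hom_restr[OF H G \<Sigma> U] restr_diff)
  qed
  show "split_short_exact_sheaf_sequence M F inclusion_map G \<Psi> H"
    unfolding split_short_exact_sheaf_sequence_def short_exact_sheaf_sequence_def
  proof (intro conjI allI impI)
    fix U assume U: "openin M U"
    show "sheaf_kernel F inclusion_map U = {0}"
      using csheaf_zero[OF F U] by (auto simp: sheaf_kernel_def inclusion_map_def)
    show "sheaf_image M F G inclusion_map U = sheaf_kernel G \<Psi> U"
    proof
      show "sheaf_image M F G inclusion_map U \<subseteq> sheaf_kernel G \<Psi> U"
      proof
        fix t assume t: "t \<in> sheaf_image M F G inclusion_map U"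
        \<comment> \<open>The image sheaf only says that \<open>t\<close> is locally a section of
          \<open>F\<close>; the sheaf axiom for this cover makes it a global one.\<close>
        define \<V> where "\<V> = {V. openin M V \<and> V \<subseteq> U \<and> restr V t \<in> F V}"
        have "U = \<Union>\<V>" using t by (auto simp: sheaf_image_def \<V>_def inclusion_map_def)
        moreover have "t \<in> F (\<Union>\<V>)"
        proof -
          have "t x = 0" if "x \<notin> \<Union>\<V>" for x
            using csheaf_support[OF G U] t that \<open>U = \<Union>\<V>\<close> by (auto simp: sheaf_image_def)
          then show ?thesis using F unfolding csheaf_def by (auto simp: \<V>_def)
        qed
        ultimately show "t \<in> sheaf_kernel G \<Psi> U" using ker[OF U] by simp
      qed
      show "sheaf_kernel G \<Psi> U \<subseteq> sheaf_image M F G inclusion_map U"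
        using U restr_id[OF F U] ker[OF U] hom_in[OF F G \<Phi> U]
        by (auto simp: sheaf_image_def inclusion_map_def intro!: exI[of _ U])
    qed
    have "t \<in> \<Psi> U ` G U" if "t \<in> H U" for t
      using split[OF U that] hom_in[OF H G \<Sigma> U that] by force
    then show "sheaf_image M G H \<Psi> U = H U"
      using U restr_id[OF H U] by (auto simp: sheaf_image_def intro!: exI[of _ U])
  qed (use assms \<Phi> in auto)
  have comp: "cochain_map M p \<Psi> U (cochain_map M p \<Sigma> U c) = c" if "pointed_cover M U" "c \<in> cochains M H p U" for U c
    using that split[OF openin_supp[OF that(1)] cochains_in[OF that(2)]]
    by (auto simp: cochain_map_def fun_eq_iff cochains_outside)
  have incl: "cochain_map M p inclusion_map U c = c" if "c \<in> cochains M E p U" for U and c :: "'a list \<Rightarrow> ('a, 'b) sect" and E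
    using that by (auto simp: cochain_map_def fun_eq_iff cochains_outside inclusion_map_def)
  have \<rho>F: "cochain_map M p \<rho> U c = c" if U: "pointed_cover M U" and c: "c \<in> cochains M F p U" for U c
  proof
    fix xs
    show "cochain_map M p \<rho> U c xs = c xs"
    proof (cases "xs \<in> simplices M p")
      case True
      have "\<Psi> (supp U xs) (c xs) = 0"
        using cochains_in[OF c True] ker[OF openin_supp[OF U True]] by (simp add: sheaf_kernel_def)
      then show ?thesis
        using True hom_zero[OF H G \<Sigma> openin_supp[OF U True]] by (simp add: cochain_map_def \<rho>_def)
    next
      case False
      then show ?thesis using cochains_outside[OF c False] by (simp add: cochain_map_def fun_eq_iff)
    qed
  qed
  have \<Psi>F: "cochain_map M p \<Psi> U c = 0" if U: "pointed_cover M U" and c: "c \<in> cochains M F p U" for U c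
  proof
    fix xs
    show "cochain_map M p \<Psi> U c xs = 0 xs"
    proof (cases "xs \<in> simplices M p")
      case True
      then show ?thesis
        using cochains_in[OF c True] ker[OF openin_supp[OF U True]] by (simp add: sheaf_kernel_def cochain_map_def)
    qed (simp add: cochain_map_def)
  qed
  have reps: "pointed_cover M U" "c \<in> cochains M E p U" if "(U, c) \<in> cech_reps M E p" for U c and E :: "('a, 'e) presheaf"
    using that by (auto simp: cech_reps_def cocycles_def)
  have zero_rep: "(U, 0) \<in> cech_reps M E p" if "pointed_cover M U" "csheaf M E" for U and E :: "('a, 'e) presheaf"
    using that by (auto simp: cech_reps_def cocycles_def cochains_zero coboundary_zero)
  have top: "pointed_cover M (\<lambda>_. topspace M)" by (simp add: pointed_cover_def)
  have zero: "((U, 0), (\<lambda>_. topspace M, 0)) \<in> cech_rel M E p" if "pointed_cover M U" "csheaf M E" for U and E :: "('a, 'e) presheaf"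
    using that by (intro cech_relI[OF that(2) zero_rep zero_rep that(1)] top)
      (auto simp: refine_zero coboundaries_zero pointed_cover_def dest: openin_subset)
  show "short_exact_in_cohomology M p F inclusion_map G \<Psi> H"
    unfolding short_exact_in_cohomology_def
  proof (intro conjI)
    have "cohomology_map M F \<rho> p (cohomology_map M G inclusion_map p X) = X" if X: "X \<in> cohomology M F p" for X
    proof -
      obtain U c where Uc: "(U, c) \<in> cech_reps M F p" "X = cech_rel M F p `` {(U, c)}"
        using X by (rule cohomology_cases)
      show ?thesis
        using Uc reps[OF Uc(1)] cochain_map_reps[OF F G \<Phi> Uc(1)]
        by (simp add: cohomology_map_class[OF F G \<Phi>] cohomology_map_class[OF G F \<rho>] incl[of c F] \<rho>F)
    qed
    then show "inj_on (cohomology_map M G inclusion_map p) (cohomology M F p)"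
      by (metis inj_on_inverseI)
    show "cohomology_map M G inclusion_map p ` cohomology M F p =
      {X \<in> cohomology M G p. cohomology_map M H \<Psi> p X = cohomology_zero M H p}"
    proof (intro equalityI subsetI)
      fix Y assume "Y \<in> cohomology_map M G inclusion_map p ` cohomology M F p"
      then obtain X where X: "X \<in> cohomology M F p" "Y = cohomology_map M G inclusion_map p X" by blast
      obtain U c where Uc: "(U, c) \<in> cech_reps M F p" "X = cech_rel M F p `` {(U, c)}"
        using X(1) by (rule cohomology_cases)
      have "cohomology_map M H \<Psi> p Y = cech_rel M H p `` {(U, 0)}"
        using Uc X reps[OF Uc(1)] cochain_map_reps[OF F G \<Phi> Uc(1)]
        by (simp add: cohomology_map_class[OF F G \<Phi>] cohomology_map_class[OF G H \<Psi>] incl[of c F] \<Psi>F)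
      also have "\<dots> = cohomology_zero M H p"
        unfolding cohomology_zero_def using reps[OF Uc(1)] H
        by (intro equiv_class_eq[OF equiv_cech_rel[OF H]] zero)
      finally show "Y \<in> {X \<in> cohomology M G p. cohomology_map M H \<Psi> p X = cohomology_zero M H p}"
        using cohomology_map_in[OF F G \<Phi>] X by simp
    next
      fix Y assume "Y \<in> {X \<in> cohomology M G p. cohomology_map M H \<Psi> p X = cohomology_zero M H p}"
      then have Y: "Y \<in> cohomology M G p" "cohomology_map M H \<Psi> p Y = cohomology_zero M H p" by auto
      obtain U g where Ug: "(U, g) \<in> cech_reps M G p" "Y = cech_rel M G p `` {(U, g)}"
        using Y(1) by (rule cohomology_cases)
      note U = reps[OF Ug(1)]
      define \<psi> where "\<psi> = cochain_map M p \<Psi> U g"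
      define r where "r = cochain_map M p \<rho> U g"
      have \<psi>: "(U, \<psi>) \<in> cech_reps M H p" unfolding \<psi>_def by (rule cochain_map_reps[OF G H \<Psi> Ug(1)])
      have r: "(U, r) \<in> cech_reps M F p" unfolding r_def by (rule cochain_map_reps[OF G F \<rho> Ug(1)])
      have "cech_rel M H p `` {(U, \<psi>)} = cech_rel M H p `` {(\<lambda>_. topspace M, 0)}"
        using Y(2) Ug by (simp add: cohomology_map_class[OF G H \<Psi>] \<psi>_def cohomology_zero_def)
      then have "((U, \<psi>), (\<lambda>_. topspace M, 0)) \<in> cech_rel M H p"
        using zero_rep[OF top H] by (intro eq_equiv_class[OF _ equiv_cech_rel[OF H]])
      \<comment> \<open>\<open>\<psi>\<close> represents 0, hence so does its image under
        \<open>\<Sigma>\<close>; and this image is exactly the difference between \<open>g\<close>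
        and its projection \<open>r\<close> to \<open>F\<close>.\<close>
      from cochain_map_rel[OF H G \<Sigma> this]
      obtain W where W: "pointed_cover M W" "\<forall>x\<in>topspace M. W x \<subseteq> U x"
        "refine W (cochain_map M p \<Sigma> U \<psi>) \<in> coboundaries M G p W"
        by (auto simp: cech_rel_def cochain_map_zero[OF H G \<Sigma> top] refine_zero)
      have "g - r = cochain_map M p \<Sigma> U \<psi>"
        using U(2) by (auto simp: fun_eq_iff r_def \<psi>_def cochain_map_def \<rho>_def cochains_outside)
      then have "refine W g - refine W r \<in> coboundaries M G p W"
        using W(3) by (simp flip: refine_diff)
      moreover have "(U, r) \<in> cech_reps M G p"
        using cochain_map_reps[OF F G \<Phi> r] reps(2)[OF r] by (simp add: incl[of r F])
      ultimately have "((U, g), (U, r)) \<in> cech_rel M G p"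
        using Ug W by (intro cech_relI[OF G, of U g p U r W]) auto
      then have "Y = cech_rel M G p `` {(U, r)}"
        using Ug by (simp add: equiv_class_eq[OF equiv_cech_rel[OF G]])
      also have "\<dots> = cohomology_map M G inclusion_map p (cech_rel M F p `` {(U, r)})"
        using reps(2)[OF r] by (simp add: cohomology_map_class[OF F G \<Phi> r] incl[of r F])
      finally show "Y \<in> cohomology_map M G inclusion_map p ` cohomology M F p"
        using r by (auto simp: cohomology_def intro!: imageI quotientI)
    qed
    have "X \<in> cohomology_map M H \<Psi> p ` cohomology M G p" if X: "X \<in> cohomology M H p" for X
    proof -
      obtain U c where Uc: "(U, c) \<in> cech_reps M H p" "X = cech_rel M H p `` {(U, c)}"
        using X by (rule cohomology_cases)
      have "X = cohomology_map M H \<Psi> p (cohomology_map M G \<Sigma> p X)"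
        using Uc reps[OF Uc(1)] cochain_map_reps[OF H G \<Sigma> Uc(1)]
        by (simp add: cohomology_map_class[OF H G \<Sigma>] cohomology_map_class[OF G H \<Psi>] comp)
      then show ?thesis using cohomology_map_in[OF H G \<Sigma> X] by blast
    qed
    then show "cohomology_map M H \<Psi> p ` cohomology M G p = cohomology M H p"
      using cohomology_map_in[OF G H \<Psi>] by blast
  qed
qed

section \<open>Holomorphic functions of several variables\<close>

definition pd :: "'m \<Rightarrow> (complex ^ 'm::finite \<Rightarrow> complex) \<Rightarrow> complex ^ 'm \<Rightarrow> complex" where
  "pd a f z = frechet_derivative f (at z) (axis a 1)"

text \<open>Writing the derivative with the complex coefficients \<open>v $ a\<close> builds complex
  linearity into the predicate, so this is complex differentiability at a point, with the partial
  derivatives as coefficients.\<close>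

definition cdiff :: "(complex ^ 'm::finite \<Rightarrow> complex) \<Rightarrow> complex ^ 'm \<Rightarrow> bool" where
  "cdiff f z \<longleftrightarrow> (f has_derivative (\<lambda>v. \<Sum>a\<in>UNIV. v $ a * pd a f z)) (at z)"

lemma has_derivative_pd:
  assumes "(f has_derivative (\<lambda>v. \<Sum>a\<in>UNIV. v $ a * p a)) (at z)"
  shows "pd b f z = p b"
proof -
  have "frechet_derivative f (at z) = (\<lambda>v. \<Sum>a\<in>UNIV. v $ a * p a)"
    by (rule frechet_derivative_at[OF assms, symmetric])
  then show ?thesis
    unfolding pd_def by (simp add: axis_def if_distrib[of "\<lambda>x. x * _"] cong: if_cong)
qed

lemma cdiffI:
  assumes "(f has_derivative (\<lambda>v. \<Sum>a\<in>UNIV. v $ a * p a)) (at z)"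
  shows "cdiff f z"
  unfolding cdiff_def using assms has_derivative_pd[OF assms] by simp

lemma holo_on_iff_cdiff: "holo_on f S \<longleftrightarrow> (\<forall>z\<in>S. cdiff f z)"
proof -
  have "cdiff f z" if D: "(f has_derivative D) (at z)" "\<forall>c v. D (c *s v) = c * D v" for D z
  proof -
    have lin: "linear D" using D(1) has_derivative_linear by blast
    have "D v = (\<Sum>a\<in>UNIV. v $ a * D (axis a 1))" for v
    proof -
      have "D v = D (\<Sum>a\<in>UNIV. v $ a *s axis a 1)" by (simp only: basis_expansion)
      also have "\<dots> = (\<Sum>a\<in>UNIV. D (v $ a *s axis a 1))" by (rule linear_sum[OF lin])
      finally show ?thesis by (simp add: D(2))
    qed
    then have "D = (\<lambda>v. \<Sum>a\<in>UNIV. v $ a * D (axis a 1))" by blast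
    then show ?thesis using D(1) cdiffI[of f "\<lambda>a. D (axis a 1)"] by simp
  qed
  moreover have "\<exists>D. (f has_derivative D) (at z) \<and> (\<forall>c v. D (c *s v) = c * D v)" if "cdiff f z" for z
    using that unfolding cdiff_def
    by (intro exI conjI, assumption) (simp add: sum_distrib_left mult.assoc)
  ultimately show ?thesis unfolding holo_on_def by blast
qed

lemma cdiff_const [simp]: "cdiff (\<lambda>z. k) z" and pd_const [simp]: "pd a (\<lambda>z. k) z = 0"
proof -
  have "((\<lambda>z. k) has_derivative (\<lambda>v. \<Sum>a\<in>UNIV. v $ a * 0)) (at z)" by simp
  from cdiffI[OF this] has_derivative_pd[OF this]
  show "cdiff (\<lambda>z. k) z" "pd a (\<lambda>z. k) z = 0" by simp_all
qed

lemma pd_nth: "pd a (\<lambda>z. z $ b) z = (if a = b then 1 else 0)"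
proof -
  have "((\<lambda>z. z $ b) has_derivative (\<lambda>v. \<Sum>a\<in>UNIV. v $ a * (if a = b then 1 else 0))) (at z)"
    using bounded_linear_imp_has_derivative[OF bounded_linear_vec_nth]
    by (simp add: if_distrib cong: if_cong)
  from has_derivative_pd[OF this] show ?thesis by simp
qed

context
  fixes f g :: "complex ^ 'm::finite \<Rightarrow> complex" and z
  assumes f: "cdiff f z" and g: "cdiff g z"
begin

lemma cdiff_add: "cdiff (\<lambda>z. f z + g z) z"
  and pd_add: "pd a (\<lambda>z. f z + g z) z = pd a f z + pd a g z"
proof -
  have "((\<lambda>z. f z + g z) has_derivative (\<lambda>v. \<Sum>a\<in>UNIV. v $ a * (pd a f z + pd a g z))) (at z)"
    using has_derivative_add[OF f[unfolded cdiff_def] g[unfolded cdiff_def]]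
    by (simp add: sum.distrib distrib_left)
  from cdiffI[OF this] has_derivative_pd[OF this]
  show "cdiff (\<lambda>z. f z + g z) z" "pd a (\<lambda>z. f z + g z) z = pd a f z + pd a g z" by simp_all
qed

lemma cdiff_diff: "cdiff (\<lambda>z. f z - g z) z"
  and pd_diff: "pd a (\<lambda>z. f z - g z) z = pd a f z - pd a g z"
proof -
  have "((\<lambda>z. f z - g z) has_derivative (\<lambda>v. \<Sum>a\<in>UNIV. v $ a * (pd a f z - pd a g z))) (at z)"
    using has_derivative_diff[OF f[unfolded cdiff_def] g[unfolded cdiff_def]]
    by (simp add: sum_subtractf right_diff_distrib)
  from cdiffI[OF this] has_derivative_pd[OF this]
  show "cdiff (\<lambda>z. f z - g z) z" "pd a (\<lambda>z. f z - g z) z = pd a f z - pd a g z" by simp_all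
qed

lemma cdiff_mult: "cdiff (\<lambda>z. f z * g z) z"
  and pd_mult: "pd a (\<lambda>z. f z * g z) z = pd a f z * g z + f z * pd a g z"
proof -
  have "((\<lambda>z. f z * g z) has_derivative (\<lambda>v. \<Sum>a\<in>UNIV. v $ a * (pd a f z * g z + f z * pd a g z))) (at z)"
    using has_derivative_mult[OF f[unfolded cdiff_def] g[unfolded cdiff_def]]
    by (simp add: sum.distrib distrib_left sum_distrib_left sum_distrib_right mult_ac add_ac)
  from cdiffI[OF this] has_derivative_pd[OF this]
  show "cdiff (\<lambda>z. f z * g z) z" "pd a (\<lambda>z. f z * g z) z = pd a f z * g z + f z * pd a g z" by simp_all
qed

end

lemma pd_uminus: "cdiff f z \<Longrightarrow> pd a (\<lambda>z. - f z) z = - pd a f z"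
  using pd_diff[of "\<lambda>z. 0" z f] by simp

lemma pd_cmult: "cdiff f z \<Longrightarrow> pd a (\<lambda>z. k * f z) z = k * pd a f z"
  by (simp add: pd_mult)

lemma cdiff_sum: "(\<And>i. i \<in> A \<Longrightarrow> cdiff (f i) z) \<Longrightarrow> cdiff (\<lambda>z. \<Sum>i\<in>A. f i z) z"
  by (induction A rule: infinite_finite_induct) (auto intro!: cdiff_add)

lemma pd_sum:
  assumes "\<And>i. i \<in> A \<Longrightarrow> cdiff (f i) z"
  shows "pd a (\<lambda>z. \<Sum>i\<in>A. f i z) z = (\<Sum>i\<in>A. pd a (f i) z)"
  using assms by (induction A rule: infinite_finite_induct) (auto simp: pd_add cdiff_sum)

lemma cdiff_prod: "(\<And>i. i \<in> A \<Longrightarrow> cdiff (f i) z) \<Longrightarrow> cdiff (\<lambda>z. \<Prod>i\<in>A. f i z) z"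
  by (induction A rule: infinite_finite_induct) (auto intro!: cdiff_mult)

lemma cdiff_inverse:
  assumes f: "cdiff f z" and nz: "f z \<noteq> 0"
  shows "cdiff (\<lambda>z. inverse (f z)) z"
proof -
  have "((\<lambda>z. inverse (f z)) has_derivative (\<lambda>v. \<Sum>a\<in>UNIV. v $ a * (- (inverse (f z) * pd a f z * inverse (f z))))) (at z)"
    using Deriv.has_derivative_inverse[OF nz f[unfolded cdiff_def]]
    by (simp add: sum_distrib_left sum_distrib_right sum_negf mult_ac)
  from cdiffI[OF this] show ?thesis .
qed

lemma cdiff_divide: "cdiff f z \<Longrightarrow> cdiff g z \<Longrightarrow> g z \<noteq> 0 \<Longrightarrow> cdiff (\<lambda>z. f z / g z) z"
  unfolding divide_inverse by (intro cdiff_mult cdiff_inverse)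

lemma
  assumes "open S" "z \<in> S" "\<And>w. w \<in> S \<Longrightarrow> f w = g w"
  shows pd_cong_open: "pd a f z = pd a g z" and cdiff_cong_open: "cdiff f z \<longleftrightarrow> cdiff g z"
proof -
  have *: "(f has_derivative D) (at z) \<longleftrightarrow> (g has_derivative D) (at z)" for D
    using has_derivative_transform_within_open[of f D z UNIV S g]
      has_derivative_transform_within_open[of g D z UNIV S f] assms by auto
  then show pd: "pd a f z = pd a g z" for a unfolding pd_def frechet_derivative_def by simp
  show "cdiff f z \<longleftrightarrow> cdiff g z" unfolding cdiff_def pd * ..
qed

lemma has_derivative_pd_vec:
  fixes \<phi> :: "complex ^ 'm::finite \<Rightarrow> complex ^ 'n::finite"
  assumes \<phi>: "\<And>b. cdiff (\<lambda>z. \<phi> z $ b) z"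
  shows "(\<phi> has_derivative (\<lambda>v. \<chi> b. \<Sum>a\<in>UNIV. v $ a * pd a (\<lambda>z. \<phi> z $ b) z)) (at z)"
proof -
  have "((\<lambda>z. \<chi> b. \<phi> z $ b) has_derivative (\<lambda>v. \<chi> b. \<Sum>a\<in>UNIV. v $ a * pd a (\<lambda>z. \<phi> z $ b) z)) (at z)"
  proof (subst has_derivative_componentwise_within, intro ballI)
    fix i :: "complex ^ 'n" assume "i \<in> Basis"
    then obtain b u where i: "i = axis b u" by (auto simp: Basis_vec_def)
    from bounded_linear.has_derivative[OF bounded_linear_inner_left \<phi>[of b, unfolded cdiff_def]]
    show "((\<lambda>z. (\<chi> b. \<phi> z $ b) \<bullet> i) has_derivative
        (\<lambda>v. (\<chi> b. \<Sum>a\<in>UNIV. v $ a * pd a (\<lambda>z. \<phi> z $ b) z) \<bullet> i)) (at z)"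
      unfolding i inner_axis by simp
  qed
  then show ?thesis by simp
qed

lemma
  fixes \<phi> :: "complex ^ 'm::finite \<Rightarrow> complex ^ 'n::finite"
  assumes \<phi>: "\<And>b. cdiff (\<lambda>z. \<phi> z $ b) z" and f: "cdiff f (\<phi> z)"
  shows cdiff_compose: "cdiff (\<lambda>z. f (\<phi> z)) z"
    and pd_compose: "pd a (\<lambda>z. f (\<phi> z)) z = (\<Sum>b\<in>UNIV. pd b f (\<phi> z) * pd a (\<lambda>z. \<phi> z $ b) z)"
proof -
  note has_derivative_pd_vec[OF \<phi>]
  from has_derivative_compose[OF this f[unfolded cdiff_def]]
  have "((\<lambda>z. f (\<phi> z)) has_derivative
      (\<lambda>v. \<Sum>a\<in>UNIV. v $ a * (\<Sum>b\<in>UNIV. pd b f (\<phi> z) * pd a (\<lambda>z. \<phi> z $ b) z))) (at z)"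
  proof (rule has_derivative_eq_rhs, intro ext)
    fix v
    have "(\<Sum>b\<in>UNIV. (\<Sum>a\<in>UNIV. v $ a * pd a (\<lambda>z. \<phi> z $ b) z) * pd b f (\<phi> z)) =
        (\<Sum>b\<in>UNIV. \<Sum>a\<in>UNIV. v $ a * (pd b f (\<phi> z) * pd a (\<lambda>z. \<phi> z $ b) z))"
      by (simp add: sum_distrib_left sum_distrib_right mult_ac)
    then show "(\<Sum>b\<in>UNIV. (\<chi> b. \<Sum>a\<in>UNIV. v $ a * pd a (\<lambda>z. \<phi> z $ b) z) $ b * pd b f (\<phi> z)) =
        (\<Sum>a\<in>UNIV. v $ a * (\<Sum>b\<in>UNIV. pd b f (\<phi> z) * pd a (\<lambda>z. \<phi> z $ b) z))"
      unfolding sum_distrib_left by (subst sum.swap) simp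
  qed
  from cdiffI[OF this] has_derivative_pd[OF this]
  show "cdiff (\<lambda>z. f (\<phi> z)) z"
    "pd a (\<lambda>z. f (\<phi> z)) z = (\<Sum>b\<in>UNIV. pd b f (\<phi> z) * pd a (\<lambda>z. \<phi> z $ b) z)" by simp_all
qed

lemma cdiff_isCont: "cdiff f z \<Longrightarrow> isCont f z"
  unfolding cdiff_def by (rule has_derivative_continuous)

section \<open>Derivatives of holomorphic functions, by Cauchy's formula along coordinate
  lines\<close>

lemma cdiff_slice:
  assumes "cdiff f (z + \<zeta> *s axis a 1)"
  shows "((\<lambda>\<zeta>. f (z + \<zeta> *s axis a 1)) has_field_derivative pd a f (z + \<zeta> *s axis a 1)) (at \<zeta>)"
proof -
  have 1: "((\<lambda>\<zeta>. z + \<zeta> *s axis a 1) has_derivative (\<lambda>h. h *s axis a 1)) (at \<zeta>)"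
  proof -
    have "bounded_linear (\<lambda>h::complex. h *s (axis a 1 :: complex ^ 'a))"
      by (intro linear_linear[THEN iffD2] linearI) (auto simp: vec_eq_iff algebra_simps)
    then show ?thesis by (auto intro!: derivative_eq_intros bounded_linear_imp_has_derivative)
  qed
  have "((\<lambda>\<zeta>. f (z + \<zeta> *s axis a 1)) has_derivative (\<lambda>h. \<Sum>b\<in>UNIV. (h *s axis a 1) $ b * pd b f (z + \<zeta> *s axis a 1))) (at \<zeta>)"
    using has_derivative_compose[OF 1 assms[unfolded cdiff_def]] .
  moreover have "(\<lambda>h. \<Sum>b\<in>UNIV. (h *s axis a 1) $ b * pd b f w) = (*) (pd a f w)" for w
    by (auto simp: fun_eq_iff axis_def if_distrib[of "\<lambda>x. x * _"] if_distrib[of "\<lambda>x. _ * x"] cong: if_cong)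
  ultimately show ?thesis
    unfolding has_field_derivative_def by simp
qed

lemma norm_smult_axis: "norm (\<zeta> *s (axis a 1 :: complex ^ 'm::finite)) = cmod \<zeta>"
proof -
  have "\<zeta> *s (axis a 1 :: complex ^ 'm) = axis a \<zeta>" by (simp add: vec_eq_iff axis_def)
  then show ?thesis by (simp add: norm_eq_sqrt_inner inner_axis_axis)
qed

text \<open>Cauchy's formula on the disc of radius \<open>r\<close> in the complex line through
  \<open>z\<close> in direction \<open>a\<close>. The radii \<open>r\<close> and
  \<open>2 * r\<close> allow one circle for all \<open>z\<close> near \<open>z0\<close>, so that
  \<open>z\<close> becomes a parameter of the integral.\<close>

lemma pd_cauchy_integral:
  fixes f :: "complex ^ 'm::finite \<Rightarrow> complex"
  assumes f: "\<And>w. w \<in> ball z0 (2 * r) \<Longrightarrow> cdiff f w" and r: "0 < r" and z: "z \<in> ball z0 r"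
  shows "pd a f z = integral {0..1} (\<lambda>t. f (z + circlepath 0 r t *s axis a 1) / circlepath 0 r t)"
proof -
  have in': "z + \<zeta> *s axis a 1 \<in> ball z0 (2 * r)" if "cmod \<zeta> \<le> r" for \<zeta>
  proof -
    have "dist z0 (z + \<zeta> *s axis a 1) \<le> dist z0 z + norm (\<zeta> *s (axis a 1 :: complex ^ 'm))"
      using dist_triangle[of z0 "z + \<zeta> *s axis a 1" z] unfolding dist_norm by (simp add: norm_minus_commute)
    moreover have "dist z0 z < r" using z by simp
    ultimately show ?thesis using that unfolding norm_smult_axis mem_ball by linarith
  qed
  let ?g = "\<lambda>\<zeta>. f (z + \<zeta> *s axis a 1)"
  have der: "(?g has_field_derivative pd a f (z + \<zeta> *s axis a 1)) (at \<zeta>)" if "cmod \<zeta> \<le> r" for \<zeta>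
    by (rule cdiff_slice) (rule f, rule in', rule that)
  have "continuous_on (cball 0 r) ?g"
    using der by (intro continuous_at_imp_continuous_on ballI) (auto intro: DERIV_isCont)
  moreover have "?g holomorphic_on ball 0 r"
    unfolding holomorphic_on_def field_differentiable_def
  proof
    fix \<zeta> :: complex assume "\<zeta> \<in> ball 0 r"
    then have "cmod \<zeta> \<le> r" by simp
    from has_field_derivative_at_within[OF der[OF this]]
    show "\<exists>d. (?g has_field_derivative d) (at \<zeta> within ball 0 r)" by blast
  qed
  ultimately have "(?g has_field_derivative (1 / (2 * of_real pi * \<i>) *
      contour_integral (circlepath 0 r) (\<lambda>u. ?g u / (u - 0)\<^sup>2))) (at 0)"
    using r by (intro Cauchy_derivative_integral_circlepath) auto
  from DERIV_unique[OF _ this] have "pd a f z = 1 / (2 * of_real pi * \<i>) * contour_integral (circlepath 0 r) (\<lambda>u. ?g u / u\<^sup>2)"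
    using der[of 0] r by simp
  also have "\<dots> = 1 / (2 * of_real pi * \<i>) *
      integral {0..1} (\<lambda>t. ?g (circlepath 0 r t) / (circlepath 0 r t)\<^sup>2 * vector_derivative (circlepath 0 r) (at t))"
    by (simp add: contour_integral_integral)
  also have "\<dots> = integral {0..1} (\<lambda>t. ?g (circlepath 0 r t) / circlepath 0 r t)"
  proof -
    \<comment> \<open>The velocity of the circle is 2 pi i times the position, which cancels the
      constant and one of the two powers in the denominator.\<close>
    have "vector_derivative (circlepath 0 r) (at t) = 2 * of_real pi * \<i> * circlepath 0 r t" for t
      by (simp only: vector_derivative_circlepath) (simp add: circlepath)
    moreover have "circlepath 0 r t \<noteq> 0" for t using r unfolding circlepath by simp
    ultimately have "?g (circlepath 0 r t) / (circlepath 0 r t)\<^sup>2 * vector_derivative (circlepath 0 r) (at t)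
        = 2 * of_real pi * \<i> * (?g (circlepath 0 r t) / circlepath 0 r t)" for t
      by (simp add: power2_eq_square)
    then show ?thesis by (simp only: integral_mult_right) simp
  qed
  finally show ?thesis .
qed

lemma continuous_on_slice:
  assumes "continuous_on (X \<times> T) (\<lambda>(x, t). h x t)" "x \<in> X"
  shows "continuous_on T (h x)"
proof -
  have "continuous_on T (\<lambda>t. case (x, t) of (x, t) \<Rightarrow> h x t)"
    by (rule continuous_on_compose2[OF assms(1)]) (use assms(2) in \<open>auto intro: continuous_on_Pair\<close>)
  then show ?thesis by simp
qed

lemma circle_shift_in_ball:
  fixes z :: "complex ^ 'm::finite"
  assumes "0 < r" "z \<in> ball z0 r"
  shows "z + circlepath 0 r t *s axis a 1 \<in> ball z0 (2 * r)"
proof -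
  have "dist z0 (z + circlepath 0 r t *s axis a 1) \<le> dist z0 z + norm (circlepath 0 r t *s (axis a 1 :: complex ^ 'm))"
    using dist_triangle[of z0 "z + circlepath 0 r t *s axis a 1" z] unfolding dist_norm by (simp add: norm_minus_commute)
  moreover have "cmod (circlepath 0 r t) = r" using assms(1) by (simp add: circlepath norm_mult)
  ultimately show ?thesis using assms(2) unfolding norm_smult_axis by simp
qed

lemma continuous_on_circle_shift:
  fixes f :: "complex ^ 'm::finite \<Rightarrow> complex"
  assumes "continuous_on (ball z0 (2 * r)) f" "0 < r"
  shows "continuous_on (ball z0 r \<times> cbox 0 1) (\<lambda>(z, t). f (z + circlepath 0 r t *s axis a 1) / circlepath 0 r t)"
proof -
  have nz: "circlepath 0 r t \<noteq> 0" for t using assms(2) by (simp add: circlepath)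
  have c: "continuous_on S (circlepath 0 r)" for S
    unfolding circlepath by (intro continuous_intros)
  have "continuous_on X (\<lambda>x. \<chi> i. if i = a then g x else 0)"
    if "continuous_on X g" for X :: "((complex ^ 'm) \<times> real) set" and g :: "_ \<Rightarrow> complex"
  proof (rule continuous_on_vec_lambda)
    show "continuous_on X (\<lambda>x. if i = a then g x else 0)" for i
      using that by (cases "i = a") auto
  qed
  moreover have "w *s axis a 1 = (\<chi> i. if i = a then w else 0)" for w :: complex
    by (simp add: axis_def vec_eq_iff)
  ultimately have s: "continuous_on (ball z0 r \<times> cbox 0 1) (\<lambda>(z, t). z + circlepath 0 r t *s axis a 1)"
    unfolding case_prod_beta
    by (simp, intro continuous_on_add continuous_on_fst continuous_on_id) (auto intro!:
        continuous_on_compose2[OF c[of UNIV] continuous_on_snd[OF continuous_on_id]])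
  have "continuous_on (ball z0 r \<times> cbox 0 1) (\<lambda>x. f (case x of (z, t) \<Rightarrow> z + circlepath 0 r t *s axis a 1))"
    by (rule continuous_on_compose2[OF assms(1) s]) (auto simp del: mem_ball intro: circle_shift_in_ball[OF assms(2)])
  then show ?thesis
    unfolding case_prod_beta using nz
    by (intro continuous_on_divide continuous_on_compose2[OF c[of UNIV]] continuous_intros) auto
qed

context
  fixes f :: "complex ^ 'm::finite \<Rightarrow> complex" and S
  assumes S: "open S" and f: "\<And>w. w \<in> S \<Longrightarrow> cdiff f w"
begin

lemma ball_inside:
  assumes "z0 \<in> S" obtains r where "0 < r" "ball z0 (2 * r) \<subseteq> S"
proof -
  obtain e where "e > 0" "ball z0 e \<subseteq> S" using S assms by (auto simp: open_contains_ball)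
  then show ?thesis using that[of "e / 2"] by auto
qed

text \<open>Holomorphy is assumed only as differentiability at each point. Cauchy's formula
  expresses the derivative through \<open>f\<close> itself, whose continuity is known, and thereby
  makes the derivative continuous.\<close>

lemma continuous_on_pd: "continuous_on S (pd a f)"
proof (intro continuous_at_imp_continuous_on ballI)
  fix z0 assume "z0 \<in> S"
  then obtain r where r: "0 < r" "ball z0 (2 * r) \<subseteq> S" using ball_inside by blast
  have "continuous_on (ball z0 (2 * r)) f"
    using f r by (intro continuous_at_imp_continuous_on) (auto intro: cdiff_isCont)
  from integral_continuous_on_param[OF continuous_on_circle_shift[OF this r(1), of a]]
  have "continuous_on (ball z0 r) (\<lambda>z. integral {0..1} (\<lambda>t. f (z + circlepath 0 r t *s axis a 1) / circlepath 0 r t))"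
    by simp
  then have "continuous_on (ball z0 r) (pd a f)"
    using r f by (subst continuous_on_cong[OF refl pd_cauchy_integral[of z0 r]]) auto
  then show "isCont (pd a f) z0"
    using r(1) by (simp add: continuous_on_eq_continuous_at)
qed

text \<open>Differentiation under Cauchy's integral: the integrand involves \<open>f\<close>, so its
  first derivatives already control the derivative of \<open>pd a f\<close>.\<close>

lemma pd_has_derivative_integral:
  assumes r: "0 < r" "ball z0 (2 * r) \<subseteq> S"
  shows "(pd a f has_derivative (\<lambda>v. \<Sum>b\<in>UNIV. v $ b *
     integral {0..1} (\<lambda>t. pd b f (z0 + circlepath 0 r t *s axis a 1) / circlepath 0 r t))) (at z0)"
proof -
  define p where "p = (\<lambda>t. circlepath 0 r t *s (axis a 1 :: complex ^ 'm))"
  define c where "c = circlepath 0 r"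
  define U where "U = ball z0 r"
  have z0: "z0 \<in> U" using r by (simp add: U_def)
  have inb: "x + p t \<in> ball z0 (2 * r)" if "x \<in> U" for x t
    using circle_shift_in_ball[OF r(1)] that by (auto simp: p_def U_def)
  have bl: "bounded_linear (\<lambda>v::complex^'m. \<Sum>b\<in>UNIV. v $ b * k b)" for k
    by (intro bounded_linear_sum bounded_linear_mult_const bounded_linear_vec_nth)
  \<comment> \<open>The Leibniz rule takes the derivative as a bounded linear operator that depends
    jointly continuously on the point and the integration variable; \<open>continuous_on_pd\<close>
    provides this.\<close>
  define G where "G = (\<lambda>x t. Blinfun (\<lambda>v. \<Sum>b\<in>UNIV. v $ b * (pd b f (x + p t) / c t)))"
  have G: "blinfun_apply (G x t) = (\<lambda>v. \<Sum>b\<in>UNIV. v $ b * (pd b f (x + p t) / c t))" for x t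
    unfolding G_def by (rule bounded_linear_Blinfun_apply[OF bl])
  have cf: "continuous_on (ball z0 (2 * r)) f"
    using f r by (intro continuous_at_imp_continuous_on) (auto intro: cdiff_isCont)
  have cpf: "continuous_on (U \<times> cbox 0 1) (\<lambda>(z, t). pd b f (z + p t) / c t)" for b
    using continuous_on_circle_shift[OF continuous_on_subset[OF continuous_on_pd r(2)] r(1)]
    by (simp add: p_def c_def U_def)
  have contG: "continuous_on (U \<times> cbox 0 1) (\<lambda>(x, t). G x t)"
    using cpf unfolding case_prod_beta
    by (intro continuous_on_blinfun_componentwise)
       (auto simp: G simp del: times_divide_eq_right intro!: continuous_on_sum continuous_on_mult_left)
  have der: "((\<lambda>x. f (x + p t) / c t) has_derivative blinfun_apply (G x t)) (at x within U)" if "x \<in> U" for x t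
  proof -
    have "cdiff f (x + p t)" using inb[OF that] r f by blast
    then have "(f has_derivative (\<lambda>v. \<Sum>b\<in>UNIV. v $ b * pd b f (x + p t))) (at (x + p t))"
      by (simp add: cdiff_def)
    moreover have "((\<lambda>x. x + p t) has_derivative (\<lambda>h. h)) (at x within U)"
      by (auto intro!: derivative_eq_intros)
    ultimately have "((\<lambda>x. f (x + p t)) has_derivative (\<lambda>v. \<Sum>b\<in>UNIV. v $ b * pd b f (x + p t))) (at x within U)"
      by (rule has_derivative_compose[rotated])
    from has_derivative_mult_left[OF this, of "inverse (c t)"] show ?thesis
      unfolding G divide_inverse by (simp add: sum_distrib_right mult.assoc)
  qed
  have "continuous_on (U \<times> cbox 0 1) (\<lambda>(z, t). f (z + p t) / c t)"
    using continuous_on_circle_shift[OF cf r(1), of a] unfolding p_def c_def U_def .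
  then have int: "(\<lambda>t. f (x + p t) / c t) integrable_on cbox 0 1" if "x \<in> U" for x
    by (rule integrable_continuous[OF continuous_on_slice[where h = "\<lambda>z t. f (z + p t) / c t"]]) (rule that)
  have intG: "G z0 integrable_on cbox 0 1"
    by (rule integrable_continuous[OF continuous_on_slice[OF contG z0]])
  have intp: "(\<lambda>t. pd b f (z0 + p t) / c t) integrable_on cbox 0 1" for b
    by (rule integrable_continuous[OF continuous_on_slice[OF cpf z0]])
  have "((\<lambda>x. integral (cbox 0 1) (\<lambda>t. f (x + p t) / c t)) has_derivative
      blinfun_apply (integral (cbox 0 1) (G z0))) (at z0 within U)"
    by (rule leibniz_rule[OF der int contG z0]) (auto simp: U_def)
  then have 1: "((\<lambda>x. integral (cbox 0 1) (\<lambda>t. f (x + p t) / c t)) has_derivative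
      blinfun_apply (integral (cbox 0 1) (G z0))) (at z0)"
    using z0 at_within_open[of z0 U] by (simp add: U_def)
  have eqf: "blinfun_apply (integral (cbox 0 1) (G z0)) v =
      (\<Sum>b\<in>UNIV. v $ b * integral {0..1} (\<lambda>t. pd b f (z0 + p t) / c t))" for v
  proof -
    have "blinfun_apply (integral (cbox 0 1) (G z0)) v = integral (cbox 0 1) (\<lambda>t. blinfun_apply (G z0 t) v)"
      using integral_linear[OF intG blinfun.bounded_linear_left[of v]] by (simp add: o_def)
    also have "\<dots> = (\<Sum>b\<in>UNIV. integral (cbox 0 1) (\<lambda>t. v $ b * (pd b f (z0 + p t) / c t)))"
      unfolding G using intp by (intro integral_sum integrable_on_mult_right) auto
    finally show ?thesis by (simp only: integral_mult_right cbox_interval)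
  qed
  from 1[unfolded eqf[THEN ext]] have 2: "((\<lambda>x. integral (cbox 0 1) (\<lambda>t. f (x + p t) / c t)) has_derivative
      (\<lambda>v. \<Sum>b\<in>UNIV. v $ b * integral {0..1} (\<lambda>t. pd b f (z0 + p t) / c t))) (at z0)"
    by this
  have eq: "integral (cbox 0 1) (\<lambda>t. f (x + p t) / c t) = pd a f x" if "x \<in> U" for x
    using that r by (subst pd_cauchy_integral[of z0 r f x a]) (auto simp: p_def c_def U_def intro: f)
  show ?thesis
    using has_derivative_transform_within_open[OF 2 _ z0 eq] unfolding p_def c_def U_def by simp
qed

lemma cdiff_pd:
  assumes "z \<in> S"
  shows "cdiff (pd a f) z"
proof -
  obtain r where r: "0 < r" "ball z (2 * r) \<subseteq> S" using ball_inside[OF assms] by blast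
  show ?thesis by (rule cdiffI[OF pd_has_derivative_integral[OF r]])
qed

end

text \<open>By Cauchy's formula both sides are the same circle integral of \<open>pd b f\<close>.\<close>

lemma pd_commute:
  assumes S: "open S" and f: "\<And>w. w \<in> S \<Longrightarrow> cdiff f w" and z: "z \<in> S"
  shows "pd a (pd b f) z = pd b (pd a f) z"
proof -
  obtain r where r: "0 < r" "ball z (2 * r) \<subseteq> S" using ball_inside[OF S f z] by blast
  have "pd b (pd a f) z = integral {0..1} (\<lambda>t. pd b f (z + circlepath 0 r t *s axis a 1) / circlepath 0 r t)"
    using has_derivative_pd[OF pd_has_derivative_integral[OF S f r]] by blast
  also have "\<dots> = pd a (pd b f) z"
    using r by (intro pd_cauchy_integral[of z r, symmetric] cdiff_pd[OF S f]) auto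
  finally show ?thesis ..
qed

section \<open>Tensors in coordinates\<close>

type_synonym 'm tensor = "'m list \<Rightarrow> complex"

abbreviation slot :: "'m \<Rightarrow> 'm tensor \<Rightarrow> 'm tensor" where
  "slot a t \<equiv> (\<lambda>is. t (a # is))"

text \<open>The recursion is the antiderivation rule for contraction with the basis covector of the
  first index. It reduces identities between tensors to inductions that peel off one index; the
  usual signed sum is \<open>ext_eq_sum\<close>.\<close>

fun ext :: "('m \<Rightarrow> complex) \<Rightarrow> 'm tensor \<Rightarrow> 'm tensor" where
  "ext v t [] = 0"
| "ext v t (a # is) = v a * t is - ext v (slot a t) is"

text \<open>Wedge product with the bivector \<open>1/2 \<Sum> p\<^sup>a\<^sup>b e\<^sub>a \<and> e\<^sub>b\<close>; for antisymmetric \<open>p\<close> the recursion absorbs the factor \<open>1/2\<close>.\<close>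

fun lef :: "('m \<Rightarrow> 'm \<Rightarrow> complex) \<Rightarrow> 'm tensor \<Rightarrow> 'm tensor" where
  "lef p t [] = 0"
| "lef p t (a # is) = lef p (slot a t) is + ext (p a) t is"

definition con :: "('m::finite \<Rightarrow> complex) \<Rightarrow> 'm tensor \<Rightarrow> 'm tensor" where
  "con \<alpha> t is = (\<Sum>a\<in>UNIV. \<alpha> a * t (a # is))"

text \<open>Contraction with the two-form \<open>w\<close>, adjoint to \<open>lef\<close>: on \<open>Ker \<gamma>\<close> the two satisfy the commutation relation \<open>lam_lef\<close> of an \<open>sl\<^sub>2\<close>-triple.\<close>

definition lam :: "('m::finite \<Rightarrow> 'm \<Rightarrow> complex) \<Rightarrow> 'm tensor \<Rightarrow> 'm tensor" where
  "lam w t is = (\<Sum>c\<in>UNIV. \<Sum>a\<in>UNIV. w c a * t (a # c # is)) / 2"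

fun push :: "('m::finite \<Rightarrow> 'm \<Rightarrow> complex) \<Rightarrow> 'm tensor \<Rightarrow> 'm tensor" where
  "push J t [] = t []"
| "push J t (b # bs) = (\<Sum>a\<in>UNIV. J b a * push J (slot a t) bs)"

definition alternating :: "'m tensor \<Rightarrow> bool" where
  "alternating t \<longleftrightarrow> (\<forall>xs a b ys. t (xs @ a # b # ys) = - t (xs @ b # a # ys))"

lemma alternatingI:
  "(\<And>xs a b ys. t (xs @ a # b # ys) = - t (xs @ b # a # ys)) \<Longrightarrow> alternating t"
  unfolding alternating_def by blast

lemma alternatingD: "alternating t \<Longrightarrow> t (xs @ a # b # ys) = - t (xs @ b # a # ys)"
  unfolding alternating_def by blast

text \<open>Vanishing on lists of any other length makes equality of tensors the same as equality of
  functions.\<close>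

definition tens :: "nat \<Rightarrow> 'm tensor \<Rightarrow> bool" where
  "tens q t \<longleftrightarrow> alternating t \<and> (\<forall>is. length is \<noteq> q \<longrightarrow> t is = 0)"

lemma ext_add: "ext v (\<lambda>is. t is + u is) is = ext v t is + ext v u is"
  by (induction "is" arbitrary: t u) (simp_all add: algebra_simps)

lemma ext_cmult: "ext v (\<lambda>is. k * t is) is = k * ext v t is"
  by (induction "is" arbitrary: t) (simp_all add: algebra_simps)

lemma ext_sum: "ext v (\<lambda>is. \<Sum>i\<in>A. f i is) is = (\<Sum>i\<in>A. ext v (f i) is)"
  by (induction "is" arbitrary: f) (simp_all add: algebra_simps sum_subtractf sum_distrib_left)

lemma ext_zero: "ext v (\<lambda>is. 0) is = 0"
  using ext_cmult[of v 0 "\<lambda>_. 0"] by simp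

lemma ext_minus: "ext v (\<lambda>is. - t is) is = - ext v t is"
  using ext_cmult[of v "-1" t] by simp

lemma ext_vadd: "ext (\<lambda>b. v b + w b) t is = ext v t is + ext w t is"
  by (induction "is" arbitrary: t) (simp_all add: algebra_simps)

lemma ext_vcmult: "ext (\<lambda>b. k * v b) t is = k * ext v t is"
  by (induction "is" arbitrary: t) (simp_all add: algebra_simps)

lemma ext_vsum: "ext (\<lambda>b. \<Sum>i\<in>A. v i b) t is = (\<Sum>i\<in>A. ext (v i) t is)"
  by (induction "is" arbitrary: t) (simp_all add: sum_subtractf sum_distrib_right)

lemma ext_vminus: "ext (\<lambda>b. - v b) t is = - ext v t is"
  using ext_vcmult[of "-1" v t] by simp

lemma ext_vdiff: "ext (\<lambda>b. v b - w b) t is = ext v t is - ext w t is"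
  using ext_vadd[of v "\<lambda>b. - w b" t] by (simp add: ext_vminus)

lemma ext_vzero: "ext (\<lambda>b. 0) t is = 0"
  using ext_vcmult[of 0 "\<lambda>_. 0"] by simp

lemma lef_add: "lef p (\<lambda>is. t is + u is) is = lef p t is + lef p u is"
  by (induction "is" arbitrary: t u) (simp_all add: ext_add)

lemma lef_cmult: "lef p (\<lambda>is. k * t is) is = k * lef p t is"
  by (induction "is" arbitrary: t) (simp_all add: algebra_simps ext_cmult)

lemma lef_sum: "lef p (\<lambda>is. \<Sum>i\<in>A. f i is) is = (\<Sum>i\<in>A. lef p (f i) is)"
  by (induction "is" arbitrary: f) (simp_all add: ext_sum sum.distrib)

lemma lef_zero: "lef p (\<lambda>is. 0) is = 0"
  using lef_cmult[of p 0 "\<lambda>_. 0"] by simp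

lemma lef_minus: "lef p (\<lambda>is. - t is) is = - lef p t is"
  using lef_cmult[of p "-1" t] by simp

lemma lef_pcmult: "lef (\<lambda>a b. k * p a b) t is = k * lef p t is"
  by (induction "is" arbitrary: t) (simp_all add: algebra_simps ext_vcmult)

lemma con_add: "con \<alpha> (\<lambda>is. t is + u is) is = con \<alpha> t is + con \<alpha> u is"
  by (simp add: con_def algebra_simps sum.distrib)

lemma con_diff: "con \<alpha> (\<lambda>is. t is - u is) is = con \<alpha> t is - con \<alpha> u is"
  by (simp add: con_def algebra_simps sum_subtractf)

lemma con_cmult: "con \<alpha> (\<lambda>is. k * t is) is = k * con \<alpha> t is"
  by (simp add: con_def sum_distrib_left mult_ac)

lemma con_sum: "con \<alpha> (\<lambda>is. \<Sum>i\<in>A. f i is) is = (\<Sum>i\<in>A. con \<alpha> (f i) is)"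
  unfolding con_def sum_distrib_left by (rule sum.swap)

lemma con_vadd: "con (\<lambda>a. \<alpha> a + \<beta> a) t is = con \<alpha> t is + con \<beta> t is"
  by (simp add: con_def algebra_simps sum.distrib)

lemma con_vdiff: "con (\<lambda>a. \<alpha> a - \<beta> a) t is = con \<alpha> t is - con \<beta> t is"
  by (simp add: con_def algebra_simps sum_subtractf)

lemma con_vcmult: "con (\<lambda>a. k * \<alpha> a) t is = k * con \<alpha> t is"
  by (simp add: con_def sum_distrib_left mult_ac)

lemma con_slot: "con \<alpha> t = (\<lambda>is. \<Sum>a\<in>UNIV. \<alpha> a * slot a t is)"
  by (simp add: con_def fun_eq_iff)

lemma lam_slot: "lam w t = (\<lambda>is. \<Sum>c\<in>UNIV. \<Sum>a\<in>UNIV. (w c a / 2) * slot c (slot a t) is)"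
  by (simp add: lam_def fun_eq_iff sum_divide_distrib)

lemma lam_add: "lam w (\<lambda>is. t is + u is) is = lam w t is + lam w u is"
  by (simp add: lam_def algebra_simps sum.distrib add_divide_distrib)

lemma lam_diff: "lam w (\<lambda>is. t is - u is) is = lam w t is - lam w u is"
  by (simp add: lam_def algebra_simps sum_subtractf diff_divide_distrib)

lemma lam_cmult: "lam w (\<lambda>is. k * t is) is = k * lam w t is"
  by (simp add: lam_def sum_distrib_left mult_ac)

lemma con_ext: "con \<alpha> (ext v t) is = (\<Sum>a\<in>UNIV. \<alpha> a * v a) * t is - ext v (con \<alpha> t) is"
  unfolding con_slot ext_sum ext_cmult
  by (simp add: sum_subtractf sum_distrib_left right_diff_distrib mult_ac)

text \<open>The covector meets either the tensor or the bivector; in the second case it leaves the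
  vector obtained by raising \<open>\<alpha>\<close> with \<open>p\<close>.\<close>

lemma con_lef: "con \<alpha> (lef p t) is = lef p (con \<alpha> t) is + ext (\<lambda>b. \<Sum>a\<in>UNIV. \<alpha> a * p a b) t is"
  unfolding con_slot lef_sum lef_cmult ext_vsum ext_vcmult
  by (simp add: sum.distrib distrib_left)

lemma tens_swap: "tens q t \<Longrightarrow> t (a # b # is) = - t (b # a # is)"
  using alternatingD[of t "[]" a b "is"] by (simp add: tens_def)

lemma con_anticommute:
  assumes "tens q t" shows "con \<alpha> (slot a t) is = - con \<alpha> t (a # is)"
proof -
  have "t (a # b # is) = - t (b # a # is)" for b
    using assms by (rule tens_swap)
  then show ?thesis by (simp add: con_def sum_negf)
qed

lemma con_con:
  assumes "tens q t" shows "con \<alpha> (con \<beta> t) is = - con \<beta> (con \<alpha> t) is"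
proof -
  have *: "t (a # b # is) = - t (b # a # is)" for a b
    using assms by (rule tens_swap)
  show ?thesis
    unfolding con_def sum_distrib_left sum_negf[symmetric]
    by (subst sum.swap, intro sum.cong refl) (subst *, simp add: mult_ac)
qed



lemma alternating_slot:
  assumes "alternating t" shows "alternating (slot c t)"
proof (rule alternatingI)
  fix xs a b ys
  show "slot c t (xs @ a # b # ys) = - slot c t (xs @ b # a # ys)"
    using alternatingD[OF assms, of "c # xs" a b ys] by simp
qed

lemma tens_slot:
  assumes "tens (Suc q) t" shows "tens q (slot a t)"
  using assms by (simp add: tens_def alternating_slot)

lemma tens_zero: "tens q (\<lambda>is. 0)"
  by (simp add: tens_def alternating_def)

lemma alternating_sum: "(\<And>i. i \<in> A \<Longrightarrow> alternating (f i)) \<Longrightarrow> alternating (\<lambda>is. \<Sum>i\<in>A. f i is)"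
  by (rule alternatingI) (auto simp: sum_negf[symmetric] intro!: sum.cong alternatingD)

lemma alternating_cmult: "alternating t \<Longrightarrow> alternating (\<lambda>is. k * t is)"
  by (rule alternatingI) (subst alternatingD, simp_all)

lemma alternating_add: "alternating t \<Longrightarrow> alternating u \<Longrightarrow> alternating (\<lambda>is. t is + u is)"
  by (rule alternatingI) (subst alternatingD, assumption, subst alternatingD[of u], simp_all)

lemma tens_add: "tens q t \<Longrightarrow> tens q u \<Longrightarrow> tens q (\<lambda>is. t is + u is)"
  by (simp add: tens_def alternating_add)

lemma tens_cmult: "tens q t \<Longrightarrow> tens q (\<lambda>is. k * t is)"
  by (simp add: tens_def alternating_cmult)

lemma tens_diff: "tens q t \<Longrightarrow> tens q u \<Longrightarrow> tens q (\<lambda>is. t is - u is)"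
  using tens_add[OF _ tens_cmult[of q u "-1"], of t] by simp

lemma tens_sum: "(\<And>i. i \<in> A \<Longrightarrow> tens q (f i)) \<Longrightarrow> tens q (\<lambda>is. \<Sum>i\<in>A. f i is)"
  by (auto simp: tens_def intro!: alternating_sum sum.neutral)

lemma slot_degree_0: "tens 0 t \<Longrightarrow> slot a t = (\<lambda>is. 0)"
  by (simp add: tens_def)

lemma tens_0_Cons: "tens 0 t \<Longrightarrow> t (a # is) = 0"
  by (simp add: tens_def)

lemma tens_con: "tens (Suc q) t \<Longrightarrow> tens q (con \<alpha> t)"
  unfolding con_slot by (intro tens_sum tens_cmult tens_slot)

lemma con_degree_0: "tens 0 t \<Longrightarrow> con \<alpha> t = (\<lambda>is. 0)"
  unfolding con_slot by (simp add: tens_0_Cons)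

lemma tens_lam: "tens (Suc (Suc q)) t \<Longrightarrow> tens q (lam w t)"
  unfolding lam_slot by (intro tens_sum tens_cmult tens_slot)

lemma lam_low_degree:
  assumes "tens q t" "q < 2" shows "lam w t = (\<lambda>is. 0)"
  using assms unfolding tens_def lam_def by (auto simp: fun_eq_iff)

lemma alternating_slot_slot:
  assumes "alternating t" shows "slot a (slot b t) = (\<lambda>is. - slot b (slot a t) is)"
proof
  show "slot a (slot b t) is = - slot b (slot a t) is" for "is"
    using alternatingD[OF assms, of "[]" b a "is"] by simp
qed

lemma tens_ext:
  assumes "tens q t" shows "tens (Suc q) (ext v t)"
proof -
  have deg: "ext v t is = 0" if "length is \<noteq> Suc q" "\<forall>is. length is \<noteq> q \<longrightarrow> t is = 0" for "is" and t :: "'a tensor"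
    using that
  proof (induction "is" arbitrary: q t)
    case (Cons a "is")
    have "ext v (slot a t) is = 0"
    proof (cases q)
      case 0
      have "slot a t = (\<lambda>is. 0)"
        using Cons.prems(2) by (intro ext) (simp add: 0)
      then show ?thesis by (simp add: ext_zero)
    next
      case (Suc q')
      then show ?thesis using Cons by (intro Cons.IH[of q']) auto
    qed
    then show ?case using Cons.prems by simp
  qed simp
  have "ext v t (xs @ a # b # ys) = - ext v t (xs @ b # a # ys)"
    if "alternating t" for xs a b ys and t :: "'a tensor"
    using that
  proof (induction xs arbitrary: t)
    case Nil
    have "ext v (slot b (slot a t)) ys = - ext v (slot a (slot b t)) ys"
      by (subst alternating_slot_slot[OF Nil]) (rule ext_minus)
    then show ?case by simp
  next
    case (Cons c xs)
    show ?case using Cons.IH[OF alternating_slot[OF Cons.prems]] alternatingD[OF Cons.prems, of xs a b ys] by simp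
  qed
  then show ?thesis using assms deg unfolding tens_def by (blast intro: alternatingI)
qed

lemma tens_lef:
  assumes "tens q t" and p: "\<And>a b. p a b = - p b a"
  shows "tens (Suc (Suc q)) (lef p t)"
proof -
  have deg: "lef p t is = 0" if "length is \<noteq> Suc (Suc q)" "tens q t" for "is" and t :: "'a tensor"
    using that
  proof (induction "is" arbitrary: q t)
    case (Cons a "is")
    have "lef p (slot a t) is = 0"
    proof (cases q)
      case 0
      then show ?thesis using Cons.prems by (simp add: slot_degree_0 lef_zero)
    next
      case (Suc q')
      then show ?thesis using Cons by (intro Cons.IH[of q'] tens_slot) auto
    qed
    moreover have "ext (p a) t is = 0" using Cons.prems tens_ext[of q t "p a"] by (simp add: tens_def)
    ultimately show ?case by simp
  qed simp
  have "lef p t (xs @ a # b # ys) = - lef p t (xs @ b # a # ys)"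
    if t: "tens q t" for xs a b ys and t :: "'a tensor"
    using t
  proof (induction xs arbitrary: t q)
    case Nil
    then have "alternating t" by (simp add: tens_def)
    then have "lef p (slot b (slot a t)) ys = - lef p (slot a (slot b t)) ys"
      by (subst alternating_slot_slot) (simp_all add: lef_minus)
    then show ?case using p[of b a] by simp
  next
    case (Cons c xs)
    have "ext (p c) t (xs @ a # b # ys) = - ext (p c) t (xs @ b # a # ys)"
      using tens_ext[OF Cons.prems] by (intro alternatingD) (simp add: tens_def)
    moreover have "lef p (slot c t) (xs @ a # b # ys) = - lef p (slot c t) (xs @ b # a # ys)"
    proof (cases q)
      case 0
      then show ?thesis using Cons.prems by (simp add: slot_degree_0 lef_zero)
    next
      case (Suc q')
      then show ?thesis using Cons by (intro Cons.IH[of q'] tens_slot) auto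
    qed
    ultimately show ?case by simp
  qed
  then show ?thesis using assms deg unfolding tens_def by (blast intro: alternatingI)
qed

definition delta :: "'m \<Rightarrow> 'm \<Rightarrow> complex" where
  "delta a b = (if a = b then 1 else 0)"

lemma sum_delta [simp]:
  fixes a :: "'m::finite"
  shows "(\<Sum>b\<in>UNIV. delta a b * f b) = f a" "(\<Sum>b\<in>UNIV. delta b a * f b) = f a"
    "(\<Sum>b\<in>UNIV. f b * delta a b) = f a" "(\<Sum>b\<in>UNIV. f b * delta b a) = f a"
  by (simp_all add: delta_def if_distrib[of "\<lambda>x. x * _"] if_distrib[of "\<lambda>x. _ * x"] cong: if_cong)

text \<open>The number operator of the exterior algebra: moving one index past the contraction
  releases one copy of \<open>t\<close>, so the sum counts the degree.\<close>

lemma ext_number: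
  fixes t :: "'m::finite tensor"
  assumes "tens q t"
  shows "(\<Sum>a\<in>UNIV. ext (delta a) (slot a t) is) = of_nat q * t is"
  using assms
proof (induction "is" arbitrary: q t)
  case Nil
  then show ?case by (auto simp: tens_def)
next
  case (Cons c "is")
  have sw: "slot c (slot a t) = (\<lambda>is. - slot a (slot c t) is)" for a
    using Cons.prems by (intro alternating_slot_slot) (simp add: tens_def)
  have "(\<Sum>a\<in>UNIV. ext (delta a) (slot a t) (c # is)) =
      t (c # is) + (\<Sum>a\<in>UNIV. ext (delta a) (slot a (slot c t)) is)"
    by (simp add: sw ext_minus sum.distrib)
  also have "(\<Sum>a\<in>UNIV. ext (delta a) (slot a (slot c t)) is) = (of_nat q - 1) * t (c # is)"
  proof (cases q)
    case 0
    then show ?thesis using Cons.prems by (simp add: slot_degree_0 ext_zero tens_def)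
  next
    case (Suc q')
    then show ?thesis using Cons.IH[OF tens_slot[of q' t c]] Cons.prems by simp
  qed
  finally show ?case by (simp add: algebra_simps)
qed

section \<open>Naturality under linear maps\<close>

lemma push_add: "push J (\<lambda>is. t is + u is) is = push J t is + push J u is"
  by (induction "is" arbitrary: t u) (simp_all add: algebra_simps sum.distrib)

lemma push_cmult: "push J (\<lambda>is. k * t is) is = k * push J t is"
  by (induction "is" arbitrary: t) (simp_all add: mult_ac sum_distrib_left)

lemma push_zero: "push J (\<lambda>is. 0) is = 0"
  using push_cmult[of J 0 "\<lambda>_. 0"] by simp

lemma push_minus: "push J (\<lambda>is. - t is) is = - push J t is"
  using push_cmult[of J "-1" t] by simp

lemma push_diff: "push J (\<lambda>is. t is - u is) is = push J t is - push J u is"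
  using push_add[of J t "\<lambda>is. - u is"] push_cmult[of J "-1" u] by simp

lemma push_sum: "push J (\<lambda>is. \<Sum>i\<in>A. f i is) is = (\<Sum>i\<in>A. push J (f i) is)"
  by (induction A rule: infinite_finite_induct) (simp_all add: push_zero push_add)

lemma slot_push: "(\<lambda>bs. push J t (b # bs)) = (\<lambda>bs. \<Sum>a\<in>UNIV. J b a * push J (slot a t) bs)"
  by simp

lemma push_ext: "push J (ext v t) bs = ext (\<lambda>b. \<Sum>a\<in>UNIV. J b a * v a) (push J t) bs"
proof (induction bs arbitrary: t)
  case (Cons b bs)
  have "slot a (ext v t) = (\<lambda>is. v a * t is - ext v (slot a t) is)" for a by simp
  then have "push J (ext v t) (b # bs) =
      (\<Sum>a\<in>UNIV. J b a * (v a * push J t bs - ext (\<lambda>b. \<Sum>a\<in>UNIV. J b a * v a) (push J (slot a t)) bs))"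
    by (simp add: push_diff push_cmult Cons.IH)
  also have "\<dots> = ext (\<lambda>b. \<Sum>a\<in>UNIV. J b a * v a) (push J t) (b # bs)"
    by (simp add: slot_push ext_sum ext_cmult sum_subtractf right_diff_distrib sum_distrib_left mult_ac)
  finally show ?case .
qed simp

lemma push_lef:
  "push J (lef p t) bs = lef (\<lambda>b d. \<Sum>a\<in>UNIV. \<Sum>c\<in>UNIV. J b a * J d c * p a c) (push J t) bs"
    (is "_ = lef ?p _ _")
proof (induction bs arbitrary: t)
  case (Cons b bs)
  have "slot a (lef p t) = (\<lambda>is. lef p (slot a t) is + ext (p a) t is)" for a by simp
  then have "push J (lef p t) (b # bs) = (\<Sum>a\<in>UNIV. J b a * lef ?p (push J (slot a t)) bs) +
      (\<Sum>a\<in>UNIV. J b a * ext (\<lambda>d. \<Sum>c\<in>UNIV. J d c * p a c) (push J t) bs)"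
    by (simp add: push_add push_ext Cons.IH distrib_left sum.distrib)
  also have "\<dots> = lef ?p (push J t) (b # bs)"
    by (simp add: slot_push lef_sum lef_cmult ext_vsum ext_vcmult mult.assoc flip: sum_distrib_left)
  finally show ?case .
qed simp

lemma con_push: "con \<alpha> (push J t) bs = push J (con (\<lambda>a. \<Sum>b\<in>UNIV. \<alpha> b * J b a) t) bs"
proof -
  have "con \<alpha> (push J t) bs = (\<Sum>b\<in>UNIV. \<Sum>a\<in>UNIV. \<alpha> b * (J b a * push J (slot a t) bs))"
    by (simp add: con_def sum_distrib_left)
  also have "\<dots> = (\<Sum>a\<in>UNIV. \<Sum>b\<in>UNIV. \<alpha> b * (J b a * push J (slot a t) bs))"
    by (rule sum.swap)
  finally show ?thesis
    by (simp add: con_slot push_sum push_cmult sum_distrib_right mult.assoc)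
qed

text \<open>Tensors are pushed forward and forms pulled back: the two-form on the right is the
  pullback of \<open>w\<close> along \<open>J\<close>.\<close>

lemma lam_push: "lam w (push J t) bs =
  push J (lam (\<lambda>c a. \<Sum>d\<in>UNIV. \<Sum>b\<in>UNIV. J d c * J b a * w d b) t) bs"
proof -
  have e: "push J t (b # d # bs) = (\<Sum>c\<in>UNIV. \<Sum>a\<in>UNIV. J d c * J b a * push J (slot c (slot a t)) bs)" for b d
    by (simp add: sum_distrib_left mult_ac) (subst sum.swap, simp add: mult_ac)
  have "lam w (push J t) bs = (\<Sum>d\<in>UNIV. \<Sum>b\<in>UNIV. \<Sum>c\<in>UNIV. \<Sum>a\<in>UNIV.
      w d b / 2 * (J d c * J b a * push J (slot c (slot a t)) bs))"
    by (simp add: lam_def e sum_distrib_left sum_divide_distrib del: push.simps)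
  also have "\<dots> = (\<Sum>d\<in>UNIV. \<Sum>c\<in>UNIV. \<Sum>b\<in>UNIV. \<Sum>a\<in>UNIV.
      w d b / 2 * (J d c * J b a * push J (slot c (slot a t)) bs))"
    by (intro sum.cong refl sum.swap)
  also have "\<dots> = (\<Sum>c\<in>UNIV. \<Sum>d\<in>UNIV. \<Sum>b\<in>UNIV. \<Sum>a\<in>UNIV.
      w d b / 2 * (J d c * J b a * push J (slot c (slot a t)) bs))"
    by (rule sum.swap)
  also have "\<dots> = (\<Sum>c\<in>UNIV. \<Sum>d\<in>UNIV. \<Sum>a\<in>UNIV. \<Sum>b\<in>UNIV.
      w d b / 2 * (J d c * J b a * push J (slot c (slot a t)) bs))"
    by (intro sum.cong refl sum.swap)
  also have "\<dots> = (\<Sum>c\<in>UNIV. \<Sum>a\<in>UNIV. \<Sum>d\<in>UNIV. \<Sum>b\<in>UNIV.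
      w d b / 2 * (J d c * J b a * push J (slot c (slot a t)) bs))"
    by (intro sum.cong refl sum.swap)
  also have "\<dots> = push J (lam (\<lambda>c a. \<Sum>d\<in>UNIV. \<Sum>b\<in>UNIV. J d c * J b a * w d b) t) bs"
    unfolding lam_slot push_sum push_cmult
    by (simp add: sum_distrib_left sum_distrib_right sum_divide_distrib mult_ac)
  finally show ?thesis .
qed

lemma tens_push:
  assumes "tens q t" shows "tens q (push J t)"
proof -
  have deg: "push J t is = 0" if "length is \<noteq> q" "tens q t" for "is" and t :: "'a tensor"
    using that
  proof (induction "is" arbitrary: q t)
    case Nil
    then show ?case by (simp add: tens_def)
  next
    case (Cons a "is")
    have "push J (slot b t) is = 0" for b
    proof (cases q)
      case 0
      then show ?thesis using Cons.prems by (simp add: slot_degree_0 push_zero)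
    next
      case (Suc q')
      then show ?thesis using Cons by (intro Cons.IH[of q'] tens_slot) auto
    qed
    then show ?case by simp
  qed
  have "push J t (xs @ a # b # ys) = - push J t (xs @ b # a # ys)"
    if "alternating t" for xs a b ys and t :: "'a tensor"
    using that
  proof (induction xs arbitrary: t)
    case Nil
    have swap: "push J (slot c (slot d t)) ys = - push J (slot d (slot c t)) ys" for c d
      by (subst alternating_slot_slot[OF Nil], rule push_minus)
    have "push J t (a # b # ys) = (\<Sum>d\<in>UNIV. \<Sum>c\<in>UNIV. J a d * (J b c * push J (slot c (slot d t)) ys))"
      by (simp add: sum_distrib_left)
    also have "\<dots> = (\<Sum>d\<in>UNIV. \<Sum>c\<in>UNIV. - (J b c * (J a d * push J (slot d (slot c t)) ys)))"
      by (intro sum.cong refl) (subst swap, simp)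
    also have "\<dots> = - push J t (b # a # ys)"
      by (subst sum.swap) (simp add: sum_distrib_left sum_negf)
    finally show ?case by simp
  next
    case (Cons c xs)
    show ?case by (simp add: Cons.IH[OF alternating_slot[OF Cons.prems]] sum_negf)
  qed
  then show ?thesis using assms deg unfolding tens_def by (blast intro: alternatingI)
qed

section \<open>Contact algebra at a point\<close>

text \<open>
  The solution \<open>s\<close> of \<open>lef p (lam w s) + a s = t\<close> in degree \<open>q\<close>.  Applying \<open>lam w\<close> and commuting it past
  \<open>lef p\<close> shows that \<open>lam w s\<close> solves an equation of the same kind in degree \<open>q - 2\<close>.  Division by \<open>a = 0\<close>
  gives \<open>0\<close>; the values of \<open>a\<close> that are used stay nonzero along the recursion.
\<close>

fun resolve :: "complex \<Rightarrow> ('m::finite \<Rightarrow> 'm \<Rightarrow> complex) \<Rightarrow> ('m \<Rightarrow> 'm \<Rightarrow> complex) \<Rightarrow>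
    nat \<Rightarrow> complex \<Rightarrow> 'm tensor \<Rightarrow> 'm tensor" where
  "resolve n w p (Suc (Suc q)) a t =
     (\<lambda>is. (t is - lef p (resolve n w p q (a - (n - of_nat q)) (lam w t)) is) / a)"
| "resolve n w p q a t = (\<lambda>is. t is / a)"

text \<open>\<open>E\<close> is the Reeb vector of \<open>\<gamma>\<close>, and \<open>- p\<close> is inverse to \<open>w = d\<gamma>\<close> on \<open>Ker \<gamma>\<close>.\<close>

locale contact_point =
  fixes \<gamma> :: "'m::finite \<Rightarrow> complex" and w :: "'m \<Rightarrow> 'm \<Rightarrow> complex"
    and E :: "'m \<Rightarrow> complex" and p :: "'m \<Rightarrow> 'm \<Rightarrow> complex" and n :: nat
  assumes dim: "CARD('m) = 2 * n + 1"
    and w_anti: "w a b = - w b a" and p_anti: "p a b = - p b a"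
    and \<gamma>_E: "(\<Sum>a\<in>UNIV. \<gamma> a * E a) = 1"
    and w_E: "(\<Sum>b\<in>UNIV. w a b * E b) = 0"
    and \<gamma>_p: "(\<Sum>a\<in>UNIV. \<gamma> a * p a b) = 0"
    and p_w: "(\<Sum>b\<in>UNIV. p a b * w b c) = E a * \<gamma> c - delta a c"
begin

lemma w_p: "(\<Sum>b\<in>UNIV. w a b * p b c) = \<gamma> a * E c - delta a c"
proof -
  have "(\<Sum>b\<in>UNIV. w a b * p b c) = (\<Sum>b\<in>UNIV. p c b * w b a)"
    by (intro sum.cong refl) (simp add: w_anti[of a] p_anti[of c])
  then show ?thesis by (simp add: p_w delta_def mult.commute)
qed

lemma trace_p_w: "(\<Sum>a\<in>UNIV. \<Sum>b\<in>UNIV. p a b * w b a) = - 2 * of_nat n"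
  using \<gamma>_E by (simp add: p_w sum_subtractf delta_def dim mult.commute)

lemma con_lef_kernel: "con \<gamma> t = (\<lambda>is. 0) \<Longrightarrow> con \<gamma> (lef p t) = (\<lambda>is. 0)"
  by (rule ext) (simp add: con_lef lef_zero \<gamma>_p ext_vzero)

lemma con_lam_kernel:
  assumes "tens q t" "con \<gamma> t = (\<lambda>is. 0)" shows "con \<gamma> (lam w t) = (\<lambda>is. 0)"
proof
  fix "is"
  have *: "con \<gamma> (\<lambda>is. t (a # c # is)) is = 0" for a c
  proof -
    have s: "t (a # c # d # is) = t (d # a # c # is)" for d
    proof -
      have "t ([a] @ c # d # is) = - t ([a] @ d # c # is)"
        using assms(1) by (intro alternatingD) (simp add: tens_def)
      also have "\<dots> = t (d # a # c # is)" using tens_swap[OF assms(1), of a d "c # is"] by simp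
      finally show ?thesis by simp
    qed
    have "con \<gamma> (\<lambda>is. t (a # c # is)) is = con \<gamma> t (a # c # is)" by (simp add: con_def s)
    then show ?thesis using assms(2) by simp
  qed
  show "con \<gamma> (lam w t) is = 0"
    unfolding lam_slot con_sum con_cmult by (simp add: *)
qed

text \<open>Both contractions falling on the bivector give half the trace of \<open>p\<close>
  against \<open>w\<close>, which is \<open>- n\<close>; the two mixed terms give
  \<open>q / 2\<close> each through \<open>ext_number\<close>. The mixed terms contain
  \<open>delta a b - \<gamma> a * E b\<close> in place of \<open>delta a b\<close>, and the part
  with \<open>E\<close> disappears because \<gamma> annihilates \<open>t\<close>.\<close>

lemma lam_lef:
  assumes t: "tens q t" "con \<gamma> t = (\<lambda>is. 0)"
  shows "lam w (lef p t) is = lef p (lam w t) is + (of_nat q - of_nat n) * t is"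
proof -
  have "lam w (lef p t) is = (\<Sum>c\<in>UNIV. \<Sum>a\<in>UNIV. (w c a / 2) * (lef p (slot c (slot a t)) is
      + ext (p c) (slot a t) is + (p a c * t is - ext (p a) (slot c t) is)))"
    by (simp add: lam_slot)
  also have "\<dots> = lef p (lam w t) is + ((\<Sum>c\<in>UNIV. \<Sum>a\<in>UNIV. (w c a / 2) * ext (p c) (slot a t) is)
      + (\<Sum>c\<in>UNIV. \<Sum>a\<in>UNIV. (w c a / 2) * (p a c * t is))
      - (\<Sum>c\<in>UNIV. \<Sum>a\<in>UNIV. (w c a / 2) * ext (p a) (slot c t) is))"
    unfolding lam_slot lef_sum lef_cmult
    by (simp add: distrib_left right_diff_distrib sum.distrib sum_subtractf)
  also have "(\<Sum>c\<in>UNIV. \<Sum>a\<in>UNIV. (w c a / 2) * ext (p a) (slot c t) is) =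
      - (\<Sum>c\<in>UNIV. \<Sum>a\<in>UNIV. (w c a / 2) * ext (p c) (slot a t) is)"
  proof -
    have "(\<Sum>c\<in>UNIV. \<Sum>a\<in>UNIV. (w c a / 2) * ext (p a) (slot c t) is) =
        (\<Sum>c\<in>UNIV. \<Sum>a\<in>UNIV. (w a c / 2) * ext (p c) (slot a t) is)"
      by (rule sum.swap)
    also have "\<dots> = (\<Sum>c\<in>UNIV. \<Sum>a\<in>UNIV. - ((w c a / 2) * ext (p c) (slot a t) is))"
      by (intro sum.cong refl) (subst w_anti, simp)
    finally show ?thesis by (simp add: sum_negf)
  qed
  also have "(\<Sum>c\<in>UNIV. \<Sum>a\<in>UNIV. (w c a / 2) * (p a c * t is)) = - of_nat n * t is"
  proof -
    have "(\<Sum>c\<in>UNIV. \<Sum>a\<in>UNIV. (w c a / 2) * (p a c * t is)) =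
        (\<Sum>a\<in>UNIV. \<Sum>c\<in>UNIV. p a c * w c a) * (t is / 2)"
      by (subst sum.swap) (simp add: sum_distrib_right sum_distrib_left mult_ac)
    then show ?thesis by (simp add: trace_p_w)
  qed
  also have "(\<Sum>c\<in>UNIV. \<Sum>a\<in>UNIV. (w c a / 2) * ext (p c) (slot a t) is) = of_nat q * t is / 2"
  proof -
    have "(\<Sum>c\<in>UNIV. \<Sum>a\<in>UNIV. w c a * ext (p c) (slot a t) is) =
        (\<Sum>a\<in>UNIV. ext (\<lambda>b. \<Sum>c\<in>UNIV. w c a * p c b) (slot a t) is)"
      by (subst sum.swap) (simp add: ext_vsum ext_vcmult)
    also have "\<dots> = (\<Sum>a\<in>UNIV. ext (\<lambda>b. delta a b - \<gamma> a * E b) (slot a t) is)"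
    proof -
      have "(\<Sum>c\<in>UNIV. w c a * p c b) = (\<Sum>c\<in>UNIV. - (w a c * p c b))" for a b
        by (intro sum.cong refl) (subst w_anti, simp)
      then show ?thesis by (simp add: sum_negf w_p)
    qed
    also have "\<dots> = of_nat q * t is - ext E (con \<gamma> t) is"
      unfolding con_slot ext_sum ext_cmult ext_vdiff ext_vcmult sum_subtractf
      using ext_number[OF t(1)] by simp
    finally show ?thesis using t(2) by (simp add: ext_zero flip: sum_divide_distrib)
  qed
  finally show ?thesis by (simp add: algebra_simps)
qed

text \<open>The excluded values are the possible eigenvalues of minus \<open>lef p\<close> after
  \<open>lam w\<close> in degree \<open>q\<close>: one for each number \<open>r\<close> of bivector
  factors that can be split off, whence \<open>2 * r \<le> q\<close>.\<close>

lemma resolve: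
  assumes "tens q t" "con \<gamma> t = (\<lambda>is. 0)"
    and "\<And>r. 2 * r \<le> q \<Longrightarrow> a \<noteq> of_nat r * (of_nat n - of_nat q + 1 + of_nat r)"
  shows "tens q (resolve (of_nat n) w p q a t) \<and> con \<gamma> (resolve (of_nat n) w p q a t) = (\<lambda>is. 0) \<and>
    (\<forall>is. lef p (lam w (resolve (of_nat n) w p q a t)) is + a * resolve (of_nat n) w p q a t is = t is)"
  using assms
proof (induction q arbitrary: t a rule: less_induct)
  case (less q)
  note t = less.prems(1,2)
  have a: "a \<noteq> 0" using less.prems(3)[of 0] by simp
  show ?case
  proof (cases "q < 2")
    case True
    then have s: "resolve (of_nat n) w p q a t = (\<lambda>is. inverse a * t is)"
      by (auto simp: less_2_cases_iff divide_inverse mult.commute)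
    have "con \<gamma> (\<lambda>is. inverse a * t is) = (\<lambda>is. 0)"
      by (rule ext) (simp add: con_cmult t)
    then show ?thesis
      using a lam_low_degree[OF tens_cmult[OF t(1), of "inverse a"] True]
      by (simp add: s tens_cmult t lef_zero)
  next
    case False
    then obtain q' where q: "q = Suc (Suc q')" using le_Suc_ex[of 2 q] by auto
    define a' where "a' = a - (of_nat n - of_nat q')"
    define s1 where "s1 = resolve (of_nat n) w p q' a' (lam w t)"
    \<comment> \<open>Case \<open>r\<close> in degree \<open>q'\<close> is case \<open>Suc r\<close>
      in degree \<open>q\<close> after the shift from \<open>a\<close> to \<open>a'\<close>.\<close>
    have "a' \<noteq> of_nat r * (of_nat n - of_nat q' + 1 + of_nat r)" if "2 * r \<le> q'" for r
      using less.prems(3)[of "Suc r"] that by (simp add: q a'_def algebra_simps)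
    then have "tens q' s1 \<and> con \<gamma> s1 = (\<lambda>is. 0) \<and> (\<forall>is. lef p (lam w s1) is + a' * s1 is = lam w t is)"
      unfolding s1_def using t(1) con_lam_kernel[OF t] by (intro less.IH) (auto simp: q tens_lam)
    then have s1: "tens q' s1" "con \<gamma> s1 = (\<lambda>is. 0)" "lam w t is = lef p (lam w s1) is + a' * s1 is" for "is"
      by simp_all
    have s: "resolve (of_nat n) w p q a t = (\<lambda>is. inverse a * (t is - lef p s1 is))"
      by (simp add: q s1_def a'_def divide_inverse mult.commute)
    have "tens q (lef p s1)" unfolding q by (rule tens_lef[OF s1(1)]) (rule p_anti)
    then have 1: "tens q (\<lambda>is. inverse a * (t is - lef p s1 is))"
      using t by (intro tens_cmult tens_diff)
    have 2: "con \<gamma> (\<lambda>is. inverse a * (t is - lef p s1 is)) = (\<lambda>is. 0)"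
      using con_lef_kernel[OF s1(2)] by (intro ext) (simp add: con_cmult con_diff t)
    \<comment> \<open>Commuting \<open>lam w\<close> past \<open>lef p\<close> on \<open>s1\<close>
      costs \<open>q' - n\<close>. The two terms \<open>lef p (lam w s1)\<close> cancel and
      \<open>a' - (q' - n)\<close> is \<open>a\<close>, so the factor \<open>inverse a\<close>
      leaves \<open>s1\<close>.\<close>
    have "lam w (\<lambda>is. inverse a * (t is - lef p s1 is)) = s1"
      using a by (intro ext) (simp only: lam_cmult lam_diff lam_lef[OF s1(1,2)] s1(3), simp add: a'_def field_simps)
    then show ?thesis using 1 2 a by (simp only: s) (simp add: field_simps)
  qed
qed

end

section \<open>The splitting operator in coordinates\<close>

definition om :: "(complex ^ 'm::finite \<Rightarrow> 'm \<Rightarrow> complex) \<Rightarrow> complex ^ 'm \<Rightarrow> 'm \<Rightarrow> 'm \<Rightarrow> complex" where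
  "om g z a b = pd a (\<lambda>z. g z b) z - pd b (\<lambda>z. g z a) z"

text \<open>Divergence of multivector fields with respect to the coordinate volume form.\<close>

definition dvg :: "(complex ^ 'm::finite \<Rightarrow> 'm tensor) \<Rightarrow> complex ^ 'm \<Rightarrow> 'm tensor" where
  "dvg x z is = (\<Sum>c\<in>UNIV. pd c (\<lambda>z. x z (c # is)) z)"

definition vdiv :: "(complex ^ 'm::finite \<Rightarrow> 'm \<Rightarrow> 'm \<Rightarrow> complex) \<Rightarrow> complex ^ 'm \<Rightarrow> 'm \<Rightarrow> complex" where
  "vdiv p z b = (\<Sum>a\<in>UNIV. pd a (\<lambda>z. p z a b) z)"

text \<open>
  The factors \<open>n + 2\<close> and \<open>n + 1\<close> are forced by independence of the contact form: \<open>dvg (h x)\<close> contributes a term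
  \<open>con \<eta> x\<close> with \<open>\<eta> = dh / h\<close>, and so does \<open>vdiv p\<close> because \<open>\<gamma> (vdiv p) = - n\<close>; these terms cancel.
\<close>

definition split_op :: "nat \<Rightarrow> (complex ^ 'm::finite \<Rightarrow> 'm \<Rightarrow> 'm \<Rightarrow> complex) \<Rightarrow>
    (complex ^ 'm \<Rightarrow> 'm \<Rightarrow> complex) \<Rightarrow> (complex ^ 'm \<Rightarrow> 'm \<Rightarrow> 'm \<Rightarrow> complex) \<Rightarrow>
    (complex ^ 'm \<Rightarrow> 'm tensor) \<Rightarrow> complex ^ 'm \<Rightarrow> 'm tensor" where
  "split_op n w E p x z is =
     (of_nat n + 2) * (dvg (\<lambda>z. lef (p z) (x z)) z is - ext (vdiv p z) (x z) is + ext (E z) (x z) is)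
     - lef (p z) (\<lambda>is. (of_nat n + 1) * dvg x z is
         + con (\<lambda>a. \<Sum>b\<in>UNIV. w z a b * vdiv p z b) (x z) is) is"

lemma cdiff_ext:
  assumes "\<And>b. cdiff (\<lambda>z. v z b) z" "\<And>is. cdiff (\<lambda>z. t z is) z"
  shows "cdiff (\<lambda>z. ext (v z) (t z) is) z"
  using assms by (induction "is" arbitrary: t) (auto intro!: cdiff_diff cdiff_mult)

lemma cdiff_lef:
  assumes "\<And>a b. cdiff (\<lambda>z. p z a b) z" "\<And>is. cdiff (\<lambda>z. t z is) z"
  shows "cdiff (\<lambda>z. lef (p z) (t z) is) z"
  using assms by (induction "is" arbitrary: t) (auto intro!: cdiff_add cdiff_ext)

lemma cdiff_con:
  assumes "\<And>b. cdiff (\<lambda>z. v z b) z" "\<And>is. cdiff (\<lambda>z. t z is) z"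
  shows "cdiff (\<lambda>z. con (v z) (t z) is) z"
  unfolding con_def by (intro cdiff_sum cdiff_mult assms)

lemma cdiff_lam:
  assumes "\<And>a b. cdiff (\<lambda>z. w z a b) z" "\<And>is. cdiff (\<lambda>z. t z is) z"
  shows "cdiff (\<lambda>z. lam (w z) (t z) is) z"
  unfolding lam_def by (intro cdiff_divide cdiff_sum cdiff_mult assms cdiff_const) simp

lemma cdiff_push:
  assumes "\<And>a b. cdiff (\<lambda>z. J z a b) z" "\<And>is. cdiff (\<lambda>z. t z is) z"
  shows "cdiff (\<lambda>z. push (J z) (t z) is) z"
  using assms by (induction "is" arbitrary: t) (auto intro!: cdiff_sum cdiff_mult)

lemma cdiff_resolve:
  assumes "\<And>a b. cdiff (\<lambda>z. w z a b) z" "\<And>a b. cdiff (\<lambda>z. p z a b) z" "\<And>is. cdiff (\<lambda>z. t z is) z"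
  shows "cdiff (\<lambda>z. resolve n (w z) (p z) q a (t z) is) z"
proof -
  have *: "cdiff (\<lambda>z. f z / a) z" if "cdiff f z" for f and a :: complex
    unfolding divide_inverse by (intro cdiff_mult that cdiff_const)
  show ?thesis
    using assms
  proof (induction q arbitrary: t a "is" rule: less_induct)
    case (less q)
    show ?case
    proof (cases "q < 2")
      case True
      then show ?thesis using less.prems(3) by (auto simp: less_2_cases_iff intro!: *)
    next
      case False
      then obtain q' where "q = Suc (Suc q')" using le_Suc_ex[of 2 q] by auto
      moreover from this have "cdiff (\<lambda>z. resolve n (w z) (p z) q' a (lam (w z) (t z)) is) z" for a "is"
        using less.prems by (intro less.IH cdiff_lam) auto
      ultimately show ?thesis
        using less.prems by (auto intro!: * cdiff_diff cdiff_lef)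
    qed
  qed
qed

lemma resolve_sum:
  "resolve n w p q a (\<lambda>is. \<Sum>i\<in>A. f i is) is = (\<Sum>i\<in>A. resolve n w p q a (f i) is)"
proof (induction q arbitrary: f a "is" rule: less_induct)
  case (less q)
  have l: "lam w (\<lambda>is. \<Sum>i\<in>A. f i is) = (\<lambda>is. \<Sum>i\<in>A. lam w (f i) is)"
    by (induction A rule: infinite_finite_induct) (auto simp: fun_eq_iff lam_add lam_def)
  show ?case
  proof (cases "q < 2")
    case True
    then show ?thesis by (auto simp: less_2_cases_iff sum_divide_distrib)
  next
    case False
    then obtain q' where "q = Suc (Suc q')" using le_Suc_ex[of 2 q] by auto
    moreover from this have "resolve n w p q' a (\<lambda>is. \<Sum>i\<in>A. lam w (f i) is) =
        (\<lambda>is. \<Sum>i\<in>A. resolve n w p q' a (lam w (f i)) is)" for a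
      by (intro HOL.ext less.IH) simp
    ultimately show ?thesis
      by (simp add: l lef_sum sum_subtractf flip: sum_divide_distrib)
  qed
qed

lemma resolve_add:
  "resolve n w p q a (\<lambda>is. t is + u is) is = resolve n w p q a t is + resolve n w p q a u is"
  using resolve_sum[of n w p q a "\<lambda>b. if b then t else u" "UNIV :: bool set" "is"]
  by (simp add: UNIV_bool add.commute)

lemma resolve_cmult:
  "resolve n w p q a (\<lambda>is. k * t is) is = k * resolve n w p q a t is"
proof (induction q arbitrary: t a "is" rule: less_induct)
  case (less q)
  show ?case
  proof (cases "q < 2")
    case True
    then show ?thesis by (auto simp: less_2_cases_iff)
  next
    case False
    then obtain q' where "q = Suc (Suc q')" using le_Suc_ex[of 2 q] by auto
    moreover from this have "resolve n w p q' a (lam w (\<lambda>is. k * t is)) =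
        (\<lambda>is. k * resolve n w p q' a (lam w t) is)" for a
      unfolding lam_cmult[abs_def] by (intro HOL.ext less.IH) simp
    ultimately show ?thesis
      by (simp add: lef_cmult right_diff_distrib)
  qed
qed

text \<open>\<open>w\<close> is the pullback of \<open>w'\<close> and \<open>p'\<close> the
  push-forward of \<open>p\<close>, so both operators in the recursion commute with
  \<open>push\<close>.\<close>

lemma resolve_push:
  assumes "\<And>c a. w c a = (\<Sum>d\<in>UNIV. \<Sum>b\<in>UNIV. J d c * J b a * w' d b)"
    and "\<And>b d. p' b d = (\<Sum>a\<in>UNIV. \<Sum>c\<in>UNIV. J b a * J d c * p a c)"
  shows "resolve n w' p' q a (push J t) is = push J (resolve n w p q a t) is"
proof (induction q arbitrary: t a "is" rule: less_induct)
  case (less q)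
  have w: "lam w' (push J t) = push J (lam w t)" for t
    by (rule ext) (simp add: lam_push assms(1)[abs_def])
  have p: "lef p' (push J t) = push J (lef p t)" for t
    by (rule ext) (simp add: push_lef assms(2)[abs_def])
  show ?case
  proof (cases "q < 2")
    case True
    have "push J (\<lambda>is. t is / a) is = push J t is / a"
      using push_cmult[of J "inverse a" t "is"] by (simp add: divide_inverse mult.commute)
    then show ?thesis using True by (auto simp: less_2_cases_iff)
  next
    case False
    then obtain q' where q: "q = Suc (Suc q')" using le_Suc_ex[of 2 q] by auto
    have "resolve n w' p' q' a' (push J (lam w t)) = push J (resolve n w p q' a' (lam w t))" for a'
      using less.IH[of q'] q by (auto simp: fun_eq_iff)
    then have "resolve n w' p' q a (push J t) is = inverse a * (push J t is -
        push J (lef p (resolve n w p q' (a - (n - of_nat q')) (lam w t))) is)"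
      by (simp add: q w p divide_inverse mult.commute)
    also have "\<dots> = push J (resolve n w p q a t) is"
      by (simp add: q divide_inverse mult.commute[of _ "inverse a"] push_cmult push_diff)
    finally show ?thesis .
  qed
qed

text \<open>By the product rule the derivatives of \<open>g\<close> antisymmetrize to d\<gamma>,
  while antisymmetry of the tensor gives the sign of the other term. If the contraction of
  \<open>x\<close> with \<open>g\<close> vanishes on an open set, no derivative of \<open>x\<close>
  survives; this makes the composite with the contact map algebraic.\<close>

lemma con_dvg:
  assumes x: "\<And>is. cdiff (\<lambda>z. x z is) z" and g: "\<And>a. cdiff (\<lambda>z. g z a) z"
    and t: "\<And>z. z \<in> Z \<Longrightarrow> tens q (x z)" "open Z" "z \<in> Z"
  shows "con (g z) (dvg x z) is = - dvg (\<lambda>z. con (g z) (x z)) z is + lam (om g z) (x z) is"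
proof -
  have sw: "x y (a # c # is) = - x y (c # a # is)" if "y \<in> Z" for y a c
    using tens_swap[OF t(1)[OF that]] .
  have pdx: "pd c (\<lambda>z. x z (c # a # is)) z = - pd c (\<lambda>z. x z (a # c # is)) z" for a c
    using pd_cong_open[OF t(2,3), of "\<lambda>z. x z (c # a # is)" "\<lambda>z. - x z (a # c # is)", OF sw]
      pd_uminus[OF x] by simp
  have "dvg (\<lambda>z. con (g z) (x z)) z is = (\<Sum>c\<in>UNIV. \<Sum>a\<in>UNIV.
      pd c (\<lambda>z. g z a) z * x z (a # c # is) + g z a * pd c (\<lambda>z. x z (a # c # is)) z)"
    unfolding dvg_def con_def using x g by (simp add: pd_sum pd_mult cdiff_mult)
  moreover have "con (g z) (dvg x z) is = (\<Sum>c\<in>UNIV. \<Sum>a\<in>UNIV. - (g z a * pd c (\<lambda>z. x z (a # c # is)) z))"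
    unfolding dvg_def con_def sum_distrib_left pdx by (subst sum.swap) simp
  moreover have "lam (om g z) (x z) is = (\<Sum>c\<in>UNIV. \<Sum>a\<in>UNIV. pd c (\<lambda>z. g z a) z * x z (a # c # is))"
  proof -
    have "(\<Sum>c\<in>UNIV. \<Sum>a\<in>UNIV. pd a (\<lambda>z. g z c) z * x z (a # c # is)) =
        (\<Sum>c\<in>UNIV. \<Sum>a\<in>UNIV. pd c (\<lambda>z. g z a) z * x z (c # a # is))"
      by (rule sum.swap)
    also have "\<dots> = - (\<Sum>c\<in>UNIV. \<Sum>a\<in>UNIV. pd c (\<lambda>z. g z a) z * x z (a # c # is))"
      unfolding sum_negf[symmetric] by (intro sum.cong refl) (subst sw[OF t(3)], simp)
    finally show ?thesis
      by (simp add: lam_def om_def left_diff_distrib sum_subtractf)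
  qed
  ultimately show ?thesis by (simp add: sum.distrib sum_negf)
qed

section \<open>The operator for one contact form in one chart\<close>

locale contact_domain =
  fixes Z :: "(complex ^ 'm::finite) set" and g :: "complex ^ 'm \<Rightarrow> 'm \<Rightarrow> complex"
    and E :: "complex ^ 'm \<Rightarrow> 'm \<Rightarrow> complex" and p :: "complex ^ 'm \<Rightarrow> 'm \<Rightarrow> 'm \<Rightarrow> complex" and n :: nat
  assumes open_Z: "open Z"
    and cdiff_g: "z \<in> Z \<Longrightarrow> cdiff (\<lambda>z. g z a) z"
    and cdiff_E: "z \<in> Z \<Longrightarrow> cdiff (\<lambda>z. E z a) z"
    and cdiff_p: "z \<in> Z \<Longrightarrow> cdiff (\<lambda>z. p z a b) z"
    and contact_point: "z \<in> Z \<Longrightarrow> contact_point (g z) (om g z) (E z) (p z) n"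
begin

abbreviation "sop \<equiv> split_op n (om g) E p"

lemma cdiff_om: "z \<in> Z \<Longrightarrow> cdiff (\<lambda>z. om g z a b) z"
  unfolding om_def using open_Z cdiff_g by (intro cdiff_diff cdiff_pd) auto

lemma cdiff_vdiv: "z \<in> Z \<Longrightarrow> cdiff (\<lambda>z. vdiv p z b) z"
  unfolding vdiv_def using open_Z cdiff_p by (intro cdiff_sum cdiff_pd) auto

lemma cdiff_dvg:
  assumes "\<And>z is. z \<in> Z \<Longrightarrow> cdiff (\<lambda>z. x z is) z" "z \<in> Z"
  shows "cdiff (\<lambda>z. dvg x z is) z"
  unfolding dvg_def using open_Z assms by (intro cdiff_sum cdiff_pd) auto

lemma cdiff_sop:
  assumes x: "\<And>z is. z \<in> Z \<Longrightarrow> cdiff (\<lambda>z. x z is) z" and z: "z \<in> Z"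
  shows "cdiff (\<lambda>z. sop x z is) z"
  unfolding split_op_def
  by (intro cdiff_add cdiff_diff cdiff_mult cdiff_const cdiff_lef cdiff_ext cdiff_con cdiff_sum
      cdiff_dvg cdiff_vdiv cdiff_om cdiff_E cdiff_p x z)

text \<open>Differentiate the relation that contracting \<gamma> with the bivector gives zero: the
  derivative of \<gamma> contributes half of a trace of \<open>p\<close> against d\<gamma>. This is
  where the dimension enters the coefficients of \<open>split_op\<close>.\<close>

lemma \<gamma>_vdiv:
  assumes "z \<in> Z" shows "(\<Sum>b\<in>UNIV. g z b * vdiv p z b) = - of_nat n"
proof -
  interpret contact_point "g z" "om g z" "E z" "p z" n by (rule contact_point[OF assms])
  have "0 = (\<Sum>b\<in>UNIV. g y b * p y a b)" if "y \<in> Z" for a y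
  proof -
    interpret y: contact_point "g y" "om g y" "E y" "p y" n by (rule contact_point[OF that])
    have "(\<Sum>b\<in>UNIV. g y b * p y a b) = (\<Sum>b\<in>UNIV. - (g y b * p y b a))"
      by (intro sum.cong refl) (subst y.p_anti, simp)
    then show ?thesis by (simp add: sum_negf y.\<gamma>_p)
  qed
  then have "pd a (\<lambda>z. \<Sum>b\<in>UNIV. g z b * p z a b) z = 0" for a
    using pd_cong_open[OF open_Z assms, of "\<lambda>z. \<Sum>b\<in>UNIV. g z b * p z a b" "\<lambda>z. 0"] by simp
  then have "0 = (\<Sum>a\<in>UNIV. \<Sum>b\<in>UNIV. pd a (\<lambda>z. g z b) z * p z a b + g z b * pd a (\<lambda>z. p z a b) z)"
    using cdiff_g[OF assms] cdiff_p[OF assms] by (simp add: pd_sum pd_mult cdiff_mult)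
  also have "\<dots> = (\<Sum>a\<in>UNIV. \<Sum>b\<in>UNIV. pd a (\<lambda>z. g z b) z * p z a b)
      + (\<Sum>a\<in>UNIV. \<Sum>b\<in>UNIV. g z b * pd a (\<lambda>z. p z a b) z)"
    by (simp add: sum.distrib)
  also have "(\<Sum>a\<in>UNIV. \<Sum>b\<in>UNIV. g z b * pd a (\<lambda>z. p z a b) z) = (\<Sum>b\<in>UNIV. g z b * vdiv p z b)"
    by (subst sum.swap) (simp add: vdiv_def sum_distrib_left)
  also have "(\<Sum>a\<in>UNIV. \<Sum>b\<in>UNIV. pd a (\<lambda>z. g z b) z * p z a b) = of_nat n"
  proof -
    have "(\<Sum>a\<in>UNIV. \<Sum>b\<in>UNIV. pd b (\<lambda>z. g z a) z * p z a b) =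
        (\<Sum>a\<in>UNIV. \<Sum>b\<in>UNIV. pd a (\<lambda>z. g z b) z * p z b a)"
      by (rule sum.swap)
    also have "\<dots> = - (\<Sum>a\<in>UNIV. \<Sum>b\<in>UNIV. pd a (\<lambda>z. g z b) z * p z a b)"
      unfolding sum_negf[symmetric] by (intro sum.cong refl) (subst p_anti, simp)
    finally have "(\<Sum>a\<in>UNIV. \<Sum>b\<in>UNIV. p z a b * om g z b a) =
        - 2 * (\<Sum>a\<in>UNIV. \<Sum>b\<in>UNIV. pd a (\<lambda>z. g z b) z * p z a b)"
      by (simp add: om_def right_diff_distrib sum_subtractf mult.commute)
    then show ?thesis using trace_p_w by simp
  qed
  finally show ?thesis by (simp add: add_eq_0_iff)
qed

lemma tens_dvg:
  assumes x: "\<And>z is. z \<in> Z \<Longrightarrow> cdiff (\<lambda>z. x z is) z" and z: "z \<in> Z"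
    and t: "\<And>z. z \<in> Z \<Longrightarrow> tens (Suc q) (x z)"
  shows "tens q (dvg x z)"
proof -
  have "tens q (\<lambda>is. pd c (\<lambda>z. x z (c # is)) z)" for c
    unfolding tens_def
  proof (intro conjI alternatingI allI impI)
    fix xs a b ys
    have "x y ((c # xs) @ a # b # ys) = - x y ((c # xs) @ b # a # ys)" if "y \<in> Z" for y
      using t[OF that] by (intro alternatingD) (simp add: tens_def)
    then show "pd c (\<lambda>z. x z (c # xs @ a # b # ys)) z = - pd c (\<lambda>z. x z (c # xs @ b # a # ys)) z"
      using pd_cong_open[OF open_Z z, of "\<lambda>z. x z (c # xs @ a # b # ys)" "\<lambda>z. - x z (c # xs @ b # a # ys)"]
        pd_uminus[OF x[OF z]] by simp
  next
    fix "is" :: "'m list" assume "length is \<noteq> q"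
    then have "x y (c # is) = 0" if "y \<in> Z" for y using t[OF that] by (simp add: tens_def)
    then show "pd c (\<lambda>z. x z (c # is)) z = 0"
      using pd_cong_open[OF open_Z z, of "\<lambda>z. x z (c # is)" "\<lambda>z. 0"] by simp
  qed
  then show ?thesis unfolding dvg_def[abs_def] by (rule tens_sum)
qed

context
  fixes x :: "complex ^ 'm \<Rightarrow> 'm tensor" and q
  assumes x: "\<And>z is. z \<in> Z \<Longrightarrow> cdiff (\<lambda>z. x z is) z"
    and t: "\<And>z. z \<in> Z \<Longrightarrow> tens q (x z)"
begin

lemma tens_sop:
  assumes z: "z \<in> Z" shows "tens (Suc q) (sop x z)"
proof -
  interpret contact_point "g z" "om g z" "E z" "p z" n by (rule contact_point[OF z])
  have 1: "tens (Suc q) (dvg (\<lambda>z. lef (p z) (x z)) z)"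
  proof (rule tens_dvg)
    fix y assume y: "y \<in> Z"
    show "tens (Suc (Suc q)) (lef (p y) (x y))"
      using contact_point.p_anti[OF contact_point[OF y]] by (rule tens_lef[OF t[OF y]])
  qed (use z in \<open>auto intro!: cdiff_lef cdiff_p x\<close>)
  have 2: "tens (Suc q) (lef (p z) (\<lambda>is. (of_nat n + 1) * dvg x z is
         + con (\<lambda>a. \<Sum>b\<in>UNIV. om g z a b * vdiv p z b) (x z) is))"
  proof (cases q)
    case 0
    \<comment> \<open>In degree 0 both the divergence and the contraction would have degree -1. With
      natural numbers as degrees they have to be shown to vanish separately.\<close>
    have "pd c (\<lambda>z. x z (c # is)) z = 0" for c "is"
      using pd_cong_open[OF open_Z z, of "\<lambda>z. x z (c # is)" "\<lambda>z. 0"] tens_0_Cons[OF t[unfolded 0]] by simp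
    then have "dvg x z is = 0" for "is" by (simp add: dvg_def)
    then show ?thesis using t[OF z] 0 by (simp add: con_degree_0 lef_zero[abs_def] tens_zero)
  next
    case (Suc q')
    then show ?thesis
      using t z x by (auto intro!: tens_lef tens_add tens_cmult tens_dvg tens_con p_anti)
  qed
  show ?thesis
    unfolding split_op_def[abs_def]
    by (intro tens_diff tens_cmult tens_add 1 2 tens_ext t z)
qed

text \<open>The first group contributes \<open>lef p (lam w x)\<close> and \<open>x\<close> with the
  factor \<open>(q - n) + n + 1\<close>, from \<open>lam_lef\<close>, \<open>\<gamma>_vdiv\<close>
  and \<open>\<gamma>_E\<close>. The second contributes \<open>(n + 1) * lef p (lam w x)\<close>.
  Since the first carries the factor \<open>n + 2\<close>, exactly one
  \<open>lef p (lam w x)\<close> is left.\<close>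

lemma con_sop:
  assumes k: "\<And>z. z \<in> Z \<Longrightarrow> con (g z) (x z) = (\<lambda>is. 0)" and z: "z \<in> Z"
  shows "con (g z) (sop x z) is = lef (p z) (lam (om g z) (x z)) is + (of_nat n + 2) * (of_nat q + 1) * x z is"
proof -
  interpret contact_point "g z" "om g z" "E z" "p z" n by (rule contact_point[OF z])
  have dvg0: "dvg y z is = 0" if "\<And>z. z \<in> Z \<Longrightarrow> y z = (\<lambda>is. 0)" for y "is"
    using pd_cong_open[OF open_Z z, of "\<lambda>z. y z (_ # is)" "\<lambda>z. 0"] that
    unfolding dvg_def by (intro sum.neutral) auto
  have 1: "con (g z) (dvg x z) = lam (om g z) (x z)"
    using con_dvg[of x z g Z q, OF x[OF z] cdiff_g[OF z] t open_Z z] dvg0[OF k] by auto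
  have kl: "con (g y) (lef (p y) (x y)) = (\<lambda>is. 0)" if "y \<in> Z" for y
    using contact_point.con_lef_kernel[OF contact_point[OF that] k[OF that]] .
  have 2: "con (g z) (dvg (\<lambda>z. lef (p z) (x z)) z) is = lam (om g z) (lef (p z) (x z)) is"
  proof -
    have "tens (Suc (Suc q)) (lef (p y) (x y))" if "y \<in> Z" for y
      using contact_point.p_anti[OF contact_point[OF that]] by (rule tens_lef[OF t[OF that]])
    then show ?thesis
      using con_dvg[of "\<lambda>z. lef (p z) (x z)" z g Z "Suc (Suc q)", OF cdiff_lef[OF cdiff_p[OF z] x[OF z]]
          cdiff_g[OF z] _ open_Z z] dvg0[of "\<lambda>z. con (g z) (lef (p z) (x z))"] kl by auto
  qed
  have 3: "con (g z) (con \<theta> (x z)) = (\<lambda>is. 0)" for \<theta>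
    by (rule ext) (subst con_con[OF t[OF z]], simp add: k[OF z] con_def)
  have 4: "con (g z) (\<lambda>is. (of_nat n + 1) * dvg x z is + con \<theta> (x z) is) =
      (\<lambda>is. (of_nat n + 1) * lam (om g z) (x z) is)" for \<theta>
    by (rule ext) (simp add: con_add con_cmult 1 3)
  show ?thesis
    unfolding split_op_def[abs_def] con_diff con_cmult con_add con_lef con_ext 2 4 lef_cmult
    by (simp add: k[OF z] ext_zero \<gamma>_p ext_vzero \<gamma>_vdiv[OF z] \<gamma>_E lam_lef[OF t[OF z] k[OF z]])
      (simp add: algebra_simps)
qed

end

end

section \<open>Change of the contact form\<close>

lemma (in contact_point) p_\<gamma>: "(\<Sum>b\<in>UNIV. p a b * \<gamma> b) = 0"
proof -
  have "(\<Sum>b\<in>UNIV. p a b * \<gamma> b) = (\<Sum>b\<in>UNIV. - (\<gamma> b * p b a))"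
    by (intro sum.cong refl) (subst p_anti, simp)
  then show ?thesis by (simp add: sum_negf \<gamma>_p)
qed

text \<open>Lets the transformation rules of the Reeb vector and the bivector be checked on their
  defining equations instead of on Cramer's formulas. The difference of two bivectors is annihilated
  by \<open>w\<close> and by \<gamma>, and \<open>w_p\<close> recovers it from these two
  products.\<close>

lemma contact_point_unique:
  fixes \<gamma> :: "'m::finite \<Rightarrow> complex"
  assumes "contact_point \<gamma> w E p n" "contact_point \<gamma> w E' p' n"
  shows "E' = E" "p' = p"
proof -
  interpret contact_point \<gamma> w E p n by fact
  interpret c': contact_point \<gamma> w E' p' n by fact
  show E: "E' = E"
  proof
    fix a
    have "0 = (\<Sum>b\<in>UNIV. p a b * (\<Sum>c\<in>UNIV. w b c * E' c))"
      by (simp add: c'.w_E)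
    also have "\<dots> = (\<Sum>c\<in>UNIV. (\<Sum>b\<in>UNIV. p a b * w b c) * E' c)"
      by (simp add: sum_distrib_left sum_distrib_right mult.assoc) (rule sum.swap)
    also have "\<dots> = E a * (\<Sum>c\<in>UNIV. \<gamma> c * E' c) - E' a"
      by (simp add: p_w left_diff_distrib sum_subtractf sum_distrib_left mult.assoc)
    finally show "E' a = E a" by (simp add: c'.\<gamma>_E)
  qed
  show "p' = p"
  proof (intro HOL.ext)
    fix a d
    define D where "D = (\<lambda>b. p' a b - p a b)"
    have w0: "(\<Sum>b\<in>UNIV. D b * w b c) = 0" for c
      using p_w c'.p_w E by (simp add: D_def left_diff_distrib sum_subtractf)
    have "0 = (\<Sum>c\<in>UNIV. (\<Sum>b\<in>UNIV. D b * w b c) * p c d)"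
      by (simp add: w0)
    also have "\<dots> = (\<Sum>b\<in>UNIV. D b * (\<Sum>c\<in>UNIV. w b c * p c d))"
      by (simp add: sum_distrib_left sum_distrib_right mult.assoc) (rule sum.swap)
    also have "\<dots> = E d * (\<Sum>b\<in>UNIV. D b * \<gamma> b) - D d"
      unfolding w_p by (simp add: right_diff_distrib sum_subtractf sum_distrib_left mult_ac)
    also have "(\<Sum>b\<in>UNIV. D b * \<gamma> b) = 0"
      by (simp add: D_def left_diff_distrib sum_subtractf p_\<gamma> c'.p_\<gamma>)
    finally show "p' a d = p a d" by (simp add: D_def)
  qed
qed

text \<open>\<open>e\<close> is \<open>\<eta>\<close> raised with the bivector. Lowering it again
  with \<open>w\<close> returns \<open>\<eta>\<close> only up to a multiple of \<gamma>; such
  multiples are harmless on tensors that \<gamma> annihilates.\<close>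

lemma (in contact_point)
  fixes \<eta> :: "'m \<Rightarrow> complex"
  defines "e \<equiv> \<lambda>b. \<Sum>a\<in>UNIV. \<eta> a * p a b"
  shows \<gamma>_raise: "(\<Sum>b\<in>UNIV. \<gamma> b * e b) = 0"
    and raise_self: "(\<Sum>b\<in>UNIV. \<eta> b * e b) = 0"
    and w_raise: "(\<Sum>b\<in>UNIV. w a b * e b) = \<eta> a - \<gamma> a * (\<Sum>c\<in>UNIV. \<eta> c * E c)"
    and p_raise: "(\<Sum>b\<in>UNIV. p a b * \<eta> b) = - e a"
proof -
  show p_raise: "(\<Sum>b\<in>UNIV. p a b * \<eta> b) = - e a" for a
    unfolding e_def sum_negf[symmetric] by (intro sum.cong refl) (subst p_anti, simp)
  have "(\<Sum>b\<in>UNIV. \<gamma> b * e b) = (\<Sum>a\<in>UNIV. \<eta> a * (\<Sum>b\<in>UNIV. p a b * \<gamma> b))"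
    unfolding e_def by (simp add: sum_distrib_left mult_ac) (rule sum.swap)
  then show "(\<Sum>b\<in>UNIV. \<gamma> b * e b) = 0" by (simp add: p_\<gamma>)
  have "(\<Sum>b\<in>UNIV. \<eta> b * e b) = (\<Sum>a\<in>UNIV. \<eta> a * (\<Sum>b\<in>UNIV. p a b * \<eta> b))"
    unfolding e_def sum_distrib_left by (subst sum.swap, intro sum.cong refl) simp
  then show "(\<Sum>b\<in>UNIV. \<eta> b * e b) = 0" by (simp add: p_raise sum_negf)
  have "(\<Sum>b\<in>UNIV. w a b * e b) = (\<Sum>c\<in>UNIV. - (\<eta> c * (\<Sum>b\<in>UNIV. w a b * p b c)))"
    unfolding e_def sum_distrib_left sum_negf[symmetric]
    by (subst sum.swap, intro sum.cong refl) (subst p_anti, simp)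
  also have "\<dots> = \<eta> a - \<gamma> a * (\<Sum>c\<in>UNIV. \<eta> c * E c)"
    unfolding w_p by (simp add: right_diff_distrib sum_subtractf sum_negf sum_distrib_left mult_ac)
  finally show "(\<Sum>b\<in>UNIV. w a b * e b) = \<eta> a - \<gamma> a * (\<Sum>c\<in>UNIV. \<eta> c * E c)" .
qed

text \<open>For \<open>\<eta>\<close> equal to dh / h the new two-form is d(h \<gamma>). Its added
  part, contracted with \<open>E\<close>, leaves \<open>\<eta> - \<eta>(E) \<gamma>\<close>, which
  by \<open>w_raise\<close> is exactly what subtracting the raised \<open>\<eta>\<close> from
  \<open>E\<close> cancels.\<close>

lemma (in contact_point) contact_point_gauge:
  fixes h :: complex and \<eta> :: "'m \<Rightarrow> complex"
  assumes h: "h \<noteq> 0"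
  shows "contact_point (\<lambda>a. h * \<gamma> a) (\<lambda>a b. h * (w a b + \<eta> a * \<gamma> b - \<eta> b * \<gamma> a))
    (\<lambda>b. (E b - (\<Sum>a\<in>UNIV. \<eta> a * p a b)) / h) (\<lambda>a b. p a b / h) n"
proof -
  define e where "e = (\<lambda>b. \<Sum>a\<in>UNIV. \<eta> a * p a b)"
  have raise: "(\<Sum>b\<in>UNIV. \<gamma> b * e b) = 0" "(\<Sum>b\<in>UNIV. \<eta> b * e b) = 0"
    "(\<Sum>b\<in>UNIV. w a b * e b) = \<eta> a - \<gamma> a * (\<Sum>c\<in>UNIV. \<eta> c * E c)"
    "(\<Sum>b\<in>UNIV. p a b * \<eta> b) = - e a" for a
    unfolding e_def by (rule \<gamma>_raise raise_self w_raise p_raise)+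
  have "contact_point (\<lambda>a. h * \<gamma> a) (\<lambda>a b. h * (w a b + \<eta> a * \<gamma> b - \<eta> b * \<gamma> a))
    (\<lambda>b. (E b - e b) / h) (\<lambda>a b. p a b / h) n"
  proof
    show "CARD('m) = 2 * n + 1" by (rule dim)
    show "h * (w a b + \<eta> a * \<gamma> b - \<eta> b * \<gamma> a) = - (h * (w b a + \<eta> b * \<gamma> a - \<eta> a * \<gamma> b))" for a b
      by (subst w_anti) (simp add: algebra_simps)
    show "p a b / h = - (p b a / h)" for a b by (subst p_anti) simp
    have "(\<Sum>a\<in>UNIV. h * \<gamma> a * ((E a - e a) / h)) = (\<Sum>a\<in>UNIV. \<gamma> a * E a) - (\<Sum>a\<in>UNIV. \<gamma> a * e a)"
      unfolding sum_subtractf[symmetric] using h by (intro sum.cong refl) (simp add: field_simps)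
    then show "(\<Sum>a\<in>UNIV. h * \<gamma> a * ((E a - e a) / h)) = 1" by (simp only: \<gamma>_E raise) simp
    show "(\<Sum>a\<in>UNIV. h * \<gamma> a * (p a b / h)) = 0" for b
      using h by (simp add: \<gamma>_p)
    have "(\<Sum>b\<in>UNIV. h * (w a b + \<eta> a * \<gamma> b - \<eta> b * \<gamma> a) * ((E b - e b) / h)) =
       (\<Sum>b\<in>UNIV. w a b * E b) - (\<Sum>b\<in>UNIV. w a b * e b) + \<eta> a * ((\<Sum>b\<in>UNIV. \<gamma> b * E b) - (\<Sum>b\<in>UNIV. \<gamma> b * e b))
        - \<gamma> a * ((\<Sum>b\<in>UNIV. \<eta> b * E b) - (\<Sum>b\<in>UNIV. \<eta> b * e b))" for a
      unfolding sum_subtractf[symmetric] sum_distrib_left sum.distrib[symmetric]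
      using h by (intro sum.cong refl) (simp add: field_simps)
    then show "(\<Sum>b\<in>UNIV. h * (w a b + \<eta> a * \<gamma> b - \<eta> b * \<gamma> a) * ((E b - e b) / h)) = 0" for a
      by (simp only: w_E raise \<gamma>_E) (simp add: algebra_simps)
    have "(\<Sum>b\<in>UNIV. p a b / h * (h * (w b c + \<eta> b * \<gamma> c - \<eta> c * \<gamma> b))) =
       (\<Sum>b\<in>UNIV. p a b * w b c) + \<gamma> c * (\<Sum>b\<in>UNIV. p a b * \<eta> b) - \<eta> c * (\<Sum>b\<in>UNIV. p a b * \<gamma> b)" for a c
      unfolding sum_distrib_left sum.distrib[symmetric] sum_subtractf[symmetric]
      using h by (intro sum.cong refl) (simp add: field_simps)
    then show "(\<Sum>b\<in>UNIV. p a b / h * (h * (w b c + \<eta> b * \<gamma> c - \<eta> c * \<gamma> b))) = (E a - e a) / h * (h * \<gamma> c) - delta a c" for a c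
      using h by (simp only: p_w p_\<gamma> raise) (simp add: field_simps)
  qed
  then show ?thesis unfolding e_def .
qed

lemma contact_domain_gauge:
  assumes "contact_domain Z g E p n" "contact_domain Z g' E' p' n"
    and h: "\<And>z. z \<in> Z \<Longrightarrow> cdiff h z"
    and g': "\<And>z a. z \<in> Z \<Longrightarrow> g' z a = h z * g z a"
    and y: "y \<in> Z"
  defines "\<eta> \<equiv> \<lambda>a. pd a h y / h y"
  shows "h y \<noteq> 0"
    and "om g' y a b = h y * (om g y a b + \<eta> a * g y b - \<eta> b * g y a)"
    and "E' y = (\<lambda>b. (E y b - (\<Sum>a\<in>UNIV. \<eta> a * p y a b)) / h y)"
    and "p' y = (\<lambda>a b. p y a b / h y)"
proof -
  interpret d: contact_domain Z g E p n by fact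
  interpret d': contact_domain Z g' E' p' n by fact
  show hnz: "h y \<noteq> 0"
  proof
    assume "h y = 0"
    then show False using contact_point.\<gamma>_E[OF d'.contact_point[OF y]] g'[OF y] by simp
  qed
  show w': "om g' y a b = h y * (om g y a b + \<eta> a * g y b - \<eta> b * g y a)" for a b
  proof -
    have "pd a (\<lambda>z. g' z b) y = pd a (\<lambda>z. h z * g z b) y" for a b
      using pd_cong_open[OF d.open_Z y g'] .
    then show ?thesis
      using hnz h[OF y] d.cdiff_g[OF y]
      by (simp add: om_def \<eta>_def pd_mult field_simps)
  qed
  have 1: "contact_point (g' y) (om g' y) (\<lambda>b. (E y b - (\<Sum>a\<in>UNIV. \<eta> a * p y a b)) / h y) (\<lambda>a b. p y a b / h y) n"
    using contact_point.contact_point_gauge[OF d.contact_point[OF y] hnz, of \<eta>]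
    unfolding g'[OF y, abs_def, symmetric] w'[abs_def, symmetric]
    by (simp add: g'[OF y] w' fun_eq_iff)
  show "E' y = (\<lambda>b. (E y b - (\<Sum>a\<in>UNIV. \<eta> a * p y a b)) / h y)" "p' y = (\<lambda>a b. p y a b / h y)"
    using contact_point_unique[OF 1 d'.contact_point[OF y]] by simp_all
qed

text \<open>\<open>lef p x\<close> is unchanged because \<open>p\<close> scales inversely to
  \<open>x\<close>, so its divergence is unchanged too. The two groups of terms in
  \<open>split_op\<close> turn out to be invariant separately; hence this lemma leaves their ratio
  free.\<close>

lemma split_op_gauge:
  assumes "contact_domain Z g E p n" "contact_domain Z g' E' p' n"
    and h: "\<And>z. z \<in> Z \<Longrightarrow> cdiff h z"
    and g': "\<And>z a. z \<in> Z \<Longrightarrow> g' z a = h z * g z a"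
    and x: "\<And>z is. z \<in> Z \<Longrightarrow> cdiff (\<lambda>z. x z is) z" and t: "\<And>z. z \<in> Z \<Longrightarrow> tens q (x z)"
    and k: "\<And>z. z \<in> Z \<Longrightarrow> con (g z) (x z) = (\<lambda>is. 0)"
    and x': "\<And>z is. z \<in> Z \<Longrightarrow> x' z is = h z * x z is"
    and z: "z \<in> Z"
  shows "split_op n (om g') E' p' x' z is = split_op n (om g) E p x z is"
proof -
  interpret d: contact_domain Z g E p n by fact
  interpret d': contact_domain Z g' E' p' n by fact
  define \<eta> where "\<eta> = (\<lambda>z a. pd a h z / h z)"
  have hnz: "h y \<noteq> 0"
    and w': "om g' y a b = h y * (om g y a b + \<eta> y a * g y b - \<eta> y b * g y a)"
    and uniq: "E' y = (\<lambda>b. (E y b - (\<Sum>a\<in>UNIV. \<eta> y a * p y a b)) / h y)" "p' y = (\<lambda>a b. p y a b / h y)"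
    if "y \<in> Z" for y a b
    using contact_domain_gauge[OF assms(1,2) h g' that] unfolding \<eta>_def by blast+
  interpret contact_point "g z" "om g z" "E z" "p z" n by (rule d.contact_point[OF z])
  define e where "e = (\<lambda>b. \<Sum>a\<in>UNIV. \<eta> z a * p z a b)"
  define V where "V = vdiv p z"
  have lef': "lef (p' y) (x' y) is = lef (p y) (x y) is" if "y \<in> Z" for y "is"
  proof -
    have "x' y = (\<lambda>is. h y * x y is)" using x'[OF that] by blast
    moreover have "p' y = (\<lambda>a b. inverse (h y) * p y a b)" using uniq(2)[OF that] by (simp add: divide_inverse mult.commute)
    ultimately show ?thesis using hnz[OF that] by (simp add: lef_pcmult lef_cmult)
  qed
  have dvg': "dvg (\<lambda>z. lef (p' z) (x' z)) z is = dvg (\<lambda>z. lef (p z) (x z)) z is" for "is"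
    unfolding dvg_def by (intro sum.cong refl pd_cong_open[OF d.open_Z z lef'])
  have dvgx: "dvg x' z = (\<lambda>is. h z * (con (\<eta> z) (x z) is + dvg x z is))"
  proof
    fix "is"
    have "pd c (\<lambda>z. x' z (c # is)) z = pd c h z * x z (c # is) + h z * pd c (\<lambda>z. x z (c # is)) z" for c
      using pd_mult[OF h[OF z] x[OF z]] by (subst pd_cong_open[OF d.open_Z z x']) auto
    then show "dvg x' z is = h z * (con (\<eta> z) (x z) is + dvg x z is)"
      using hnz[OF z] by (simp add: dvg_def con_def \<eta>_def sum.distrib distrib_left sum_distrib_left)
  qed
  have V': "vdiv p' z = (\<lambda>b. (V b - e b) / h z)"
  proof
    fix b
    have "pd a (\<lambda>z. p z a b) z = \<eta> z a * p z a b + h z * pd a (\<lambda>z. p' z a b) z" for a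
    proof -
      have "pd a (\<lambda>z. p z a b) z = pd a (\<lambda>z. h z * p' z a b) z"
        using uniq(2) hnz by (intro pd_cong_open[OF d.open_Z z]) simp
      also have "\<dots> = pd a h z * p' z a b + h z * pd a (\<lambda>z. p' z a b) z"
        using h[OF z] d'.cdiff_p[OF z] by (simp add: pd_mult)
      finally show ?thesis by (simp add: uniq(2)[OF z] \<eta>_def)
    qed
    then have "V b = e b + h z * vdiv p' z b"
      by (simp add: V_def vdiv_def e_def sum.distrib sum_distrib_left)
    then show "vdiv p' z b = (V b - e b) / h z" using hnz[OF z] by (simp add: field_simps)
  qed
  have x'z: "x' z = (\<lambda>is. h z * x z is)" using x'[OF z] by blast
  \<comment> \<open>The Reeb field and the divergence of the bivector acquire the same correction
    \<open>- e / h\<close>, so it drops out of their difference.\<close>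
  have exts: "ext (E' z) (x' z) is - ext (vdiv p' z) (x' z) is = ext (E z) (x z) is - ext V (x z) is" for "is"
  proof -
    have "ext (\<lambda>b. f b / h z) (\<lambda>is. h z * x z is) is = ext f (x z) is" for f
      using hnz[OF z] ext_vcmult[of "inverse (h z)" f "\<lambda>is. h z * x z is" "is"]
      by (simp add: ext_cmult divide_inverse mult.commute)
    then show ?thesis
      unfolding x'z V' uniq(1)[OF z] by (simp add: ext_vdiff e_def)
  qed
  have raise: "(\<Sum>b\<in>UNIV. g z b * e b) = 0"
    "(\<Sum>b\<in>UNIV. om g z a b * e b) = \<eta> z a - g z a * (\<Sum>c\<in>UNIV. \<eta> z c * E z c)" for a
    unfolding e_def by (rule \<gamma>_raise w_raise)+
  define r where "r = (\<Sum>c\<in>UNIV. \<eta> z c * E z c) - (\<Sum>b\<in>UNIV. \<eta> z b * (V b - e b))"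
  \<comment> \<open>Of the factor \<open>n + 1\<close>, one unit comes from lowering
    \<open>e\<close> and \<open>n\<close> units from \<gamma> contracted with \<open>V\<close>. It
    matches the term that \<open>(n + 1) * dvg x'\<close> produces from the derivative of
    \<open>h\<close>; the multiple \<open>r\<close> of \<gamma> acts as zero on
    \<open>x\<close>.\<close>
  have wV: "(\<Sum>b\<in>UNIV. om g' z a b * vdiv p' z b) =
      (\<Sum>b\<in>UNIV. om g z a b * V b) - (of_nat n + 1) * \<eta> z a + r * g z a" for a
  proof -
    have "(\<Sum>b\<in>UNIV. om g' z a b * vdiv p' z b) =
        (\<Sum>b\<in>UNIV. (om g z a b + \<eta> z a * g z b - \<eta> z b * g z a) * (V b - e b))"
      using hnz[OF z] by (simp add: w'[OF z] V')
    also have "\<dots> = (\<Sum>b\<in>UNIV. om g z a b * V b) - (\<Sum>b\<in>UNIV. om g z a b * e b)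
       + \<eta> z a * ((\<Sum>b\<in>UNIV. g z b * V b) - (\<Sum>b\<in>UNIV. g z b * e b))
       - g z a * (\<Sum>b\<in>UNIV. \<eta> z b * (V b - e b))"
      unfolding sum_subtractf[symmetric] sum_distrib_left sum.distrib[symmetric]
      by (intro sum.cong refl) (simp add: algebra_simps)
    also have "\<dots> = (\<Sum>b\<in>UNIV. om g z a b * V b) - (of_nat n + 1) * \<eta> z a + r * g z a"
      unfolding raise V_def d.\<gamma>_vdiv[OF z] by (simp add: r_def V_def algebra_simps)
    finally show ?thesis .
  qed
  have last: "(of_nat n + 1) * dvg x' z is + con (\<lambda>a. \<Sum>b\<in>UNIV. om g' z a b * vdiv p' z b) (x' z) is
     = h z * ((of_nat n + 1) * dvg x z is + con (\<lambda>a. \<Sum>b\<in>UNIV. om g z a b * V b) (x z) is)" for "is"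
    unfolding wV dvgx x'z con_cmult con_vadd con_vdiff con_vcmult
    by (simp add: k[OF z] algebra_simps)
  have lefh: "lef (p' z) (\<lambda>is. h z * y is) is = lef (p z) y is" for y "is"
    using hnz[OF z] lef_pcmult[of "inverse (h z)" "p z" y "is"]
    by (simp add: lef_cmult uniq(2)[OF z] divide_inverse mult.commute)
  have "D - ext (vdiv p' z) (x' z) is + ext (E' z) (x' z) is = D - ext (vdiv p z) (x z) is + ext (E z) (x z) is" for D
    using exts[of "is"] by (simp add: V_def algebra_simps)
  then show ?thesis
    unfolding split_op_def last lefh dvg' by (simp only: V_def)
qed

text \<open>On tensors annihilated by \<gamma> the added part of the two-form contracts to zero.
  Thus \<open>lam\<close> is multiplied by \<open>h\<close> and \<open>lef\<close> divided by
  \<open>h\<close>, and in the recursion the two always occur in pairs.\<close>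

lemma (in contact_point) resolve_gauge:
  assumes h: "h \<noteq> 0" and w': "\<And>a b. w' a b = h * (w a b + \<eta> a * \<gamma> b - \<eta> b * \<gamma> a)"
    and p': "p' = (\<lambda>a b. p a b / h)" and "tens q t" "con \<gamma> t = (\<lambda>is. 0)"
  shows "resolve m w' p' q a t is = resolve m w p q a t is"
  using assms(4,5)
proof (induction q arbitrary: t a "is" rule: less_induct)
  case (less q)
  note t = less.prems
  show ?case
  proof (cases "q < 2")
    case True
    then show ?thesis by (auto simp: less_2_cases_iff)
  next
    case False
    then obtain q' where q: "q = Suc (Suc q')" using le_Suc_ex[of 2 q] by auto
    have lam': "lam w' t is = h * lam w t is" for "is"
    proof -
      have "(\<Sum>c\<in>UNIV. \<Sum>a\<in>UNIV. \<eta> c * \<gamma> a * t (a # c # is)) = con \<eta> (con \<gamma> t) is"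
        by (simp add: con_def sum_distrib_left mult_ac)
      then have 1: "(\<Sum>c\<in>UNIV. \<Sum>a\<in>UNIV. \<eta> c * \<gamma> a * t (a # c # is)) = 0" by (simp add: t(2) con_def)
      have "(\<Sum>c\<in>UNIV. \<Sum>a\<in>UNIV. \<eta> a * \<gamma> c * t (a # c # is)) = con \<gamma> (con \<eta> t) is"
        by (simp add: con_def sum_distrib_left mult_ac)
      also have "\<dots> = 0" using con_con[OF t(1), of \<gamma> \<eta> "is"] by (simp add: t(2) con_def)
      finally have 2: "(\<Sum>c\<in>UNIV. \<Sum>a\<in>UNIV. \<eta> a * \<gamma> c * t (a # c # is)) = 0" .
      have "lam w' t is = h * (lam w t is + ((\<Sum>c\<in>UNIV. \<Sum>a\<in>UNIV. \<eta> c * \<gamma> a * t (a # c # is))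
          - (\<Sum>c\<in>UNIV. \<Sum>a\<in>UNIV. \<eta> a * \<gamma> c * t (a # c # is))) / 2)"
        unfolding lam_def w' sum_subtractf[symmetric] add_divide_distrib[symmetric] sum.distrib[symmetric]
          sum_distrib_left times_divide_eq_right
        by (intro arg_cong[where f = "\<lambda>x. x / 2"] sum.cong refl) (simp add: algebra_simps)
      then show ?thesis by (simp add: 1 2)
    qed
    have "resolve m w' p' q' b (lam w' t) = (\<lambda>is. h * resolve m w p q' b (lam w t) is)" for b
      using less.IH[of q' "lam w t"] tens_lam[of q' t w] con_lam_kernel[OF t] t
      by (intro HOL.ext) (simp add: lam'[abs_def] resolve_cmult q)
    moreover have "lef p' (\<lambda>is. h * y is) is = lef p y is" for y "is"
      using h lef_pcmult[of "inverse h" p y "is"]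
      by (simp add: lef_cmult p' divide_inverse mult.commute)
    ultimately show ?thesis by (simp add: q)
  qed
qed

lemma contact_domain_subset:
  "contact_domain Z g E p n \<Longrightarrow> open Z' \<Longrightarrow> Z' \<subseteq> Z \<Longrightarrow> contact_domain Z' g E p n"
  unfolding contact_domain_def by blast

section \<open>Change of coordinates\<close>

text \<open>The derivative of \<open>push J t\<close> for fixed \<open>t\<close> when
  \<open>J\<close> moves with velocity \<open>J'\<close>.\<close>

fun dpush :: "('m::finite \<Rightarrow> 'm \<Rightarrow> complex) \<Rightarrow> ('m \<Rightarrow> 'm \<Rightarrow> complex) \<Rightarrow> 'm tensor \<Rightarrow> 'm tensor" where
  "dpush J J' t [] = 0"
| "dpush J J' t (b # bs) = (\<Sum>e\<in>UNIV. J' b e * push J (slot e t) bs + J b e * dpush J J' (slot e t) bs)"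

lemma pd_push:
  assumes J: "\<And>b e. cdiff (\<lambda>z. J z b e) z" and t: "\<And>is. cdiff (\<lambda>z. t z is) z"
  shows "pd a (\<lambda>z. push (J z) (t z) is) z =
    dpush (J z) (\<lambda>b e. pd a (\<lambda>z. J z b e) z) (t z) is + push (J z) (\<lambda>is. pd a (\<lambda>z. t z is) z) is"
  using t
proof (induction "is" arbitrary: t)
  case (Cons b bs)
  have "cdiff (\<lambda>z. push (J z) (slot e (t z)) bs) z" for e
    using J Cons.prems by (rule cdiff_push)
  then show ?case
    using J Cons.prems Cons.IH[of "\<lambda>z. slot _ (t z)"]
    by (simp add: pd_sum pd_mult cdiff_mult distrib_left sum.distrib add_ac)
qed simp

lemma dpush_minus: "dpush J J' (\<lambda>is. - t is) is = - dpush J J' t is"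
  by (induction "is" arbitrary: t) (simp_all add: push_minus sum.distrib sum_negf sum_subtractf)

text \<open>The derivative of the Jacobian is a symmetric second derivative, and \<open>t\<close> is antisymmetric.\<close>

lemma dpush_symmetric:
  assumes "alternating t" and sym: "\<And>a b c. J' a b c = J' c b a"
  shows "(\<Sum>a\<in>UNIV. dpush J (J' a) (slot a t) is) = 0"
  using assms(1)
proof (induction "is" arbitrary: t)
  case (Cons b bs)
  note sw = alternating_slot_slot[OF Cons.prems]
  have "(\<Sum>a\<in>UNIV. \<Sum>e\<in>UNIV. J' a b e * push J (slot e (slot a t)) bs) =
      (\<Sum>a\<in>UNIV. \<Sum>e\<in>UNIV. J' e b a * push J (slot a (slot e t)) bs)"
    by (rule sum.swap)
  also have "\<dots> = - (\<Sum>a\<in>UNIV. \<Sum>e\<in>UNIV. J' a b e * push J (slot e (slot a t)) bs)"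
    unfolding sum_negf[symmetric] by (intro sum.cong refl) (subst sw, subst sym, simp add: push_minus)
  finally have 1: "(\<Sum>a\<in>UNIV. \<Sum>e\<in>UNIV. J' a b e * push J (slot e (slot a t)) bs) = 0" by simp
  have "(\<Sum>a\<in>UNIV. \<Sum>e\<in>UNIV. J b e * dpush J (J' a) (slot e (slot a t)) bs) =
      (\<Sum>e\<in>UNIV. \<Sum>a\<in>UNIV. J b e * dpush J (J' a) (slot e (slot a t)) bs)"
    by (rule sum.swap)
  also have "\<dots> = (\<Sum>e\<in>UNIV. - (J b e * (\<Sum>a\<in>UNIV. dpush J (J' a) (slot a (slot e t)) bs)))"
    unfolding sum_distrib_left sum_negf[symmetric]
    by (intro sum.cong refl) (subst sw, simp add: dpush_minus)
  also have "\<dots> = 0" using Cons.IH[OF alternating_slot[OF Cons.prems]] by simp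
  finally show ?case using 1 by (simp add: sum.distrib)
qed simp

text \<open>\<open>K\<close> is the inverse Jacobian, expressed at the source point; the two matrix
  identities stand in for an inverse map.\<close>

locale coord_change =
  fixes Z Z' :: "(complex ^ 'm::finite) set" and \<phi> :: "complex ^ 'm \<Rightarrow> complex ^ 'm"
    and J K :: "complex ^ 'm \<Rightarrow> 'm \<Rightarrow> 'm \<Rightarrow> complex"
  assumes open_source: "open Z" and open_target: "open Z'"
    and maps: "z \<in> Z \<Longrightarrow> \<phi> z \<in> Z'"
    and cdiff_\<phi>: "z \<in> Z \<Longrightarrow> cdiff (\<lambda>z. \<phi> z $ b) z"
    and J: "J z b a = pd a (\<lambda>z. \<phi> z $ b) z"
    and J_K: "z \<in> Z \<Longrightarrow> (\<Sum>a\<in>UNIV. J z b a * K z a d) = delta b d"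
    and K_J: "z \<in> Z \<Longrightarrow> (\<Sum>b\<in>UNIV. K z a b * J z b c) = delta a c"
begin

lemma cdiff_J: "z \<in> Z \<Longrightarrow> cdiff (\<lambda>z. J z b a) z"
  unfolding J using open_source cdiff_\<phi> by (intro cdiff_pd) auto

lemma pd_J: "z \<in> Z \<Longrightarrow> pd c (\<lambda>z. J z b a) z = pd a (\<lambda>z. J z b c) z"
  unfolding J using open_source cdiff_\<phi> by (intro pd_commute) auto

text \<open>The logarithmic derivative of the Jacobian determinant.\<close>

definition \<tau> :: "complex ^ 'm \<Rightarrow> 'm \<Rightarrow> complex" where
  "\<tau> z e = (\<Sum>b\<in>UNIV. \<Sum>a\<in>UNIV. K z a b * pd e (\<lambda>z. J z b a) z)"

lemma pd_target:
  assumes z: "z \<in> Z" and f: "\<And>w. w \<in> Z' \<Longrightarrow> cdiff f w"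
  shows "pd b f (\<phi> z) = (\<Sum>a\<in>UNIV. K z a b * pd a (\<lambda>z. f (\<phi> z)) z)"
proof -
  have "(\<Sum>a\<in>UNIV. K z a b * pd a (\<lambda>z. f (\<phi> z)) z) =
      (\<Sum>a\<in>UNIV. \<Sum>d\<in>UNIV. pd d f (\<phi> z) * (J z d a * K z a b))"
    using cdiff_\<phi>[OF z] f[OF maps[OF z]] by (simp add: pd_compose J[symmetric] sum_distrib_left mult_ac)
  also have "\<dots> = (\<Sum>d\<in>UNIV. pd d f (\<phi> z) * (\<Sum>a\<in>UNIV. J z d a * K z a b))"
    by (subst sum.swap) (simp add: sum_distrib_left)
  finally show ?thesis by (simp add: J_K[OF z])
qed

text \<open>The coordinate volume forms differ by the Jacobian determinant, whose logarithmic
  derivative is \<tau>. Differentiating the Jacobian in the slot that is summed gives the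
  contraction with \<tau>; differentiating it in the other slots gives zero by
  \<open>dpush_symmetric\<close>.\<close>

lemma dvg_push:
  assumes z: "z \<in> Z"
    and y: "\<And>z is. z \<in> Z \<Longrightarrow> cdiff (\<lambda>z. y z is) z" and alt: "alternating (y z)"
    and y': "\<And>w is. w \<in> Z' \<Longrightarrow> cdiff (\<lambda>w. y' w is) w"
    and push: "\<And>z is. z \<in> Z \<Longrightarrow> y' (\<phi> z) is = push (J z) (y z) is"
  shows "dvg y' (\<phi> z) is = push (J z) (dvg y z) is + push (J z) (con (\<tau> z) (y z)) is"
proof -
  define P where "P = (\<lambda>e. push (J z) (slot e (y z)) is)"
  define Q where "Q = (\<lambda>a e. pd a (\<lambda>z. push (J z) (slot e (y z)) is) z)"
  have pdb: "pd a (\<lambda>z. y' (\<phi> z) (b # is)) z = (\<Sum>e\<in>UNIV. pd e (\<lambda>z. J z b a) z * P e) + (\<Sum>e\<in>UNIV. J z b e * Q a e)" for a b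
  proof -
    have "pd a (\<lambda>z. y' (\<phi> z) (b # is)) z = pd a (\<lambda>z. push (J z) (y z) (b # is)) z"
      by (rule pd_cong_open[OF open_source z push])
    also have "\<dots> = (\<Sum>e\<in>UNIV. pd a (\<lambda>z. J z b e) z * P e + J z b e * Q a e)"
      using cdiff_J[OF z] y[OF z] by (simp add: pd_sum pd_mult cdiff_mult cdiff_push P_def Q_def)
    finally show ?thesis by (simp add: sum.distrib pd_J[OF z, of a])
  qed
  have "dvg y' (\<phi> z) is = (\<Sum>b\<in>UNIV. \<Sum>a\<in>UNIV. K z a b * pd a (\<lambda>z. y' (\<phi> z) (b # is)) z)"
    unfolding dvg_def by (intro sum.cong refl pd_target[OF z y'])
  also have "\<dots> = (\<Sum>b\<in>UNIV. \<Sum>a\<in>UNIV. \<Sum>e\<in>UNIV. K z a b * pd e (\<lambda>z. J z b a) z * P e)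
      + (\<Sum>b\<in>UNIV. \<Sum>a\<in>UNIV. \<Sum>e\<in>UNIV. K z a b * J z b e * Q a e)"
    unfolding pdb by (simp add: distrib_left sum.distrib sum_distrib_left mult.assoc)
  also have "(\<Sum>b\<in>UNIV. \<Sum>a\<in>UNIV. \<Sum>e\<in>UNIV. K z a b * pd e (\<lambda>z. J z b a) z * P e) = (\<Sum>e\<in>UNIV. \<tau> z e * P e)"
  proof -
    have "(\<Sum>b\<in>UNIV. \<Sum>a\<in>UNIV. \<Sum>e\<in>UNIV. K z a b * pd e (\<lambda>z. J z b a) z * P e) =
        (\<Sum>b\<in>UNIV. \<Sum>e\<in>UNIV. \<Sum>a\<in>UNIV. K z a b * pd e (\<lambda>z. J z b a) z * P e)"
      by (intro sum.cong refl sum.swap)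
    also have "\<dots> = (\<Sum>e\<in>UNIV. \<Sum>b\<in>UNIV. \<Sum>a\<in>UNIV. K z a b * pd e (\<lambda>z. J z b a) z * P e)"
      by (rule sum.swap)
    finally show ?thesis by (simp add: \<tau>_def sum_distrib_right)
  qed
  also have "\<dots> = push (J z) (con (\<tau> z) (y z)) is"
    by (simp add: con_slot push_sum push_cmult P_def)
  also have "(\<Sum>b\<in>UNIV. \<Sum>a\<in>UNIV. \<Sum>e\<in>UNIV. K z a b * J z b e * Q a e) = push (J z) (dvg y z) is"
  proof -
    have "(\<Sum>b\<in>UNIV. \<Sum>a\<in>UNIV. \<Sum>e\<in>UNIV. K z a b * J z b e * Q a e) =
        (\<Sum>a\<in>UNIV. \<Sum>b\<in>UNIV. \<Sum>e\<in>UNIV. K z a b * J z b e * Q a e)"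
      by (rule sum.swap)
    also have "\<dots> = (\<Sum>a\<in>UNIV. \<Sum>e\<in>UNIV. \<Sum>b\<in>UNIV. K z a b * J z b e * Q a e)"
      by (intro sum.cong refl sum.swap)
    also have "\<dots> = (\<Sum>a\<in>UNIV. Q a a)"
      by (simp add: K_J[OF z] flip: sum_distrib_right)
    also have "\<dots> = (\<Sum>a\<in>UNIV. dpush (J z) (\<lambda>b e. pd a (\<lambda>z. J z b e) z) (slot a (y z)) is)
        + (\<Sum>a\<in>UNIV. push (J z) (\<lambda>is. pd a (\<lambda>z. y z (a # is)) z) is)"
      unfolding Q_def using cdiff_J[OF z] y[OF z] by (simp add: pd_push sum.distrib)
    also have "(\<Sum>a\<in>UNIV. dpush (J z) (\<lambda>b e. pd a (\<lambda>z. J z b e) z) (slot a (y z)) is) = 0"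
      by (rule dpush_symmetric[OF alt]) (rule pd_J[OF z])
    finally show ?thesis by (simp add: dvg_def[abs_def] push_sum)
  qed
  finally show ?thesis by simp
qed

text \<open>The exterior derivative commutes with pullback because the second derivatives of the
  coordinate change are symmetric and cancel.\<close>

lemma om_push:
  assumes z: "z \<in> Z" and g: "\<And>z a. z \<in> Z \<Longrightarrow> g z a = (\<Sum>b\<in>UNIV. g' (\<phi> z) b * J z b a)"
    and g': "\<And>w b. w \<in> Z' \<Longrightarrow> cdiff (\<lambda>w. g' w b) w"
  shows "om g z c a = (\<Sum>d\<in>UNIV. \<Sum>b\<in>UNIV. J z d c * J z b a * om g' (\<phi> z) d b)"
proof -
  have pg: "pd c (\<lambda>z. g z a) z = (\<Sum>b\<in>UNIV. \<Sum>d\<in>UNIV. J z d c * J z b a * pd d (\<lambda>w. g' w b) (\<phi> z))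
      + (\<Sum>b\<in>UNIV. g' (\<phi> z) b * pd c (\<lambda>z. J z b a) z)" for c a
  proof -
    have "pd c (\<lambda>z. g z a) z = pd c (\<lambda>z. \<Sum>b\<in>UNIV. g' (\<phi> z) b * J z b a) z"
      by (rule pd_cong_open[OF open_source z g])
    also have "\<dots> = (\<Sum>b\<in>UNIV. (\<Sum>d\<in>UNIV. pd d (\<lambda>w. g' w b) (\<phi> z) * J z d c) * J z b a
        + g' (\<phi> z) b * pd c (\<lambda>z. J z b a) z)"
    proof -
      have "cdiff (\<lambda>z. g' (\<phi> z) b) z" for b
        by (rule cdiff_compose[of \<phi> z "\<lambda>w. g' w b", OF cdiff_\<phi>[OF z] g'[OF maps[OF z]]])
      moreover have "pd c (\<lambda>z. g' (\<phi> z) b) z = (\<Sum>d\<in>UNIV. pd d (\<lambda>w. g' w b) (\<phi> z) * J z d c)" for b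
        using pd_compose[of \<phi> z "\<lambda>w. g' w b" c, OF cdiff_\<phi>[OF z] g'[OF maps[OF z]]] by (simp add: J)
      ultimately show ?thesis
        using cdiff_J[OF z] by (simp add: pd_sum pd_mult cdiff_mult)
    qed
    finally show ?thesis by (simp add: sum.distrib sum_distrib_right sum_distrib_left mult_ac)
  qed
  have "om g z c a = (\<Sum>b\<in>UNIV. \<Sum>d\<in>UNIV. J z d c * J z b a * pd d (\<lambda>w. g' w b) (\<phi> z))
      - (\<Sum>b\<in>UNIV. \<Sum>d\<in>UNIV. J z d a * J z b c * pd d (\<lambda>w. g' w b) (\<phi> z))"
    unfolding om_def pg pd_J[OF z, of c] by simp
  also have "(\<Sum>b\<in>UNIV. \<Sum>d\<in>UNIV. J z d c * J z b a * pd d (\<lambda>w. g' w b) (\<phi> z)) =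
      (\<Sum>d\<in>UNIV. \<Sum>b\<in>UNIV. J z d c * J z b a * pd d (\<lambda>w. g' w b) (\<phi> z))"
    by (rule sum.swap)
  finally show ?thesis
    by (simp add: om_def right_diff_distrib sum_subtractf mult_ac)
qed

lemma contact_point_push:
  assumes z: "z \<in> Z" and "contact_point \<gamma> w E p n"
    and \<gamma>: "\<And>a. \<gamma> a = (\<Sum>b\<in>UNIV. \<gamma>' b * J z b a)"
    and w: "\<And>c a. w c a = (\<Sum>d\<in>UNIV. \<Sum>b\<in>UNIV. J z d c * J z b a * w' d b)"
    and w': "\<And>a b. w' a b = - w' b a"
  shows "contact_point \<gamma>' w' (\<lambda>b. \<Sum>a\<in>UNIV. J z b a * E a)
    (\<lambda>b d. \<Sum>a\<in>UNIV. \<Sum>c\<in>UNIV. J z b a * J z d c * p a c) n"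
proof -
  interpret contact_point \<gamma> w E p n by fact
  show ?thesis
  proof
    show "CARD('m) = 2 * n + 1" by (rule dim)
    show "w' a b = - w' b a" for a b by (rule w')
    show "(\<Sum>a\<in>UNIV. \<Sum>c\<in>UNIV. J z b a * J z d c * p a c) = - (\<Sum>a\<in>UNIV. \<Sum>c\<in>UNIV. J z d a * J z b c * p a c)" for b d
      unfolding sum_negf[symmetric]
      by (subst sum.swap, intro sum.cong refl) (subst p_anti, simp)
    have pull: "(\<Sum>b\<in>UNIV. \<gamma>' b * (\<Sum>a\<in>UNIV. J z b a * v a)) = (\<Sum>a\<in>UNIV. \<gamma> a * v a)" for v
      unfolding \<gamma> sum_distrib_left sum_distrib_right by (subst sum.swap) (simp add: mult.assoc)
    show "(\<Sum>b\<in>UNIV. \<gamma>' b * (\<Sum>a\<in>UNIV. J z b a * E a)) = 1"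
      unfolding pull by (rule \<gamma>_E)
    have "(\<Sum>b\<in>UNIV. \<gamma>' b * (\<Sum>a\<in>UNIV. \<Sum>c\<in>UNIV. J z b a * J z d c * p a c)) =
        (\<Sum>b\<in>UNIV. \<gamma>' b * (\<Sum>a\<in>UNIV. J z b a * (\<Sum>c\<in>UNIV. J z d c * p a c)))" for d
      by (simp add: sum_distrib_left mult.assoc)
    also have "\<dots> d = (\<Sum>c\<in>UNIV. J z d c * (\<Sum>a\<in>UNIV. \<gamma> a * p a c))" for d
      unfolding pull unfolding sum_distrib_left by (subst sum.swap) (simp add: mult_ac)
    finally show "(\<Sum>b\<in>UNIV. \<gamma>' b * (\<Sum>a\<in>UNIV. \<Sum>c\<in>UNIV. J z b a * J z d c * p a c)) = 0" for d
      by (simp add: \<gamma>_p)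
    \<comment> \<open>Covectors in the target are compared after pulling back, where the required
      equations become those of the source.\<close>
    have Jinj: "f = f'" if "\<And>a. (\<Sum>b\<in>UNIV. f b * J z b a) = (\<Sum>b\<in>UNIV. f' b * J z b a)" for f f' :: "'m \<Rightarrow> complex"
    proof
      fix d
      have *: "(\<Sum>a\<in>UNIV. (\<Sum>b\<in>UNIV. f b * J z b a) * K z a d) = f d" for f
      proof -
        have "(\<Sum>a\<in>UNIV. (\<Sum>b\<in>UNIV. f b * J z b a) * K z a d) = (\<Sum>b\<in>UNIV. f b * (\<Sum>a\<in>UNIV. J z b a * K z a d))"
          unfolding sum_distrib_left sum_distrib_right by (subst sum.swap) (simp add: mult.assoc)
        then show ?thesis by (simp add: J_K[OF z])
      qed
      show "f d = f' d" using *[of f] *[of f'] that by simp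
    qed
    have wJ: "w c a = (\<Sum>d\<in>UNIV. (\<Sum>b\<in>UNIV. w' d b * J z b a) * J z d c)" for c a
      unfolding w by (simp add: sum_distrib_left sum_distrib_right mult_ac)
    have "(\<lambda>d. \<Sum>b\<in>UNIV. w' d b * (\<Sum>a\<in>UNIV. J z b a * E a)) = (\<lambda>d. 0)"
    proof (rule Jinj)
      fix c
      have "(\<Sum>d\<in>UNIV. (\<Sum>b\<in>UNIV. w' d b * (\<Sum>a\<in>UNIV. J z b a * E a)) * J z d c) =
          (\<Sum>d\<in>UNIV. \<Sum>a\<in>UNIV. \<Sum>b\<in>UNIV. w' d b * J z b a * J z d c * E a)"
        unfolding sum_distrib_left sum_distrib_right
        by (rule sum.cong[OF refl], subst sum.swap) (simp add: mult_ac)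
      also have "\<dots> = (\<Sum>a\<in>UNIV. w c a * E a)"
        unfolding wJ sum_distrib_right by (subst sum.swap) simp
      finally show "(\<Sum>d\<in>UNIV. (\<Sum>b\<in>UNIV. w' d b * (\<Sum>a\<in>UNIV. J z b a * E a)) * J z d c) = (\<Sum>d\<in>UNIV. 0 * J z d c)"
        by (simp add: w_E)
    qed
    then show "(\<Sum>b\<in>UNIV. w' d b * (\<Sum>a\<in>UNIV. J z b a * E a)) = 0" for d by metis
    have pw': "(\<lambda>e. \<Sum>d\<in>UNIV. (\<Sum>a\<in>UNIV. \<Sum>c\<in>UNIV. J z b a * J z d c * p a c) * w' d e) =
        (\<lambda>e. (\<Sum>a\<in>UNIV. J z b a * E a) * \<gamma>' e - delta b e)" for b
    proof (rule Jinj)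
      fix f
      have "(\<Sum>e\<in>UNIV. (\<Sum>d\<in>UNIV. (\<Sum>a\<in>UNIV. \<Sum>c\<in>UNIV. J z b a * J z d c * p a c) * w' d e) * J z e f) =
         (\<Sum>e\<in>UNIV. \<Sum>d\<in>UNIV. \<Sum>a\<in>UNIV. \<Sum>c\<in>UNIV. J z b a * (p a c * (J z d c * J z e f * w' d e)))"
        unfolding sum_distrib_left sum_distrib_right by (simp add: mult_ac)
      also have "\<dots> = (\<Sum>d\<in>UNIV. \<Sum>e\<in>UNIV. \<Sum>a\<in>UNIV. \<Sum>c\<in>UNIV. J z b a * (p a c * (J z d c * J z e f * w' d e)))"
        by (rule sum.swap)
      also have "\<dots> = (\<Sum>d\<in>UNIV. \<Sum>a\<in>UNIV. \<Sum>e\<in>UNIV. \<Sum>c\<in>UNIV. J z b a * (p a c * (J z d c * J z e f * w' d e)))"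
        by (intro sum.cong refl sum.swap)
      also have "\<dots> = (\<Sum>a\<in>UNIV. \<Sum>d\<in>UNIV. \<Sum>e\<in>UNIV. \<Sum>c\<in>UNIV. J z b a * (p a c * (J z d c * J z e f * w' d e)))"
        by (rule sum.swap)
      also have "\<dots> = (\<Sum>a\<in>UNIV. \<Sum>d\<in>UNIV. \<Sum>c\<in>UNIV. \<Sum>e\<in>UNIV. J z b a * (p a c * (J z d c * J z e f * w' d e)))"
        by (intro sum.cong refl sum.swap)
      also have "\<dots> = (\<Sum>a\<in>UNIV. \<Sum>c\<in>UNIV. \<Sum>d\<in>UNIV. \<Sum>e\<in>UNIV. J z b a * (p a c * (J z d c * J z e f * w' d e)))"
        by (intro sum.cong refl sum.swap)
      also have "\<dots> = (\<Sum>a\<in>UNIV. J z b a * (\<Sum>c\<in>UNIV. p a c * w c f))"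
        unfolding w by (simp add: sum_distrib_left)
      also have "\<dots> = (\<Sum>a\<in>UNIV. J z b a * E a) * \<gamma> f - J z b f"
        unfolding p_w by (simp add: right_diff_distrib sum_subtractf sum_distrib_right mult.assoc)
      also have "\<dots> = (\<Sum>e\<in>UNIV. ((\<Sum>a\<in>UNIV. J z b a * E a) * \<gamma>' e - delta b e) * J z e f)"
        unfolding \<gamma> by (simp add: left_diff_distrib sum_subtractf sum_distrib_left mult.assoc)
      finally show "(\<Sum>e\<in>UNIV. (\<Sum>d\<in>UNIV. (\<Sum>a\<in>UNIV. \<Sum>c\<in>UNIV. J z b a * J z d c * p a c) * w' d e) * J z e f)
        = (\<Sum>e\<in>UNIV. ((\<Sum>a\<in>UNIV. J z b a * E a) * \<gamma>' e - delta b e) * J z e f)" .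
    qed
    show "(\<Sum>d\<in>UNIV. (\<Sum>a\<in>UNIV. \<Sum>c\<in>UNIV. J z b a * J z d c * p a c) * w' d e) =
        (\<Sum>a\<in>UNIV. J z b a * E a) * \<gamma>' e - delta b e" for b e
      using fun_cong[OF pw'] .
  qed
qed

lemma contact_domain_push:
  assumes "contact_domain Z g E p n" "contact_domain Z' g' E' p' n"
    and g: "\<And>z a. z \<in> Z \<Longrightarrow> g z a = (\<Sum>b\<in>UNIV. g' (\<phi> z) b * J z b a)"
    and y: "y \<in> Z"
  shows "om g y c a = (\<Sum>d\<in>UNIV. \<Sum>b\<in>UNIV. J y d c * J y b a * om g' (\<phi> y) d b)"
    and "E' (\<phi> y) = (\<lambda>b. \<Sum>a\<in>UNIV. J y b a * E y a)"
    and "p' (\<phi> y) = (\<lambda>b d. \<Sum>a\<in>UNIV. \<Sum>c\<in>UNIV. J y b a * J y d c * p y a c)"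
proof -
  interpret d: contact_domain Z g E p n by fact
  interpret d': contact_domain Z' g' E' p' n by fact
  show w: "om g y c a = (\<Sum>d\<in>UNIV. \<Sum>b\<in>UNIV. J y d c * J y b a * om g' (\<phi> y) d b)" for c a
    using y by (rule om_push) (auto intro: g d'.cdiff_g)
  show "E' (\<phi> y) = (\<lambda>b. \<Sum>a\<in>UNIV. J y b a * E y a)"
    "p' (\<phi> y) = (\<lambda>b d. \<Sum>a\<in>UNIV. \<Sum>c\<in>UNIV. J y b a * J y d c * p y a c)"
    using contact_point_unique[OF contact_point_push[OF y d.contact_point[OF y] g[OF y] w]
      d'.contact_point[OF maps[OF y]]]
      contact_point.w_anti[OF d'.contact_point[OF maps[OF y]]] by blast+
qed

text \<open>This fixes the factor \<open>n + 2\<close>. The divergence of \<open>lef p x\<close>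
  yields one \<open>lef p (con \<tau> x)\<close>. The second group yields \<open>n + 1\<close> of
  them from \<open>dvg x\<close> and one more from \<open>V\<close>, whose correction is \<tau>
  raised with \<open>p\<close>.\<close>

lemma split_op_push:
  assumes "contact_domain Z g E p n" "contact_domain Z' g' E' p' n"
    and g: "\<And>z a. z \<in> Z \<Longrightarrow> g z a = (\<Sum>b\<in>UNIV. g' (\<phi> z) b * J z b a)"
    and x: "\<And>z is. z \<in> Z \<Longrightarrow> cdiff (\<lambda>z. x z is) z" and t: "\<And>z. z \<in> Z \<Longrightarrow> tens q (x z)"
    and k: "\<And>z. z \<in> Z \<Longrightarrow> con (g z) (x z) = (\<lambda>is. 0)"
    and x': "\<And>w is. w \<in> Z' \<Longrightarrow> cdiff (\<lambda>w. x' w is) w"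
    and push: "\<And>z is. z \<in> Z \<Longrightarrow> x' (\<phi> z) is = push (J z) (x z) is"
    and z: "z \<in> Z"
  shows "split_op n (om g') E' p' x' (\<phi> z) is = push (J z) (split_op n (om g) E p x z) is"
proof -
  interpret d: contact_domain Z g E p n by fact
  interpret d': contact_domain Z' g' E' p' n by fact
  have w: "om g y c a = (\<Sum>d\<in>UNIV. \<Sum>b\<in>UNIV. J y d c * J y b a * om g' (\<phi> y) d b)"
    and uniq: "E' (\<phi> y) = (\<lambda>b. \<Sum>a\<in>UNIV. J y b a * E y a)"
      "p' (\<phi> y) = (\<lambda>b d. \<Sum>a\<in>UNIV. \<Sum>c\<in>UNIV. J y b a * J y d c * p y a c)"
    if "y \<in> Z" for y c a
    using contact_domain_push[OF assms(1,2) g that] by blast+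
  interpret contact_point "g z" "om g z" "E z" "p z" n by (rule d.contact_point[OF z])
  have xz: "x' (\<phi> y) = push (J y) (x y)" if "y \<in> Z" for y
    using push[OF that] by blast
  have lef': "lef (p' (\<phi> y)) (push (J y) u) is = push (J y) (lef (p y) u) is" if "y \<in> Z" for y u "is"
    by (simp add: push_lef uniq(2)[OF that])
  have dvgL: "dvg (\<lambda>w. lef (p' w) (x' w)) (\<phi> z) is =
      push (J z) (dvg (\<lambda>z. lef (p z) (x z)) z) is + push (J z) (con (\<tau> z) (lef (p z) (x z))) is" for "is"
  proof (rule dvg_push[OF z])
    show "alternating (lef (p z) (x z))"
      using tens_lef[OF t[OF z] p_anti] by (simp add: tens_def)
  qed (auto intro!: cdiff_lef d.cdiff_p d'.cdiff_p x x' simp: xz lef')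
  have dvgx: "dvg x' (\<phi> z) is = push (J z) (dvg x z) is + push (J z) (con (\<tau> z) (x z)) is" for "is"
    using t[OF z] by (intro dvg_push[OF z x _ x' push]) (auto simp: tens_def)
  define V where "V = vdiv p z"
  define e where "e = (\<lambda>b. \<Sum>a\<in>UNIV. \<tau> z a * p z a b)"
  have V': "vdiv p' (\<phi> z) = (\<lambda>b. \<Sum>a\<in>UNIV. J z b a * (V a + e a))"
  proof
    fix b
    \<comment> \<open>Read as a tensor of degree 2, the bivector has \<open>vdiv p\<close> as its
      divergence, so \<open>dvg_push\<close> applies to it as well.\<close>
    define P where "P = (\<lambda>z is. case is of [a, c] \<Rightarrow> p z a c | _ \<Rightarrow> 0)"
    define P' where "P' = (\<lambda>z is. case is of [a, c] \<Rightarrow> p' z a c | _ \<Rightarrow> 0)"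
    have "dvg P' (\<phi> z) [b] = push (J z) (dvg P z) [b] + push (J z) (con (\<tau> z) (P z)) [b]"
    proof (rule dvg_push[OF z])
      show "alternating (P z)"
      proof (rule alternatingI)
        fix xs a b ys
        show "P z (xs @ a # b # ys) = - P z (xs @ b # a # ys)"
          using p_anti[of a b] by (cases xs; cases ys; cases "tl xs") (auto simp: P_def split: list.splits)
      qed
      show "P' (\<phi> y) is = push (J y) (P y) is" if "y \<in> Z" for y "is"
      proof -
        have 0: "push J (\<lambda>is. 0) is = 0" for J and "is" :: "'m list" by (rule push_zero)
        show ?thesis
        proof (cases "\<exists>b d. is = [b, d]")
          case True
          then show ?thesis
            by (auto simp: P_def P'_def uniq(2)[OF that] sum_distrib_left mult.assoc)
        next
          case False
          have "tens 2 (P y)"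
            unfolding tens_def
          proof (intro conjI alternatingI allI impI)
            fix xs a b ys
            show "P y (xs @ a # b # ys) = - P y (xs @ b # a # ys)"
              using contact_point.p_anti[OF d.contact_point[OF that], of a b]
              by (cases xs; cases ys; cases "tl xs") (auto simp: P_def split: list.splits)
          qed (auto simp: P_def split: list.splits)
          then have "tens 2 (push (J y) (P y))" by (rule tens_push)
          moreover have "length is \<noteq> 2" using False by (auto simp: length_Suc_conv numeral_2_eq_2)
          ultimately show ?thesis by (auto simp: tens_def P'_def split: list.splits)
        qed
      qed
      show "cdiff (\<lambda>z. P z is) y" if "y \<in> Z" for y "is"
        using d.cdiff_p[OF that] by (cases "is"; cases "tl is"; cases "tl (tl is)") (auto simp: P_def)
      show "cdiff (\<lambda>z. P' z is) y" if "y \<in> Z'" for y "is"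
        using d'.cdiff_p[OF that] by (cases "is"; cases "tl is"; cases "tl (tl is)") (auto simp: P'_def)
    qed
    then show "vdiv p' (\<phi> z) b = (\<Sum>a\<in>UNIV. J z b a * (V a + e a))"
      by (simp add: dvg_def P_def P'_def con_def vdiv_def V_def e_def distrib_left sum.distrib)
  qed
  \<comment> \<open>Lowering the correction \<open>e\<close> of \<open>V\<close> returns \<tau> up
    to a multiple of \<open>g\<close>, and the contraction of \<open>x\<close> with \<open>g\<close>
    is zero.\<close>
  have con': "con (\<lambda>a. \<Sum>b\<in>UNIV. om g' (\<phi> z) a b * vdiv p' (\<phi> z) b) (push (J z) (x z)) is =
      push (J z) (\<lambda>is. con (\<lambda>a. \<Sum>b\<in>UNIV. om g z a b * V b) (x z) is + con (\<tau> z) (x z) is) is" for "is"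
  proof -
    have "(\<Sum>b\<in>UNIV. (\<Sum>d\<in>UNIV. om g' (\<phi> z) b d * vdiv p' (\<phi> z) d) * J z b a) =
        (\<Sum>c\<in>UNIV. om g z a c * (V c + e c))" for a
    proof -
      have "(\<Sum>b\<in>UNIV. (\<Sum>d\<in>UNIV. om g' (\<phi> z) b d * vdiv p' (\<phi> z) d) * J z b a) =
          (\<Sum>b\<in>UNIV. \<Sum>d\<in>UNIV. \<Sum>c\<in>UNIV. J z b a * J z d c * om g' (\<phi> z) b d * (V c + e c))"
        unfolding V' sum_distrib_left sum_distrib_right by (simp add: mult_ac)
      also have "\<dots> = (\<Sum>b\<in>UNIV. \<Sum>c\<in>UNIV. \<Sum>d\<in>UNIV. J z b a * J z d c * om g' (\<phi> z) b d * (V c + e c))"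
        by (intro sum.cong refl sum.swap)
      also have "\<dots> = (\<Sum>c\<in>UNIV. \<Sum>b\<in>UNIV. \<Sum>d\<in>UNIV. J z b a * J z d c * om g' (\<phi> z) b d * (V c + e c))"
        by (rule sum.swap)
      finally show ?thesis by (simp add: w[OF z] sum_distrib_right)
    qed
    also have "(\<Sum>c\<in>UNIV. om g z a c * (V c + e c)) = (\<Sum>b\<in>UNIV. om g z a b * V b) + (\<tau> z a - (\<Sum>c\<in>UNIV. \<tau> z c * E z c) * g z a)" for a
      using w_raise[of a "\<tau> z"] by (simp add: e_def distrib_left sum.distrib)
    finally have "con (\<lambda>a. \<Sum>b\<in>UNIV. om g' (\<phi> z) a b * vdiv p' (\<phi> z) b) (push (J z) (x z)) is = push (J z)
       (con (\<lambda>a. (\<Sum>b\<in>UNIV. om g z a b * V b) + (\<tau> z a - (\<Sum>c\<in>UNIV. \<tau> z c * E z c) * g z a)) (x z)) is"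
      by (simp add: con_push)
    moreover have "con (\<lambda>a. (\<Sum>b\<in>UNIV. om g z a b * V b) + (\<tau> z a - (\<Sum>c\<in>UNIV. \<tau> z c * E z c) * g z a)) (x z) =
       (\<lambda>is. con (\<lambda>a. \<Sum>b\<in>UNIV. om g z a b * V b) (x z) is + con (\<tau> z) (x z) is)"
      by (rule HOL.ext) (simp only: con_vadd con_vdiff con_vcmult k[OF z], simp)
    ultimately show ?thesis by simp
  qed
  have ext': "ext (vdiv p' (\<phi> z)) (push (J z) (x z)) is = push (J z) (\<lambda>is. ext V (x z) is + ext e (x z) is) is"
    "ext (E' (\<phi> z)) (push (J z) (x z)) is = push (J z) (ext (E z) (x z)) is" for "is"
    using push_ext[of "J z" "\<lambda>a. V a + e a" "x z" "is"]
    by (simp_all add: V' uniq(1)[OF z] push_ext ext_vadd[abs_def])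
  have inner: "(\<lambda>is. (of_nat n + 1) * dvg x' (\<phi> z) is
      + con (\<lambda>a. \<Sum>b\<in>UNIV. om g' (\<phi> z) a b * vdiv p' (\<phi> z) b) (x' (\<phi> z)) is) =
    push (J z) (\<lambda>is. (of_nat n + 1) * (dvg x z is + con (\<tau> z) (x z) is)
      + (con (\<lambda>a. \<Sum>b\<in>UNIV. om g z a b * V b) (x z) is + con (\<tau> z) (x z) is))"
    by (rule HOL.ext) (simp only: xz[OF z] con' dvgx push_add push_cmult)
  have L: "push (J z) (con (\<tau> z) (lef (p z) (x z))) is =
      push (J z) (lef (p z) (con (\<tau> z) (x z))) is + push (J z) (ext e (x z)) is" for "is"
    using push_add[of "J z" "lef (p z) (con (\<tau> z) (x z))" "ext e (x z)" "is"]
    by (simp add: con_lef[abs_def] e_def)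
  \<comment> \<open>The terms \<open>ext e\<close> coming from the two divergences have cancelled.
    What is left, \<open>lef p (con \<tau> x)\<close>, stands \<open>n + 2\<close> times on either
    side of the minus sign.\<close>
  have "split_op n (om g') E' p' x' (\<phi> z) is = push (J z) (\<lambda>is. (of_nat n + 2) *
     (dvg (\<lambda>z. lef (p z) (x z)) z is - ext V (x z) is + ext (E z) (x z) is + lef (p z) (con (\<tau> z) (x z)) is)
     - lef (p z) (\<lambda>is. (of_nat n + 1) * (dvg x z is + con (\<tau> z) (x z) is)
      + (con (\<lambda>a. \<Sum>b\<in>UNIV. om g z a b * V b) (x z) is + con (\<tau> z) (x z) is)) is) is"
    unfolding split_op_def inner lef'[OF z] dvgL unfolding xz[OF z] ext' L
    by (simp add: push_add push_diff push_cmult algebra_simps)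
  also have "\<dots> = push (J z) (split_op n (om g) E p x z) is"
    unfolding split_op_def[abs_def] V_def[symmetric]
    by (rule arg_cong[where f = "\<lambda>t. push (J z) t is"], rule HOL.ext)
       (simp add: lef_add lef_cmult algebra_simps)
  finally show ?thesis .
qed

end

section \<open>Reeb field and bivector of a contact form\<close>

text \<open>Vanishing contraction with \<open>v\<close>, demanded in every slot, so that
  antisymmetry of \<open>F\<close> need not be known.\<close>

definition killed :: "('m::finite \<Rightarrow> complex) \<Rightarrow> 'm form \<Rightarrow> bool" where
  "killed v F \<longleftrightarrow> (\<forall>is l. l < length is \<longrightarrow> (\<Sum>a\<in>UNIV. v a * F (is[l := a])) = 0)"

lemma killedD: "killed v F \<Longrightarrow> l < length is \<Longrightarrow> (\<Sum>a\<in>UNIV. v a * F (is[l := a])) = 0"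
  by (simp add: killed_def)

lemma killed_form_wedge:
  assumes F: "killed v F" and G: "killed v G"
  shows "killed v (form_wedge p q F G)"
  unfolding killed_def
proof (intro allI impI)
  fix "is" :: "'a list" and l assume l: "l < length is"
  show "(\<Sum>a\<in>UNIV. v a * form_wedge p q F G (is[l := a])) = 0"
  proof (cases "length is = p + q")
    case False
    then show ?thesis by (simp add: form_wedge_def)
  next
    case True
    let ?L = "\<lambda>is \<sigma>. map (\<lambda>i. is ! \<sigma> i) [0..<p]" and ?R = "\<lambda>is \<sigma>. map (\<lambda>i. is ! \<sigma> i) [p..<p + q]"
    have zero: "(\<Sum>a\<in>UNIV. v a * (F (?L (is[l := a]) \<sigma>) * G (?R (is[l := a]) \<sigma>))) = 0"
      if \<sigma>: "\<sigma> permutes {..<p + q}" for \<sigma>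
    proof -
      \<comment> \<open>The position at which \<sigma> reads slot \<open>l\<close>. The varying
        index therefore enters exactly one of the two factors.\<close>
      define i0 where "i0 = inv_into UNIV \<sigma> l"
      have \<sigma>i0: "\<sigma> i0 = l"
        unfolding i0_def by (rule permutes_inverses(1)[OF \<sigma>])
      moreover have "l \<in> {..<p + q}" using l True by simp
      ultimately have i0: "i0 < p + q"
        using permutes_in_image[OF \<sigma>, of i0] by simp
      have inj: "\<sigma> i = l \<longleftrightarrow> i = i0" for i
        using \<sigma>i0 inj_eq[OF permutes_inj[OF \<sigma>], of i i0] by simp
      have nth: "is[l := a] ! \<sigma> i = (if i = i0 then a else is ! \<sigma> i)" if "i < p + q" for a i
        using l inj[of i] by (cases "i = i0") (simp_all add: \<sigma>i0 nth_list_update)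
      show ?thesis
      proof (cases "i0 < p")
        case True
        have LR: "?L (is[l := a]) \<sigma> = (?L is \<sigma>)[i0 := a]" "?R (is[l := a]) \<sigma> = ?R is \<sigma>" for a
          by (intro nth_equalityI; simp add: nth nth_list_update[where xs = "map _ _"] True)
            (use True in \<open>intro map_cong refl, simp add: nth\<close>)
        have "(\<Sum>a\<in>UNIV. v a * (F (?L (is[l := a]) \<sigma>) * G (?R (is[l := a]) \<sigma>))) =
            (\<Sum>a\<in>UNIV. v a * F ((?L is \<sigma>)[i0 := a])) * G (?R is \<sigma>)"
          by (simp only: LR sum_distrib_right mult.assoc)
        then show ?thesis using killedD[OF F, of i0 "?L is \<sigma>"] True by simp
      next
        case False
        have LR: "?L (is[l := a]) \<sigma> = ?L is \<sigma>" "?R (is[l := a]) \<sigma> = (?R is \<sigma>)[i0 - p := a]" for a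
          by (intro map_cong refl, use False in \<open>simp add: nth\<close>)
            (intro nth_equalityI; use False i0 in \<open>auto simp: nth nth_list_update[where xs = "map _ _"]\<close>)
        have "(\<Sum>a\<in>UNIV. v a * (F (?L (is[l := a]) \<sigma>) * G (?R (is[l := a]) \<sigma>))) =
            F (?L is \<sigma>) * (\<Sum>a\<in>UNIV. v a * G ((?R is \<sigma>)[i0 - p := a]))"
          by (simp only: LR sum_distrib_left mult.left_commute)
        then show ?thesis using killedD[OF G, of "i0 - p" "?R is \<sigma>"] False i0 by simp
      qed
    qed
    have "(\<Sum>a\<in>UNIV. v a * form_wedge p q F G (is[l := a])) =
        (\<Sum>a\<in>UNIV. \<Sum>\<sigma> | \<sigma> permutes {..<p + q}. of_int (sign \<sigma>) *
          (v a * (F (?L (is[l := a]) \<sigma>) * G (?R (is[l := a]) \<sigma>)))) / (fact p * fact q)"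
      using True by (simp add: form_wedge_def sum_distrib_left sum_divide_distrib mult_ac)
    also have "\<dots> = (\<Sum>\<sigma> | \<sigma> permutes {..<p + q}. of_int (sign \<sigma>) *
          (\<Sum>a\<in>UNIV. v a * (F (?L (is[l := a]) \<sigma>) * G (?R (is[l := a]) \<sigma>)))) / (fact p * fact q)"
      unfolding sum_distrib_left by (subst sum.swap) simp
    also have "\<dots> = 0" using zero by simp
    finally show ?thesis .
  qed
qed

text \<open>Composition with the transposition of two positions with equal entries reverses the sign
  of a permutation but does not change the indices that are read, so the sum equals its
  negative.\<close>

lemma form_wedge_not_distinct:
  assumes "\<not> distinct is" shows "form_wedge p q F G is = 0"
proof (cases "length is = p + q")
  case False
  then show ?thesis by (simp add: form_wedge_def)
next
  case True
  from assms obtain j k where jk: "j < p + q" "k < p + q" "j \<noteq> k" "is ! j = is ! k"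
    using True by (auto simp: distinct_conv_nth)
  define \<tau> where "\<tau> = Transposition.transpose j k"
  have \<tau>: "\<tau> permutes {..<p + q}" unfolding \<tau>_def using jk by (intro permutes_swap_id) auto
  define f where "f = (\<lambda>\<sigma>. of_int (sign \<sigma>) * F (map (\<lambda>i. is ! \<sigma> i) [0..<p]) * G (map (\<lambda>i. is ! \<sigma> i) [p..<p + q]))"
  have nth: "is ! \<tau> i = is ! i" for i
    using jk(4) by (auto simp: \<tau>_def Transposition.transpose_def)
  have "(\<Sum>\<sigma> | \<sigma> permutes {..<p + q}. f \<sigma>) = (\<Sum>\<sigma> | \<sigma> permutes {..<p + q}. f (\<tau> \<circ> \<sigma>))"
  proof (rule sum.reindex_bij_witness[where i = "\<lambda>\<sigma>. \<tau> \<circ> \<sigma>" and j = "\<lambda>\<sigma>. \<tau> \<circ> \<sigma>"])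
    have "\<tau> \<circ> \<tau> = id" unfolding \<tau>_def by (simp add: fun_eq_iff)
    then show inv: "\<tau> \<circ> (\<tau> \<circ> \<sigma>) = \<sigma>" "\<tau> \<circ> (\<tau> \<circ> \<sigma>) = \<sigma>" for \<sigma> :: "nat \<Rightarrow> nat"
      unfolding o_assoc by simp_all
    show "f (\<tau> \<circ> (\<tau> \<circ> \<sigma>)) = f \<sigma>" for \<sigma> by (simp only: inv)
  qed (auto intro: permutes_compose \<tau>)
  also have "\<dots> = (\<Sum>\<sigma> | \<sigma> permutes {..<p + q}. - f \<sigma>)"
  proof (intro sum.cong refl)
    fix \<sigma> assume "\<sigma> \<in> {\<sigma>. \<sigma> permutes {..<p + q}}"
    then have "sign (\<tau> \<circ> \<sigma>) = - sign \<sigma>"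
      using \<tau> jk(3) permutes_imp_permutation[of "{..<p + q}"]
      by (subst sign_compose) (auto simp: \<tau>_def sign_swap_id)
    then show "f (\<tau> \<circ> \<sigma>) = - f \<sigma>" by (simp add: f_def nth)
  qed
  finally show ?thesis using True by (simp add: form_wedge_def f_def sum_negf)
qed

text \<open>Vary the index in the slot whose entry is a direction with nonzero component of
  \<open>v\<close>: every other value repeats an index, so the vanishing contraction consists of a
  single term.\<close>

lemma killed_top_form:
  fixes v :: "'m::finite \<Rightarrow> complex"
  assumes F: "killed v F" and dist: "\<And>is. \<not> distinct is \<Longrightarrow> F is = 0"
    and len: "\<And>is. length is \<noteq> CARD('m) \<Longrightarrow> F is = 0" and v: "v \<noteq> (\<lambda>_. 0)"
  shows "F is = 0"
proof (cases "distinct is \<and> length is = CARD('m)")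
  case True
  then have set: "set is = UNIV" using distinct_card[of "is"] by (intro card_eq_UNIV_imp_eq_UNIV) auto
  obtain a where a: "v a \<noteq> 0" using v by auto
  obtain l where l: "l < length is" "is ! l = a" using set by (metis in_set_conv_nth UNIV_I)
  have "F (is[l := b]) = 0" if "b \<noteq> a" for b
  proof (rule dist)
    obtain k where k: "k < length is" "is ! k = b" using set by (metis in_set_conv_nth UNIV_I)
    then have "k \<noteq> l" using that l by auto
    then have "is[l := b] ! k = is[l := b] ! l" using k l by simp
    with \<open>k \<noteq> l\<close> show "\<not> distinct (is[l := b])"
      using k(1) l(1) by (metis distinct_conv_nth length_list_update)
  qed
  then have "(\<Sum>b\<in>UNIV. v b * F (is[l := b])) = (\<Sum>b\<in>{a}. v b * F (is[l := b]))"
    by (intro sum.mono_neutral_right) auto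
  then show ?thesis using killedD[OF F l(1)] a list_update_id[of "is" l] l(2) by simp
next
  case False
  then show ?thesis using dist len by blast
qed

text \<open>A vector annihilated by both forms has zero contraction with all their wedge products,
  in particular with the volume form, which a nonzero vector cannot annihilate.\<close>

lemma nondegenerate:
  fixes v :: "'m::finite \<Rightarrow> complex" and w :: "'m \<Rightarrow> 'm \<Rightarrow> complex"
  assumes nz: "form_wedge (2 * n) 1 (two_form_power \<omega> n) \<eta> \<noteq> (\<lambda>_. 0)"
    and \<omega>: "\<And>is. \<omega> is = (case is of [a, b] \<Rightarrow> w a b | _ \<Rightarrow> 0)"
    and \<eta>: "\<And>is. \<eta> is = (case is of [a] \<Rightarrow> \<gamma> a | _ \<Rightarrow> 0)"
    and dim: "CARD('m) = 2 * n + 1" and anti: "\<And>a b. w a b = - w b a"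
    and v: "\<And>a. (\<Sum>b\<in>UNIV. w a b * v b) = 0" "(\<Sum>a\<in>UNIV. \<gamma> a * v a) = 0"
  shows "v = (\<lambda>_. 0)"
proof (rule ccontr)
  assume "v \<noteq> (\<lambda>_. 0)"
  have v': "(\<Sum>a\<in>UNIV. v a * w a b) = 0" for b
  proof -
    have "(\<Sum>a\<in>UNIV. v a * w a b) = (\<Sum>a\<in>UNIV. - (w b a * v a))"
      by (intro sum.cong refl) (subst anti, simp)
    then show ?thesis by (simp add: v sum_negf)
  qed
  have "killed v \<omega>"
    unfolding killed_def
  proof (intro allI impI)
    fix "is" :: "'m list" and l assume "l < length is"
    then show "(\<Sum>a\<in>UNIV. v a * \<omega> (is[l := a])) = 0"
      using v(1) v' by (cases "is"; cases "tl is"; cases "tl (tl is)"; cases l; cases "l - 1"; cases "l - 2")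
        (auto simp: \<omega> mult.commute split: nat.split)
  qed
  moreover have "killed v (\<lambda>is. if is = [] then 1 else 0)"
    by (auto simp: killed_def)
  ultimately have "killed v (two_form_power \<omega> k)" for k
    by (induction k) (auto intro: killed_form_wedge)
  moreover have "killed v \<eta>"
    unfolding killed_def
  proof (intro allI impI)
    fix "is" :: "'m list" and l assume "l < length is"
    then show "(\<Sum>a\<in>UNIV. v a * \<eta> (is[l := a])) = 0"
      using v(2) by (cases "is"; cases "tl is"; cases l; cases "l - 1") (auto simp: \<eta> mult.commute split: nat.split)
  qed
  ultimately have "killed v (form_wedge (2 * n) 1 (two_form_power \<omega> n) \<eta>)"
    by (intro killed_form_wedge)
  from killed_top_form[OF this _ _ \<open>v \<noteq> (\<lambda>_. 0)\<close>]
  have "form_wedge (2 * n) 1 (two_form_power \<omega> n) \<eta> is = 0" for "is"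
    by (simp add: form_wedge_not_distinct) (simp add: form_wedge_def dim)
  with nz show False by auto
qed

section \<open>Inverting the contact matrix\<close>

lemma cdiff_det:
  fixes A :: "complex ^ 'k::finite \<Rightarrow> complex ^ 'm::finite ^ 'm"
  assumes "\<And>i j. cdiff (\<lambda>z. A z $ i $ j) z"
  shows "cdiff (\<lambda>z. Determinants.det (A z)) z"
  unfolding Determinants.det_def by (intro cdiff_sum cdiff_mult cdiff_prod cdiff_const assms)

text \<open>The matrix is minus its transpose, so in odd size its determinant equals its own
  negative.\<close>

lemma antisymmetric_kernel:
  fixes w :: "'m::finite \<Rightarrow> 'm \<Rightarrow> complex"
  assumes odd: "odd CARD('m)" and anti: "\<And>a b. w a b = - w b a"
  obtains v where "v \<noteq> (\<lambda>_. 0)" "\<And>a. (\<Sum>b\<in>UNIV. w a b * v b) = 0"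
proof -
  define W where "W = (\<chi> a b. w a b)"
  have "Determinants.det W = Determinants.det (\<chi> i. - 1 *s Finite_Cartesian_Product.transpose W $ i)"
  proof -
    have "W = (\<chi> i. - 1 *s Finite_Cartesian_Product.transpose W $ i)"
      by (simp add: vec_eq_iff W_def Finite_Cartesian_Product.transpose_def) (metis anti)
    then show ?thesis by metis
  qed
  also have "\<dots> = (- 1) ^ CARD('m) * Determinants.det W"
    unfolding Determinants.det_rows_mul by simp
  finally have "Determinants.det W = 0" using odd by simp
  then have "\<not> invertible W" by (simp add: invertible_det_nz)
  then obtain x where x: "W *v x = 0" "x \<noteq> 0"
    unfolding invertible_left_inverse matrix_left_invertible_ker by blast
  show ?thesis
  proof (rule that[of "\<lambda>b. x $ b"])
    show "($) x \<noteq> (\<lambda>_. 0)" using x(2) by (auto simp: vec_eq_iff fun_eq_iff)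
    show "(\<Sum>b\<in>UNIV. w a b * x $ b) = 0" for a
      using arg_cong[OF x(1), of "\<lambda>y. y $ a"] by (simp add: matrix_vector_mult_def W_def)
  qed
qed

text \<open>d\<gamma> is degenerate in odd dimension. Adding the square of \<gamma> makes the form
  nondegenerate, so that the Reeb vector and the bivector can be extracted from one inverse
  matrix.\<close>

definition contact_matrix :: "('m::finite \<Rightarrow> complex) \<Rightarrow> ('m \<Rightarrow> 'm \<Rightarrow> complex) \<Rightarrow> complex ^ 'm ^ 'm" where
  "contact_matrix \<gamma> w = (\<chi> a b. w a b + \<gamma> a * \<gamma> b)"

text \<open>The inverse of the matrix by Cramer's rule, which makes it visibly holomorphic.\<close>

definition contact_inverse :: "('m::finite \<Rightarrow> complex) \<Rightarrow> ('m \<Rightarrow> 'm \<Rightarrow> complex) \<Rightarrow> 'm \<Rightarrow> 'm \<Rightarrow> complex" where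
  "contact_inverse \<gamma> w a b = Determinants.det (\<chi> i j. if j = a then axis b 1 $ i else contact_matrix \<gamma> w $ i $ j)
     / Determinants.det (contact_matrix \<gamma> w)"

text \<open>The matrix sends the Reeb vector to \<gamma>, since \<open>w\<close> kills that vector
  and \<gamma> takes the value 1 on it.\<close>

definition reeb :: "('m::finite \<Rightarrow> complex) \<Rightarrow> ('m \<Rightarrow> 'm \<Rightarrow> complex) \<Rightarrow> 'm \<Rightarrow> complex" where
  "reeb \<gamma> w a = (\<Sum>b\<in>UNIV. contact_inverse \<gamma> w a b * \<gamma> b)"

text \<open>The inverse matrix is the square of the Reeb vector plus the inverse of \<open>w\<close>
  on the kernel of \<gamma>; the latter is minus the bivector.\<close>

definition bivector :: "('m::finite \<Rightarrow> complex) \<Rightarrow> ('m \<Rightarrow> 'm \<Rightarrow> complex) \<Rightarrow> 'm \<Rightarrow> 'm \<Rightarrow> complex" where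
  "bivector \<gamma> w a b = reeb \<gamma> w a * reeb \<gamma> w b - contact_inverse \<gamma> w a b"

context
  fixes \<gamma> :: "'m::finite \<Rightarrow> complex" and w :: "'m \<Rightarrow> 'm \<Rightarrow> complex" and n :: nat
  assumes dim: "CARD('m) = 2 * n + 1" and anti: "w a b = - w b a"
    and nondeg: "(\<And>a. (\<Sum>b\<in>UNIV. w a b * v b) = 0) \<Longrightarrow> (\<Sum>a\<in>UNIV. \<gamma> a * v a) = 0 \<Longrightarrow> v = (\<lambda>_. 0)"
begin

lemma antisymmetric_self: "(\<Sum>a\<in>UNIV. v a * (\<Sum>b\<in>UNIV. w a b * v b)) = 0"
proof -
  have "(\<Sum>a\<in>UNIV. v a * (\<Sum>b\<in>UNIV. w a b * v b)) = (\<Sum>a\<in>UNIV. \<Sum>b\<in>UNIV. v a * v b * w a b)"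
    by (simp add: sum_distrib_left mult_ac)
  moreover have "(\<Sum>a\<in>UNIV. \<Sum>b\<in>UNIV. v a * v b * w a b) = - (\<Sum>a\<in>UNIV. \<Sum>b\<in>UNIV. v a * v b * w a b)"
    unfolding sum_negf[symmetric] by (subst sum.swap, intro sum.cong refl) (subst anti, simp)
  ultimately show ?thesis by simp
qed

text \<open>Pairing a null vector with its image removes the antisymmetric part and leaves the
  square of its value under \<gamma>. That value is therefore zero, and then \<open>w\<close>
  annihilates the vector too.\<close>

lemma det_contact_matrix: "Determinants.det (contact_matrix \<gamma> w) \<noteq> 0"
proof -
  have "x = 0" if x: "contact_matrix \<gamma> w *v x = 0" for x
  proof -
    have e: "(\<Sum>b\<in>UNIV. w a b * x $ b) + \<gamma> a * (\<Sum>b\<in>UNIV. \<gamma> b * x $ b) = 0" for a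
    proof -
      have "(contact_matrix \<gamma> w *v x) $ a = (\<Sum>b\<in>UNIV. w a b * x $ b) + \<gamma> a * (\<Sum>b\<in>UNIV. \<gamma> b * x $ b)"
        by (simp add: matrix_vector_mult_def contact_matrix_def distrib_right sum.distrib sum_distrib_left mult.assoc)
      then show ?thesis by (simp add: x)
    qed
    have "0 = (\<Sum>a\<in>UNIV. x $ a * ((\<Sum>b\<in>UNIV. w a b * x $ b) + \<gamma> a * (\<Sum>b\<in>UNIV. \<gamma> b * x $ b)))"
      by (simp add: e)
    also have "\<dots> = (\<Sum>a\<in>UNIV. \<gamma> a * x $ a) * (\<Sum>b\<in>UNIV. \<gamma> b * x $ b)"
      using antisymmetric_self[of "\<lambda>a. x $ a"]
      by (simp add: distrib_left sum.distrib sum_distrib_right[of _ _ "\<Sum>b\<in>UNIV. \<gamma> b * x $ b"] mult_ac)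
    finally have g: "(\<Sum>b\<in>UNIV. \<gamma> b * x $ b) = 0" by simp
    then have "(\<lambda>a. x $ a) = (\<lambda>_. 0)" using e by (intro nondeg) auto
    then show ?thesis by (simp add: vec_eq_iff fun_eq_iff)
  qed
  then show ?thesis
    unfolding invertible_det_nz[symmetric] invertible_left_inverse matrix_left_invertible_ker by blast
qed

lemma contact_matrix_inverse:
  "(\<Sum>b\<in>UNIV. (w a b + \<gamma> a * \<gamma> b) * contact_inverse \<gamma> w b c) = delta a c"
  "(\<Sum>b\<in>UNIV. contact_inverse \<gamma> w a b * (w b c + \<gamma> b * \<gamma> c)) = delta a c"
proof -
  let ?B = "contact_matrix \<gamma> w" and ?C = "\<chi> a b. contact_inverse \<gamma> w a b"
  have "?B *v (\<chi> k. contact_inverse \<gamma> w k c) = axis c 1" for c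
    unfolding Determinants.cramer[OF det_contact_matrix] contact_inverse_def ..
  then have r: "(\<Sum>b\<in>UNIV. (w a b + \<gamma> a * \<gamma> b) * contact_inverse \<gamma> w b c) = delta a c" for a c
    by (simp add: vec_eq_iff matrix_vector_mult_def contact_matrix_def axis_def delta_def)
  then show "(\<Sum>b\<in>UNIV. (w a b + \<gamma> a * \<gamma> b) * contact_inverse \<gamma> w b c) = delta a c" .
  have "?B ** ?C = Finite_Cartesian_Product.mat 1"
    using r by (simp add: vec_eq_iff matrix_matrix_mult_def contact_matrix_def Finite_Cartesian_Product.mat_def delta_def)
  then have "?C ** ?B = Finite_Cartesian_Product.mat 1"
    by (simp add: matrix_left_right_inverse)
  then show "(\<Sum>b\<in>UNIV. contact_inverse \<gamma> w a b * (w b c + \<gamma> b * \<gamma> c)) = delta a c"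
    by (simp add: vec_eq_iff matrix_matrix_mult_def contact_matrix_def Finite_Cartesian_Product.mat_def delta_def)
qed

lemma contact_matrix_inj:
  assumes "\<And>c. (\<Sum>b\<in>UNIV. f b * (w b c + \<gamma> b * \<gamma> c)) = (\<Sum>b\<in>UNIV. f' b * (w b c + \<gamma> b * \<gamma> c))"
  shows "f a = f' a"
proof -
  have *: "(\<Sum>c\<in>UNIV. (\<Sum>b\<in>UNIV. f b * (w b c + \<gamma> b * \<gamma> c)) * contact_inverse \<gamma> w c a) = f a" for f
  proof -
    have "(\<Sum>c\<in>UNIV. (\<Sum>b\<in>UNIV. f b * (w b c + \<gamma> b * \<gamma> c)) * contact_inverse \<gamma> w c a) =
        (\<Sum>b\<in>UNIV. f b * (\<Sum>c\<in>UNIV. (w b c + \<gamma> b * \<gamma> c) * contact_inverse \<gamma> w c a))"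
      unfolding sum_distrib_left sum_distrib_right by (subst sum.swap) (simp add: mult.assoc)
    then show ?thesis by (simp add: contact_matrix_inverse)
  qed
  show ?thesis using *[of f] *[of f'] assms by simp
qed

text \<open>A nonzero kernel vector of \<open>w\<close> exists by odd dimension, and \<gamma> is
  nonzero on it by nondegeneracy. After normalization the matrix maps it to \<gamma>, so it is the
  vector that the inverse matrix assigns to \<gamma>.\<close>

lemma reeb_spec:
  shows "(\<Sum>b\<in>UNIV. w a b * reeb \<gamma> w b) = 0" and "(\<Sum>a\<in>UNIV. \<gamma> a * reeb \<gamma> w a) = 1"
proof -
  have "odd CARD('m)" using dim by simp
  then obtain v where v: "v \<noteq> (\<lambda>_. 0)" "\<And>a. (\<Sum>b\<in>UNIV. w a b * v b) = 0"
    using antisymmetric_kernel[of w] anti by blast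
  define k where "k = (\<Sum>a\<in>UNIV. \<gamma> a * v a)"
  have k: "k \<noteq> 0" unfolding k_def using nondeg[of v] v by blast
  have "reeb \<gamma> w = (\<lambda>a. v a / k)"
  proof
    fix a
    have "\<gamma> b = (\<Sum>c\<in>UNIV. (w b c + \<gamma> b * \<gamma> c) * (v c / k))" for b
    proof -
      have "(\<Sum>c\<in>UNIV. (w b c + \<gamma> b * \<gamma> c) * (v c / k)) = ((\<Sum>c\<in>UNIV. w b c * v c) + \<gamma> b * k) / k"
        unfolding k_def sum_distrib_left sum.distrib[symmetric] sum_divide_distrib
        by (intro sum.cong refl) (simp add: algebra_simps)
      then show ?thesis using k v by simp
    qed
    then have "reeb \<gamma> w a = (\<Sum>b\<in>UNIV. contact_inverse \<gamma> w a b * (\<Sum>c\<in>UNIV. (w b c + \<gamma> b * \<gamma> c) * (v c / k)))"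
      by (simp add: reeb_def)
    also have "\<dots> = (\<Sum>c\<in>UNIV. (\<Sum>b\<in>UNIV. contact_inverse \<gamma> w a b * (w b c + \<gamma> b * \<gamma> c)) * (v c / k))"
      unfolding sum_distrib_left sum_distrib_right by (subst sum.swap) (simp add: mult.assoc)
    finally show "reeb \<gamma> w a = v a / k" by (simp only: contact_matrix_inverse sum_delta)
  qed
  then show "(\<Sum>b\<in>UNIV. w a b * reeb \<gamma> w b) = 0" "(\<Sum>a\<in>UNIV. \<gamma> a * reeb \<gamma> w a) = 1"
    using v k by (simp_all add: k_def flip: sum_divide_distrib)
qed

lemma contact_point_reeb: "contact_point \<gamma> w (reeb \<gamma> w) (bivector \<gamma> w) n"
proof -
  let ?E = "reeb \<gamma> w" and ?C = "contact_inverse \<gamma> w" and ?p = "bivector \<gamma> w"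
  have Ew: "(\<Sum>b\<in>UNIV. ?E b * w b c) = 0" for c
  proof -
    have "(\<Sum>b\<in>UNIV. ?E b * w b c) = (\<Sum>b\<in>UNIV. - (w c b * ?E b))"
      by (intro sum.cong refl) (subst anti, simp)
    then show ?thesis by (simp add: sum_negf reeb_spec)
  qed
  have pw: "(\<Sum>b\<in>UNIV. ?p a b * w b c) = ?E a * \<gamma> c - delta a c" for a c
  proof -
    have "(\<Sum>b\<in>UNIV. ?p a b * w b c) = ?E a * (\<Sum>b\<in>UNIV. ?E b * w b c)
        - ((\<Sum>b\<in>UNIV. ?C a b * (w b c + \<gamma> b * \<gamma> c)) - (\<Sum>b\<in>UNIV. ?C a b * \<gamma> b) * \<gamma> c)"
      unfolding sum_distrib_left sum_distrib_right sum_subtractf[symmetric]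
      by (intro sum.cong refl) (simp add: bivector_def algebra_simps)
    then show ?thesis by (simp add: Ew contact_matrix_inverse) (simp add: reeb_def)
  qed
  \<comment> \<open>The matrix is not symmetric, so multiplying the inverse by \<gamma> from the
    left needs its own argument: both sides become \<gamma> when multiplied by the matrix.\<close>
  have F: "(\<Sum>a\<in>UNIV. \<gamma> a * ?C a b) = ?E b" for b
  proof (rule contact_matrix_inj)
    fix c
    have "(\<Sum>b\<in>UNIV. (\<Sum>a\<in>UNIV. \<gamma> a * ?C a b) * (w b c + \<gamma> b * \<gamma> c)) =
        (\<Sum>a\<in>UNIV. \<gamma> a * (\<Sum>b\<in>UNIV. ?C a b * (w b c + \<gamma> b * \<gamma> c)))"
      unfolding sum_distrib_left sum_distrib_right by (subst sum.swap) (simp add: mult.assoc)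
    also have "\<dots> = (\<Sum>b\<in>UNIV. ?E b * w b c) + (\<Sum>b\<in>UNIV. \<gamma> b * ?E b) * \<gamma> c"
      by (simp add: contact_matrix_inverse Ew reeb_spec)
    also have "\<dots> = (\<Sum>b\<in>UNIV. ?E b * (w b c + \<gamma> b * \<gamma> c))"
      unfolding sum_distrib_right sum.distrib[symmetric] by (simp add: algebra_simps)
    finally show "(\<Sum>b\<in>UNIV. (\<Sum>a\<in>UNIV. \<gamma> a * ?C a b) * (w b c + \<gamma> b * \<gamma> c)) = (\<Sum>b\<in>UNIV. ?E b * (w b c + \<gamma> b * \<gamma> c))" .
  qed
  have \<gamma>p: "(\<Sum>a\<in>UNIV. \<gamma> a * ?p a b) = 0" for b
  proof -
    have "(\<Sum>a\<in>UNIV. \<gamma> a * ?p a b) = (\<Sum>a\<in>UNIV. \<gamma> a * ?E a) * ?E b - (\<Sum>a\<in>UNIV. \<gamma> a * ?C a b)"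
      unfolding sum_distrib_right sum_subtractf[symmetric]
      by (intro sum.cong refl) (simp add: bivector_def algebra_simps)
    then show ?thesis by (simp add: F reeb_spec)
  qed
  have p\<gamma>: "(\<Sum>b\<in>UNIV. ?p a b * \<gamma> b) = 0" for a
  proof -
    have "(\<Sum>b\<in>UNIV. ?p a b * \<gamma> b) = ?E a * (\<Sum>b\<in>UNIV. \<gamma> b * ?E b) - (\<Sum>b\<in>UNIV. ?C a b * \<gamma> b)"
      unfolding sum_distrib_left sum_subtractf[symmetric]
      by (intro sum.cong refl) (simp add: bivector_def algebra_simps)
    then show ?thesis by (simp add: reeb_spec) (simp add: reeb_def)
  qed
  have wp: "(\<Sum>a\<in>UNIV. w c a * ?p a b) = \<gamma> c * ?E b - delta c b" for b c
  proof -
    have "(\<Sum>a\<in>UNIV. w c a * ?p a b) = (\<Sum>a\<in>UNIV. w c a * ?E a) * ?E b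
        - ((\<Sum>a\<in>UNIV. (w c a + \<gamma> c * \<gamma> a) * ?C a b) - \<gamma> c * (\<Sum>a\<in>UNIV. \<gamma> a * ?C a b))"
      unfolding sum_distrib_left sum_distrib_right sum_subtractf[symmetric]
      by (intro sum.cong refl) (simp add: bivector_def algebra_simps)
    then show ?thesis by (simp add: reeb_spec contact_matrix_inverse F)
  qed
  \<comment> \<open>Antisymmetry is invisible in Cramer's formula. It follows from comparing the
    left and right products with \<open>w\<close> and \<gamma>, since multiplication by the matrix
    is injective.\<close>
  have panti: "?p a b = - ?p b a" for a b
  proof (rule contact_matrix_inj[of "\<lambda>b. ?p a b" "\<lambda>b. - ?p b a" b])
    fix c
    have "(\<Sum>b\<in>UNIV. ?p a b * (w b c + \<gamma> b * \<gamma> c)) = (\<Sum>b\<in>UNIV. ?p a b * w b c) + (\<Sum>b\<in>UNIV. ?p a b * \<gamma> b) * \<gamma> c"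
      unfolding sum_distrib_right sum.distrib[symmetric] by (simp add: algebra_simps)
    moreover have "(\<Sum>b\<in>UNIV. - ?p b a * (w b c + \<gamma> b * \<gamma> c)) = (\<Sum>b\<in>UNIV. w c b * ?p b a) - (\<Sum>b\<in>UNIV. \<gamma> b * ?p b a) * \<gamma> c"
      unfolding sum_distrib_right sum_subtractf[symmetric]
      by (intro sum.cong refl) (subst (2) anti, simp add: algebra_simps)
    ultimately show "(\<Sum>b\<in>UNIV. ?p a b * (w b c + \<gamma> b * \<gamma> c)) = (\<Sum>b\<in>UNIV. - ?p b a * (w b c + \<gamma> b * \<gamma> c))"
      by (simp only: pw wp p\<gamma> \<gamma>p) (simp add: delta_def)
  qed
  show ?thesis
    by unfold_locales (fact dim anti panti reeb_spec \<gamma>p pw)+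
qed

end

lemma contact_domain_reeb:
  fixes g :: "complex ^ 'm::finite \<Rightarrow> 'm \<Rightarrow> complex"
  assumes Z: "open Z" and g: "\<And>z a. z \<in> Z \<Longrightarrow> cdiff (\<lambda>z. g z a) z" and dim: "CARD('m) = 2 * n + 1"
    and nondeg: "\<And>z v. z \<in> Z \<Longrightarrow> (\<And>a. (\<Sum>b\<in>UNIV. om g z a b * v b) = 0) \<Longrightarrow>
      (\<Sum>a\<in>UNIV. g z a * v a) = 0 \<Longrightarrow> v = (\<lambda>_. 0)"
  shows "contact_domain Z g (\<lambda>z. reeb (g z) (om g z)) (\<lambda>z. bivector (g z) (om g z)) n"
proof -
  have anti: "om g z a b = - om g z b a" for z a b by (simp add: om_def)
  have om: "cdiff (\<lambda>z. om g z a b) z" if "z \<in> Z" for z a b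
    unfolding om_def using Z g that by (intro cdiff_diff cdiff_pd) auto
  have m: "cdiff (\<lambda>z. contact_matrix (g z) (om g z) $ i $ j) z" if "z \<in> Z" for z i j
    unfolding contact_matrix_def using g[OF that] om[OF that] by (auto intro!: cdiff_add cdiff_mult)
  have C: "cdiff (\<lambda>z. contact_inverse (g z) (om g z) a b) z" if z: "z \<in> Z" for z a b
    unfolding contact_inverse_def
  proof (intro cdiff_divide cdiff_det)
    show "Determinants.det (contact_matrix (g z) (om g z)) \<noteq> 0"
      using det_contact_matrix[OF dim anti nondeg[OF z]] .
    show "cdiff (\<lambda>z. (\<chi> i j. if j = a then axis b 1 $ i else contact_matrix (g z) (om g z) $ i $ j) $ i $ j) z" for i j
      using m[OF z] by (cases "j = a") simp_all
  qed (rule m[OF z])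
  have E: "cdiff (\<lambda>z. reeb (g z) (om g z) a) z" if "z \<in> Z" for z a
    unfolding reeb_def using that by (intro cdiff_sum cdiff_mult C g)
  show ?thesis
  proof (rule contact_domain.intro)
    show "cdiff (\<lambda>z. bivector (g z) (om g z) a b) z" if "z \<in> Z" for z a b
      unfolding bivector_def using that by (intro cdiff_diff cdiff_mult E C)
    show "contact_point (g z) (om g z) (reeb (g z) (om g z)) (bivector (g z) (om g z)) n" if "z \<in> Z" for z
      using contact_point_reeb[OF dim anti nondeg[OF that]] .
  qed (fact Z g E)+
qed

section \<open>Exterior powers of the tangent space\<close>

lemma ext_eq_sum: "ext v t is = (\<Sum>j<length is. (-1) ^ j * v (is ! j) * t (remove_nth j is))"
proof (induction "is" arbitrary: t)
  case (Cons a "is")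
  have "ext v t (a # is) = v a * t is - (\<Sum>j<length is. (-1) ^ j * v (is ! j) * t (a # remove_nth j is))"
    by (simp add: Cons.IH)
  also have "\<dots> = (\<Sum>j<Suc (length is). (-1) ^ j * v ((a # is) ! j) * t (remove_nth j (a # is)))"
    by (subst sum.lessThan_Suc_shift) (simp add: remove_nth_def sum_negf)
  finally show ?case by simp
qed simp

fun lwedge :: "('m \<Rightarrow> complex) list \<Rightarrow> 'm tensor" where
  "lwedge [] = (\<lambda>is. if is = [] then 1 else 0)"
| "lwedge (v # vs) = ext v (lwedge vs)"

lemma tens_lwedge: "tens (length vs) (lwedge vs)"
  by (induction vs) (auto simp: tens_def[of 0] alternating_def intro: tens_ext)

lemma push_lwedge: "push J (lwedge vs) = lwedge (map (\<lambda>v b. \<Sum>a\<in>UNIV. J b a * v a) vs)"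
proof (induction vs)
  case Nil
  have "push J (lwedge []) is = lwedge [] is" for "is"
    using tens_push[OF tens_lwedge[of "[] :: ('a \<Rightarrow> complex) list"], of J] by (cases "is") (simp_all add: tens_def push_zero)
  then show ?case by auto
next
  case (Cons v vs)
  show ?case by (rule HOL.ext) (simp add: push_ext Cons.IH)
qed

text \<open>Laplace expansion along the first column, which belongs to the first vector, is the
  recursion of \<open>lwedge\<close>.\<close>

lemma wedge_eq_lwedge:
  assumes c: "c \<in> charts_at \<A> p"
  shows "(\<lambda>is. wedge \<A> p vs (c, is)) = lwedge (map (\<lambda>v a. v c $ a) vs)"
proof (induction vs)
  case Nil
  show ?case using c by (auto simp: wedge_def fun_eq_iff)
next
  case (Cons v vs)
  show ?case
  proof
    fix "is"
    show "wedge \<A> p (v # vs) (c, is) = lwedge (map (\<lambda>v a. v c $ a) (v # vs)) is"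
    proof (cases "length is = Suc (length vs)")
      case False
      then show ?thesis using tens_lwedge[of "map (\<lambda>v a. v c $ a) (v # vs)"] by (simp add: wedge_def tens_def)
    next
      case True
      define k where "k = Suc (length vs)"
      define A where "A = Matrix.mat k k (\<lambda>(i, j). ((v # vs) ! j) c $ (is ! i))"
      have del: "Determinant.det (mat_delete A i 0) = wedge \<A> p vs (c, remove_nth i is)" if i: "i < k" for i
      proof -
        have "mat_delete A i 0 = Matrix.mat (length vs) (length vs) (\<lambda>(l, j). (vs ! j) c $ (remove_nth i is ! l))"
          using i True by (intro eq_matI) (auto simp: mat_delete_def A_def k_def nth_remove_nth)
        then show ?thesis
          using c i True by (simp add: wedge_def length_remove_nth k_def)
      qed
      have "wedge \<A> p (v # vs) (c, is) = Determinant.det A"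
        using c True by (simp add: wedge_def A_def k_def)
      also have "\<dots> = (\<Sum>i<k. A $$ (i, 0) * cofactor A i 0)"
        by (rule laplace_expansion_column) (auto simp: A_def k_def)
      also have "\<dots> = (\<Sum>i<k. (-1) ^ i * v c $ (is ! i) * wedge \<A> p vs (c, remove_nth i is))"
        using del by (intro sum.cong) (auto simp: cofactor_def A_def k_def)
      also have "\<dots> = ext (\<lambda>a. v c $ a) (\<lambda>is. wedge \<A> p vs (c, is)) is"
        using True by (simp add: ext_eq_sum k_def)
      finally show ?thesis by (simp add: Cons.IH)
    qed
  qed
qed

text \<open>Up to the factor \<open>k\<close>, \<open>t\<close> is the sum of the wedge products of
  basis vectors with its contractions. Projecting the basis vectors to the kernel of \<gamma> along
  \<open>E\<close> changes this sum only by \<open>ext E (con \<gamma> t)\<close>, which is zero.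
  The condition on \<open>E\<close> holds both for a Reeb vector and for \<gamma> equal to 0, so one
  statement serves the kernel and the whole tangent space.\<close>

lemma span_lwedge:
  fixes t :: "'m::finite tensor"
  assumes "tens k t" "con \<gamma> t = (\<lambda>is. 0)" and E: "\<And>a. \<gamma> a * (\<Sum>b\<in>UNIV. \<gamma> b * E b) = \<gamma> a"
  shows "t \<in> cfun.span {lwedge vs |vs. length vs = k \<and> (\<forall>v\<in>set vs. (\<Sum>a\<in>UNIV. \<gamma> a * v a) = 0)}"
    (is "t \<in> cfun.span (?S k)")
  using assms(1,2)
proof (induction k arbitrary: t)
  case 0
  have "cscale (t []) (lwedge []) = t"
    using 0 by (auto simp: cscale_def tens_def fun_eq_iff)
  moreover have "cscale (t []) (lwedge []) \<in> cfun.span (?S 0)"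
    by (intro cfun.span_scale cfun.span_base CollectI exI[of _ "[]"]) simp
  ultimately show ?case by (simp only:)
next
  case (Suc k)
  have ext_span: "ext v u \<in> cfun.span (?S (Suc k))"
    if u: "u \<in> cfun.span (?S k)" and v: "(\<Sum>a\<in>UNIV. \<gamma> a * v a) = 0" for u v
  proof -
    have "cfun.span (?S k) \<subseteq> {u. ext v u \<in> cfun.span (?S (Suc k))}"
    proof (rule cfun.span_minimal)
      show "?S k \<subseteq> {u. ext v u \<in> cfun.span (?S (Suc k))}"
      proof
        fix u assume "u \<in> ?S k"
        then obtain vs where vs: "u = lwedge vs" "length vs = k" "\<forall>v\<in>set vs. (\<Sum>a\<in>UNIV. \<gamma> a * v a) = 0" by blast
        have "ext v u \<in> ?S (Suc k)" using vs v by (intro CollectI exI[of _ "v # vs"]) simp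
        then show "u \<in> {u. ext v u \<in> cfun.span (?S (Suc k))}" by (simp add: cfun.span_base)
      qed
      show "cfun.subspace {u. ext v u \<in> cfun.span (?S (Suc k))}"
      proof (rule cfun.subspaceI)
        have "ext v 0 = 0" by (rule HOL.ext) (simp add: zero_fun_def ext_zero)
        then show "0 \<in> {u. ext v u \<in> cfun.span (?S (Suc k))}" using cfun.span_zero by simp
        show "x + y \<in> {u. ext v u \<in> cfun.span (?S (Suc k))}"
          if "x \<in> {u. ext v u \<in> cfun.span (?S (Suc k))}" "y \<in> {u. ext v u \<in> cfun.span (?S (Suc k))}" for x y
        proof -
          have "ext v (x + y) = ext v x + ext v y" by (rule HOL.ext) (simp add: plus_fun_def ext_add)
          then show ?thesis using that cfun.span_add by simp
        qed
        show "cscale c x \<in> {u. ext v u \<in> cfun.span (?S (Suc k))}"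
          if "x \<in> {u. ext v u \<in> cfun.span (?S (Suc k))}" for c x
        proof -
          have "ext v (cscale c x) = cscale c (ext v x)" by (rule HOL.ext) (simp add: cscale_def ext_cmult)
          then show ?thesis using that cfun.span_scale by simp
        qed
      qed
    qed
    then show ?thesis using u by blast
  qed
  define v where "v = (\<lambda>a b. delta a b - \<gamma> a * E b)"
  have v: "(\<Sum>b\<in>UNIV. \<gamma> b * v a b) = 0" for a
  proof -
    have "(\<Sum>b\<in>UNIV. \<gamma> b * v a b) = \<gamma> a - \<gamma> a * (\<Sum>b\<in>UNIV. \<gamma> b * E b)"
      by (simp add: v_def right_diff_distrib sum_subtractf sum_distrib_left mult_ac)
    then show ?thesis by (simp add: E)
  qed
  have sl: "slot a t \<in> cfun.span (?S k)" for a
  proof (rule Suc.IH)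
    show "tens k (slot a t)" using Suc.prems(1) by (rule tens_slot)
    show "con \<gamma> (slot a t) = (\<lambda>is. 0)"
      by (rule HOL.ext) (simp add: con_anticommute[OF Suc.prems(1)] Suc.prems(2))
  qed
  have "(\<Sum>a\<in>UNIV. ext (v a) (slot a t)) = (\<lambda>is. of_nat (Suc k) * t is)"
  proof
    fix "is"
    have sum_apply: "(\<Sum>a\<in>A. f a) is = (\<Sum>a\<in>A. f a is)" for f :: "'m \<Rightarrow> 'm tensor" and A
      by (induction A rule: infinite_finite_induct) simp_all
    have "(\<Sum>a\<in>UNIV. ext (v a) (slot a t)) is = (\<Sum>a\<in>UNIV. ext (delta a) (slot a t) is) - ext E (con \<gamma> t) is"
      by (simp add: sum_apply v_def ext_vdiff ext_vcmult sum_subtractf con_slot ext_sum ext_cmult)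
    then show "(\<Sum>a\<in>UNIV. ext (v a) (slot a t)) is = of_nat (Suc k) * t is"
      using ext_number[OF Suc.prems(1)] by (simp add: Suc.prems(2) ext_zero)
  qed
  moreover have "cscale (1 / of_nat (Suc k)) (\<Sum>a\<in>UNIV. ext (v a) (slot a t)) \<in> cfun.span (?S (Suc k))"
    by (intro cfun.span_scale cfun.span_sum ext_span sl v)
  ultimately have "cscale (1 / of_nat (Suc k)) (\<lambda>is. of_nat (Suc k) * t is) \<in> cfun.span (?S (Suc k))"
    by (simp only:)
  moreover have "cscale (1 / of_nat (Suc k)) (\<lambda>is. of_nat (Suc k) * t is) = t"
    by (simp add: cscale_def fun_eq_iff del: of_nat_Suc)
  ultimately show ?case by (simp only:)
qed

section \<open>Charts and the tensors at a point\<close>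

locale complex_mfd =
  fixes M :: "'a topology" and \<A> :: "('a, 'm::finite) chart set"
  assumes mfd: "complex_manifold M \<A>"
begin

definition dom :: "('a, 'm) chart \<Rightarrow> 'a set \<Rightarrow> (complex ^ 'm) set" where
  "dom c W = snd c ` (W \<inter> fst c)"

lemma chart_open: "c \<in> \<A> \<Longrightarrow> openin M (fst c)"
  and chart_cover: "(\<Union>c\<in>\<A>. fst c) = topspace M"
  and chart_homeo: "c \<in> \<A> \<Longrightarrow> homeomorphic_map (subtopology M (fst c)) (top_of_set (snd c ` fst c)) (snd c)"
  and chart_image_open: "c \<in> \<A> \<Longrightarrow> open (snd c ` fst c)"
  using mfd unfolding complex_manifold_def by blast+

lemma chart_inj:
  assumes "c \<in> \<A>" shows "inj_on (snd c) (fst c)"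
  using homeomorphic_imp_injective_map[OF chart_homeo[OF assms]] openin_subset[OF chart_open[OF assms]]
  by (simp add: Int_absorb1)

lemma chart_inv_chart: "c \<in> \<A> \<Longrightarrow> p \<in> fst c \<Longrightarrow> chart_inv c (snd c p) = p"
  unfolding chart_inv_def by (rule inv_into_f_f[OF chart_inj])

lemma chart_chart_inv: "z \<in> snd c ` fst c \<Longrightarrow> snd c (chart_inv c z) = z"
  unfolding chart_inv_def by (rule f_inv_into_f)

lemma chart_inv_in: "z \<in> snd c ` fst c \<Longrightarrow> chart_inv c z \<in> fst c"
  unfolding chart_inv_def by (rule inv_into_into)

lemma in_dom: "c \<in> \<A> \<Longrightarrow> z \<in> dom c W \<longleftrightarrow> z \<in> snd c ` fst c \<and> chart_inv c z \<in> W"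
  unfolding dom_def using chart_chart_inv[of z c, symmetric] chart_inv_in[of z c]
  by (auto simp: chart_inv_chart)

lemma chart_in_dom: "p \<in> W \<Longrightarrow> p \<in> fst c \<Longrightarrow> snd c p \<in> dom c W"
  by (simp add: dom_def)

lemma open_dom:
  assumes c: "c \<in> \<A>" and W: "openin M W" shows "open (dom c W)"
proof -
  have "openin (subtopology M (fst c)) (W \<inter> fst c)"
    using W by (auto simp: openin_subtopology)
  then have "openin (top_of_set (snd c ` fst c)) (snd c ` (W \<inter> fst c))"
    using homeomorphic_imp_open_map[OF chart_homeo[OF c]] unfolding open_map_def by blast
  then show ?thesis using chart_image_open[OF c] unfolding dom_def by (rule openin_open_trans)
qed

lemma dom_mono: "V \<subseteq> W \<Longrightarrow> dom c V \<subseteq> dom c W"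
  by (auto simp: dom_def)

definition jac :: "('a, 'm) chart \<Rightarrow> ('a, 'm) chart \<Rightarrow> complex ^ 'm \<Rightarrow> 'm \<Rightarrow> 'm \<Rightarrow> complex" where
  "jac c d z b a = pd a (\<lambda>z. transition c d z $ b) z"

lemma cdiff_transition:
  assumes "c \<in> \<A>" "d \<in> \<A>" "z \<in> dom c (fst d)" shows "cdiff (\<lambda>z. transition c d z $ b) z"
proof -
  have "holo_on (\<lambda>z. transition c d z $ b) (snd c ` (fst c \<inter> fst d))"
    using mfd assms(1,2) unfolding complex_manifold_def by blast
  then show ?thesis using assms(3) unfolding holo_on_iff_cdiff dom_def by (auto simp: Int_commute)
qed

lemma transition_chart: "c \<in> \<A> \<Longrightarrow> p \<in> fst c \<Longrightarrow> transition c d (snd c p) = snd d p"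
  by (simp add: transition_def chart_inv_chart)

lemma charts_at_iff: "c \<in> charts_at \<A> p \<longleftrightarrow> c \<in> \<A> \<and> p \<in> fst c"
  by (simp add: charts_at_def)

lemma transition_deriv_nth:
  assumes "c \<in> charts_at \<A> p" "d \<in> charts_at \<A> p"
  shows "transition_deriv c d p v $ b = (\<Sum>a\<in>UNIV. jac c d (snd c p) b a * v $ a)"
proof -
  have "snd c p \<in> dom c (fst d)" using assms by (auto simp: charts_at_iff intro: chart_in_dom)
  then have "(transition c d has_derivative (\<lambda>v. \<chi> b. \<Sum>a\<in>UNIV. v $ a * pd a (\<lambda>z. transition c d z $ b) (snd c p))) (at (snd c p))"
    using assms by (intro has_derivative_pd_vec cdiff_transition) (auto simp: charts_at_iff)
  then have "transition_deriv c d p = (\<lambda>v. \<chi> b. \<Sum>a\<in>UNIV. v $ a * pd a (\<lambda>z. transition c d z $ b) (snd c p))"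
    unfolding transition_deriv_def by (rule frechet_derivative_at[symmetric])
  then show ?thesis by (simp add: jac_def mult.commute)
qed

lemma jac_refl:
  assumes "c \<in> charts_at \<A> p" shows "jac c c (snd c p) b a = delta b a"
proof -
  have c: "c \<in> \<A>" "p \<in> fst c" using assms by (auto simp: charts_at_iff)
  have "pd a (\<lambda>z. transition c c z $ b) (snd c p) = pd a (\<lambda>z. z $ b) (snd c p)"
    using c chart_chart_inv[of _ c] by (intro pd_cong_open[OF chart_image_open[OF c(1)]]) (auto simp: transition_def chart_inv_chart)
  then show ?thesis by (auto simp: jac_def pd_nth delta_def)
qed

lemma jac_compose:
  assumes "c \<in> charts_at \<A> p" "d \<in> charts_at \<A> p" "e \<in> charts_at \<A> p"
  shows "(\<Sum>b\<in>UNIV. jac d e (snd d p) k b * jac c d (snd c p) b a) = jac c e (snd c p) k a"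
proof -
  have cde: "c \<in> \<A>" "d \<in> \<A>" "e \<in> \<A>" "p \<in> fst c" "p \<in> fst d" "p \<in> fst e"
    using assms by (auto simp: charts_at_iff)
  have "jac c e (snd c p) k a = pd a (\<lambda>z. transition d e (transition c d z) $ k) (snd c p)"
    unfolding jac_def
  proof (rule pd_cong_open)
    show "open (dom c (fst d))" using cde by (intro open_dom chart_open)
    show "snd c p \<in> dom c (fst d)" using cde by (intro chart_in_dom)
    show "transition c e z $ k = transition d e (transition c d z) $ k" if "z \<in> dom c (fst d)" for z
      using that cde by (auto simp: dom_def transition_def chart_inv_chart)
  qed
  also have "\<dots> = (\<Sum>b\<in>UNIV. pd b (\<lambda>z. transition d e z $ k) (transition c d (snd c p)) * pd a (\<lambda>z. transition c d z $ b) (snd c p))"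
    using cde by (intro pd_compose cdiff_transition) (auto simp: transition_chart intro: chart_in_dom)
  finally show ?thesis using cde by (simp add: jac_def transition_chart)
qed

lemma tangent_space_iff:
  "v \<in> tangent_space \<A> p \<longleftrightarrow> (\<forall>c. c \<notin> charts_at \<A> p \<longrightarrow> v c = 0) \<and>
    (\<forall>c\<in>charts_at \<A> p. \<forall>d\<in>charts_at \<A> p. \<forall>b. v d $ b = (\<Sum>a\<in>UNIV. jac c d (snd c p) b a * v c $ a))"
  unfolding tangent_space_def by (auto simp: vec_eq_iff transition_deriv_nth)

lemma covector_at_iff:
  "covector_at \<A> p \<alpha> \<longleftrightarrow> (\<forall>c\<in>charts_at \<A> p. \<forall>d\<in>charts_at \<A> p. \<forall>a.
     \<alpha> c $ a = (\<Sum>b\<in>UNIV. \<alpha> d $ b * jac c d (snd c p) b a))"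
proof -
  have "(\<forall>v. pairing (\<alpha> c) v = pairing (\<alpha> d) (transition_deriv c d p v)) \<longleftrightarrow>
      (\<forall>a. \<alpha> c $ a = (\<Sum>b\<in>UNIV. \<alpha> d $ b * jac c d (snd c p) b a))"
    if "c \<in> charts_at \<A> p" "d \<in> charts_at \<A> p" for c d
  proof -
    have r: "pairing (\<alpha> d) (transition_deriv c d p v) = (\<Sum>a\<in>UNIV. (\<Sum>b\<in>UNIV. \<alpha> d $ b * jac c d (snd c p) b a) * v $ a)" for v
      unfolding pairing_def transition_deriv_nth[OF that] sum_distrib_left sum_distrib_right
      by (subst sum.swap) (simp add: mult.assoc)
    show ?thesis
    proof
      assume l: "\<forall>v. pairing (\<alpha> c) v = pairing (\<alpha> d) (transition_deriv c d p v)"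
      show "\<forall>a. \<alpha> c $ a = (\<Sum>b\<in>UNIV. \<alpha> d $ b * jac c d (snd c p) b a)"
      proof
        fix a
        have "(axis a 1 :: complex ^ 'm) $ b = delta a b" for b by (simp add: axis_def delta_def)
        then show "\<alpha> c $ a = (\<Sum>b\<in>UNIV. \<alpha> d $ b * jac c d (snd c p) b a)"
          using l[rule_format, of "axis a 1"] unfolding r by (simp add: pairing_def)
      qed
    qed (simp add: r, simp add: pairing_def)
  qed
  then show ?thesis unfolding covector_at_def by blast
qed

text \<open>An intrinsic description of the exterior power of the tangent space: it replaces
  membership in a span by conditions that can be verified chart by chart.\<close>

definition tensor_at :: "'a \<Rightarrow> nat \<Rightarrow> (('a, 'm) tensor_index \<Rightarrow> complex) \<Rightarrow> bool" where
  "tensor_at p k t \<longleftrightarrow> (\<forall>c is. c \<notin> charts_at \<A> p \<longrightarrow> t (c, is) = 0) \<and>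
     (\<forall>c\<in>charts_at \<A> p. tens k (\<lambda>is. t (c, is))) \<and>
     (\<forall>c\<in>charts_at \<A> p. \<forall>d\<in>charts_at \<A> p. \<forall>is. t (d, is) = push (jac c d (snd c p)) (\<lambda>is. t (c, is)) is)"

lemma
  assumes "tensor_at p k t"
  shows tensor_at_outside: "c \<notin> charts_at \<A> p \<Longrightarrow> t (c, is) = 0"
    and tensor_at_tens: "c \<in> charts_at \<A> p \<Longrightarrow> tens k (\<lambda>is. t (c, is))"
    and tensor_at_push: "c \<in> charts_at \<A> p \<Longrightarrow> d \<in> charts_at \<A> p \<Longrightarrow>
      t (d, is) = push (jac c d (snd c p)) (\<lambda>is. t (c, is)) is"
  using assms unfolding tensor_at_def by blast+

lemma tensor_atI:
  assumes "\<And>c is. c \<notin> charts_at \<A> p \<Longrightarrow> t (c, is) = 0"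
    and "\<And>c. c \<in> charts_at \<A> p \<Longrightarrow> tens k (\<lambda>is. t (c, is))"
    and "\<And>c d is. c \<in> charts_at \<A> p \<Longrightarrow> d \<in> charts_at \<A> p \<Longrightarrow>
      t (d, is) = push (jac c d (snd c p)) (\<lambda>is. t (c, is)) is"
  shows "tensor_at p k t"
  using assms unfolding tensor_at_def by blast

lemma subspace_tensor_at: "cfun.subspace {t. tensor_at p k t}"
proof (rule cfun.subspaceI)
  have "tensor_at p k (\<lambda>_. 0)" by (rule tensor_atI) (simp_all add: tens_zero push_zero)
  then show "0 \<in> {t. tensor_at p k t}" by (simp add: zero_fun_def)
next
  fix s t assume "s \<in> {t. tensor_at p k t}" "t \<in> {t. tensor_at p k t}"
  then have s: "tensor_at p k s" and t: "tensor_at p k t" by auto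
  have "tensor_at p k (\<lambda>b. s b + t b)"
  proof (rule tensor_atI)
    fix c d "is" assume c: "c \<in> charts_at \<A> p" and d: "d \<in> charts_at \<A> p"
    show "s (d, is) + t (d, is) = push (jac c d (snd c p)) (\<lambda>is. s (c, is) + t (c, is)) is"
      unfolding push_add tensor_at_push[OF s c d] tensor_at_push[OF t c d] ..
  qed (simp_all add: tensor_at_outside[OF s] tensor_at_outside[OF t] tens_add tensor_at_tens[OF s] tensor_at_tens[OF t])
  then show "s + t \<in> {t. tensor_at p k t}" by (simp add: plus_fun_def)
next
  fix x t assume "t \<in> {t. tensor_at p k t}"
  then have t: "tensor_at p k t" by auto
  have "tensor_at p k (\<lambda>b. x * t b)"
  proof (rule tensor_atI)
    fix c d "is" assume c: "c \<in> charts_at \<A> p" and d: "d \<in> charts_at \<A> p"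
    show "x * t (d, is) = push (jac c d (snd c p)) (\<lambda>is. x * t (c, is)) is"
      unfolding push_cmult tensor_at_push[OF t c d] ..
  qed (simp_all add: tensor_at_outside[OF t] tens_cmult tensor_at_tens[OF t])
  then show "cscale x t \<in> {t. tensor_at p k t}" by (simp add: cscale_def)
qed

lemma tensor_at_wedge:
  assumes vs: "set vs \<subseteq> tangent_space \<A> p" shows "tensor_at p (length vs) (wedge \<A> p vs)"
  unfolding tensor_at_def
proof (intro conjI allI impI ballI)
  show "wedge \<A> p vs (c, is) = 0" if "c \<notin> charts_at \<A> p" for c "is" using that by (simp add: wedge_def)
  show "tens (length vs) (\<lambda>is. wedge \<A> p vs (c, is))" if "c \<in> charts_at \<A> p" for c
    using tens_lwedge[of "map (\<lambda>v a. v c $ a) vs"] by (simp add: wedge_eq_lwedge[OF that])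
  show "wedge \<A> p vs (d, is) = push (jac c d (snd c p)) (\<lambda>is. wedge \<A> p vs (c, is)) is"
    if c: "c \<in> charts_at \<A> p" and d: "d \<in> charts_at \<A> p" for c d "is"
  proof -
    have eq: "map (\<lambda>v a. v d $ a) vs = map (\<lambda>v b. \<Sum>a\<in>UNIV. jac c d (snd c p) b a * v a) (map (\<lambda>v a. v c $ a) vs)"
      using vs c d by (auto simp: tangent_space_iff fun_eq_iff)
    show ?thesis
      using fun_cong[OF wedge_eq_lwedge[OF d, of vs], of "is"]
      unfolding eq push_lwedge[symmetric] wedge_eq_lwedge[OF c, symmetric] .
  qed
qed

lemma tensor_at_if_ext_power:
  assumes "t \<in> ext_power \<A> p k V" "V \<subseteq> tangent_space \<A> p" shows "tensor_at p k t"
proof -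
  have "ext_power \<A> p k V \<subseteq> {t. tensor_at p k t}"
    unfolding ext_power_def
    by (rule cfun.span_minimal[OF _ subspace_tensor_at]) (use assms(2) tensor_at_wedge in blast)
  then show ?thesis using assms(1) by blast
qed

lemma ext_power_if_tensor_at:
  assumes t: "tensor_at p k t" and c: "c \<in> charts_at \<A> p" and k: "con \<gamma> (\<lambda>is. t (c, is)) = (\<lambda>is. 0)"
    and E: "\<And>a. \<gamma> a * (\<Sum>b\<in>UNIV. \<gamma> b * E b) = \<gamma> a"
    and V: "\<And>v. v \<in> tangent_space \<A> p \<Longrightarrow> (\<Sum>a\<in>UNIV. \<gamma> a * v c $ a) = 0 \<Longrightarrow> v \<in> V"
  shows "t \<in> ext_power \<A> p k V"
proof -
  \<comment> \<open>Transport from the chart \<open>c\<close> to all charts at \<open>p\<close>. It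
    is linear and takes wedge products of component vectors to wedge products of tangent vectors, so
    the decomposition has to be found in the single chart \<open>c\<close> only.\<close>
  define glob where "glob = (\<lambda>u (d, is). if d \<in> charts_at \<A> p then push (jac c d (snd c p)) u is else 0)"
  define vec where "vec = (\<lambda>v d. if d \<in> charts_at \<A> p then \<chi> b. \<Sum>a\<in>UNIV. jac c d (snd c p) b a * v a else 0)"
  have vec_nth: "vec v d $ b = (\<Sum>a\<in>UNIV. jac c d (snd c p) b a * v a)" if "d \<in> charts_at \<A> p" for v d b
    using that by (simp add: vec_def)
  have vec_c: "vec v c $ b = v b" for v b
    using c by (simp add: vec_nth jac_refl)
  have vec_tangent: "vec v \<in> tangent_space \<A> p" for v
    unfolding tangent_space_iff
  proof (intro conjI allI impI ballI)
    show "vec v d = 0" if "d \<notin> charts_at \<A> p" for d using that by (simp add: vec_def)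
    fix d e b assume de: "d \<in> charts_at \<A> p" "e \<in> charts_at \<A> p"
    have "(\<Sum>a\<in>UNIV. jac d e (snd d p) b a * vec v d $ a) =
        (\<Sum>x\<in>UNIV. (\<Sum>a\<in>UNIV. jac d e (snd d p) b a * jac c d (snd c p) a x) * v x)"
      unfolding vec_nth[OF de(1)] sum_distrib_left sum_distrib_right
      by (subst sum.swap) (simp add: mult.assoc)
    then show "vec v e $ b = (\<Sum>a\<in>UNIV. jac d e (snd d p) b a * vec v d $ a)"
      by (simp add: jac_compose[OF c de] vec_nth[OF de(2)])
  qed
  have glob_lwedge: "glob (lwedge vs) = wedge \<A> p (map vec vs)" for vs
  proof
    fix x :: "('a, 'm) tensor_index"
    obtain d "is" where x: "x = (d, is)" by (cases x)
    show "glob (lwedge vs) x = wedge \<A> p (map vec vs) x"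
    proof (cases "d \<in> charts_at \<A> p")
      case True
      have "map (\<lambda>v a. v d $ a) (map vec vs) = map (\<lambda>v b. \<Sum>a\<in>UNIV. jac c d (snd c p) b a * v a) vs"
        by (auto simp: vec_nth[OF True] fun_eq_iff)
      with fun_cong[OF wedge_eq_lwedge[OF True, of "map vec vs"], of "is"]
      show ?thesis using True by (simp only: x glob_def push_lwedge prod.case if_True)
    qed (simp add: x glob_def wedge_def)
  qed
  let ?S = "{lwedge vs |vs. length vs = k \<and> (\<forall>v\<in>set vs. (\<Sum>a\<in>UNIV. \<gamma> a * v a) = 0)}"
  have sub: "cfun.span ?S \<subseteq> {u. glob u \<in> ext_power \<A> p k V}"
  proof (rule cfun.span_minimal)
    show "?S \<subseteq> {u. glob u \<in> ext_power \<A> p k V}"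
    proof
      fix u assume "u \<in> ?S"
      then obtain vs where vs: "u = lwedge vs" "length vs = k" "\<forall>v\<in>set vs. (\<Sum>a\<in>UNIV. \<gamma> a * v a) = 0" by blast
      have "vec v \<in> V" if "v \<in> set vs" for v
        using vs(3) that by (intro V vec_tangent) (simp add: vec_c)
      then have "wedge \<A> p (map vec vs) \<in> {wedge \<A> p vs |vs. length vs = k \<and> set vs \<subseteq> V}"
        using vs(2) by (intro CollectI exI[of _ "map vec vs"]) auto
      then have "glob u \<in> ext_power \<A> p k V"
        unfolding vs(1) glob_lwedge ext_power_def by (rule cfun.span_base)
      then show "u \<in> {u. glob u \<in> ext_power \<A> p k V}" unfolding mem_Collect_eq .
    qed
    show "cfun.subspace {u. glob u \<in> ext_power \<A> p k V}"
    proof (rule cfun.subspaceI)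
      have "glob (\<lambda>_. 0) b = 0" for b by (cases b) (simp add: glob_def push_zero)
      then have "glob 0 = 0" unfolding zero_fun_def by blast
      then show "0 \<in> {u. glob u \<in> ext_power \<A> p k V}" by (simp add: ext_power_def cfun.span_zero)
      fix x y assume x: "x \<in> {u. glob u \<in> ext_power \<A> p k V}"
      have "glob (\<lambda>is. x is + y is) b = glob x b + glob y b" for b y by (cases b) (simp add: glob_def push_add)
      then have "glob (x + y) = glob x + glob y" unfolding plus_fun_def by blast
      then show "x + y \<in> {u. glob u \<in> ext_power \<A> p k V}" if "y \<in> {u. glob u \<in> ext_power \<A> p k V}"
        using x that by (simp add: ext_power_def cfun.span_add)
      have "glob (\<lambda>is. r * x is) b = r * glob x b" for b r by (cases b) (simp add: glob_def push_cmult)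
      then have "glob (cscale r x) = cscale r (glob x)" for r unfolding cscale_def by blast
      then show "cscale r x \<in> {u. glob u \<in> ext_power \<A> p k V}" for r
        using x by (simp add: ext_power_def cfun.span_scale)
    qed
  qed
  have "(\<lambda>is. t (c, is)) \<in> cfun.span ?S"
    by (rule span_lwedge[OF tensor_at_tens[OF t c] k E])
  then have "glob (\<lambda>is. t (c, is)) \<in> ext_power \<A> p k V"
    using subsetD[OF sub] by blast
  moreover have "glob (\<lambda>is. t (c, is)) = t"
  proof
    fix x :: "('a, 'm) tensor_index"
    obtain d "is" where x: "x = (d, is)" by (cases x)
    show "glob (\<lambda>is. t (c, is)) x = t x"
      using tensor_at_push[OF t c, of d "is"] tensor_at_outside[OF t, of d "is"]
      by (simp add: x glob_def)
  qed
  ultimately show ?thesis by (simp only:)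
qed

lemma ext_power_tangent_iff:
  assumes "p \<in> topspace M" shows "t \<in> ext_power \<A> p k (tangent_space \<A> p) \<longleftrightarrow> tensor_at p k t"
proof
  assume t: "tensor_at p k t"
  obtain c where "c \<in> \<A>" "p \<in> fst c" using chart_cover assms by blast
  then have "c \<in> charts_at \<A> p" by (simp add: charts_at_iff)
  then show "t \<in> ext_power \<A> p k (tangent_space \<A> p)"
    using t by (intro ext_power_if_tensor_at[where \<gamma> = "\<lambda>_. 0" and c = c]) (auto simp: con_def fun_eq_iff)
qed (rule tensor_at_if_ext_power, auto)

end

section \<open>The sheaves of the sequence\<close>

locale contact_mfd = complex_mfd M \<A> for M :: "'a topology" and \<A> :: "('a, 'm::finite) chart set" +
  fixes n :: nat and I :: "'i set" and U :: "'i \<Rightarrow> 'a set" and \<gamma> :: "'i \<Rightarrow> 'a \<Rightarrow> ('a, 'm) tvec"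
    and f :: "'i \<Rightarrow> 'i \<Rightarrow> 'a \<Rightarrow> complex"
  assumes contact: "complex_contact_manifold M \<A> n I U \<gamma> f"
begin

lemma dim: "CARD('m) = 2 * n + 1"
  and open_U: "i \<in> I \<Longrightarrow> openin M (U i)"
  and cover_U: "(\<Union>i\<in>I. U i) = topspace M"
  and one_form: "i \<in> I \<Longrightarrow> holo_one_form_on \<A> (\<gamma> i) (U i)"
  and volume_form: "i \<in> I \<Longrightarrow> p \<in> U i \<Longrightarrow> c \<in> charts_at \<A> p \<Longrightarrow>
    form_wedge (2 * n) 1 (two_form_power (d_one_form_at (\<gamma> i) c p) n) (one_form_at (\<gamma> i) c p) \<noteq> (\<lambda>_. 0)"
  and holo_f: "i \<in> I \<Longrightarrow> j \<in> I \<Longrightarrow> holo_fun_on \<A> (f i j) (U i \<inter> U j)"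
  and \<gamma>_f: "i \<in> I \<Longrightarrow> j \<in> I \<Longrightarrow> p \<in> U i \<inter> U j \<Longrightarrow> c \<in> charts_at \<A> p \<Longrightarrow> \<gamma> i p c = f i j p *s \<gamma> j p c"
  using contact unfolding complex_contact_manifold_def by blast+

definition gam :: "'i \<Rightarrow> ('a, 'm) chart \<Rightarrow> complex ^ 'm \<Rightarrow> 'm \<Rightarrow> complex" where
  "gam i c z a = \<gamma> i (chart_inv c z) c $ a"

abbreviation "gdom i c \<equiv> dom c (U i)"

abbreviation "reebf i c z \<equiv> reeb (gam i c z) (om (gam i c) z)"
abbreviation "bivf i c z \<equiv> bivector (gam i c z) (om (gam i c) z)"

lemma gam_chart: "c \<in> charts_at \<A> p \<Longrightarrow> gam i c (snd c p) a = \<gamma> i p c $ a"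
  by (simp add: gam_def charts_at_iff chart_inv_chart)

lemma cdiff_gam: "i \<in> I \<Longrightarrow> c \<in> \<A> \<Longrightarrow> z \<in> gdom i c \<Longrightarrow> cdiff (\<lambda>z. gam i c z a) z"
  using one_form[of i] unfolding holo_one_form_on_def holo_on_iff_cdiff gam_def dom_def by blast

lemma contact_domain_gam:
  assumes i: "i \<in> I" and c: "c \<in> \<A>"
  shows "contact_domain (gdom i c) (gam i c) (reebf i c) (bivf i c) n"
proof (rule contact_domain_reeb)
  show "open (gdom i c)" by (rule open_dom[OF c open_U[OF i]])
  show "CARD('m) = 2 * n + 1" by (rule dim)
  show "cdiff (\<lambda>z. gam i c z a) z" if "z \<in> gdom i c" for z a
    using cdiff_gam[OF i c that] .
next
  fix z v
  assume z: "z \<in> gdom i c" and v: "\<And>a. (\<Sum>b\<in>UNIV. om (gam i c) z a b * v b) = 0" "(\<Sum>a\<in>UNIV. gam i c z a * v a) = 0"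
  define p where "p = chart_inv c z"
  have p: "p \<in> U i" "c \<in> charts_at \<A> p" "snd c p = z"
    using z c by (auto simp: p_def in_dom charts_at_iff chart_inv_in chart_chart_inv)
  show "v = (\<lambda>_. 0)"
  proof (rule nondegenerate[OF volume_form[OF i p(1,2)] _ _ dim _ v])
    show "d_one_form_at (\<gamma> i) c p is = (case is of [a, b] \<Rightarrow> om (gam i c) z a b | _ \<Rightarrow> 0)" for "is"
      unfolding d_one_form_at_def Let_def om_def pd_def gam_def p(3) ..
    show "one_form_at (\<gamma> i) c p is = (case is of [a] \<Rightarrow> gam i c z a | _ \<Rightarrow> 0)" for "is"
      unfolding one_form_at_def gam_def p_def ..
  qed (simp add: om_def)
qed

lemma gam_gauge:
  assumes "i \<in> I" "j \<in> I" "c \<in> \<A>" "z \<in> dom c (U i \<inter> U j)"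
  shows "gam i c z a = f i j (chart_inv c z) * gam j c z a"
proof -
  have "chart_inv c z \<in> U i \<inter> U j" "c \<in> charts_at \<A> (chart_inv c z)"
    using assms by (auto simp: in_dom charts_at_iff chart_inv_in)
  from \<gamma>_f[OF assms(1,2) this] show ?thesis by (simp add: gam_def)
qed

lemma cdiff_f:
  assumes "i \<in> I" "j \<in> I" "c \<in> \<A>" "z \<in> dom c (U i \<inter> U j)"
  shows "cdiff (\<lambda>z. f i j (chart_inv c z)) z"
  using holo_f[OF assms(1,2)] assms(3,4) unfolding holo_fun_on_def holo_on_iff_cdiff dom_def by blast

lemma gam_push:
  assumes "i \<in> I" "p \<in> U i" "c \<in> charts_at \<A> p" "d \<in> charts_at \<A> p"
  shows "gam i c (snd c p) a = (\<Sum>b\<in>UNIV. gam i d (snd d p) b * jac c d (snd c p) b a)"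
proof -
  have "covector_at \<A> p (\<gamma> i p)"
    using one_form[OF assms(1)] assms(2) unfolding holo_one_form_on_def by blast
  then have "\<gamma> i p c $ a = (\<Sum>b\<in>UNIV. \<gamma> i p d $ b * jac c d (snd c p) b a)"
    using assms(3,4) unfolding covector_at_iff by blast
  then show ?thesis by (simp only: gam_chart[OF assms(3)] gam_chart[OF assms(4)])
qed

lemma contact_point_gam:
  "i \<in> I \<Longrightarrow> p \<in> U i \<Longrightarrow> c \<in> charts_at \<A> p \<Longrightarrow>
    contact_point (gam i c (snd c p)) (om (gam i c) (snd c p)) (reebf i c (snd c p)) (bivf i c (snd c p)) n"
  by (rule contact_domain.contact_point[OF contact_domain_gam]) (auto simp: charts_at_iff intro: chart_in_dom)

lemma in_contact_kernel:
  assumes i: "i \<in> I" "p \<in> U i" and c: "c \<in> charts_at \<A> p" and v: "v \<in> tangent_space \<A> p"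
    and k: "(\<Sum>a\<in>UNIV. gam i c (snd c p) a * v c $ a) = 0"
  shows "v \<in> contact_kernel \<A> I U \<gamma> p"
proof -
  have i_d: "pairing (\<gamma> i p d) (v d) = 0" if d: "d \<in> charts_at \<A> p" for d
  proof -
    have "pairing (\<gamma> i p d) (v d) = (\<Sum>b\<in>UNIV. gam i d (snd d p) b * (\<Sum>a\<in>UNIV. jac c d (snd c p) b a * v c $ a))"
      using v c d by (simp add: pairing_def gam_chart tangent_space_iff)
    also have "\<dots> = (\<Sum>a\<in>UNIV. gam i c (snd c p) a * v c $ a)"
      unfolding gam_push[OF i c d] sum_distrib_left sum_distrib_right
      by (subst sum.swap) (simp add: mult.assoc)
    finally show ?thesis using k by simp
  qed
  have "pairing (\<gamma> j p d) (v d) = 0" if "j \<in> I" "p \<in> U j" "d \<in> charts_at \<A> p" for j d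
  proof -
    have "pairing (\<gamma> j p d) (v d) = f j i p * pairing (\<gamma> i p d) (v d)"
      using \<gamma>_f[OF that(1) i(1) _ that(3)] i that by (simp add: pairing_def sum_distrib_left mult.assoc)
    then show ?thesis by (simp add: i_d[OF that(3)])
  qed
  then show ?thesis using v by (simp add: contact_kernel_def)
qed

text \<open>One contact form in one chart decides: by \<open>in_contact_kernel\<close>, vanishing
  there propagates to all charts and all members of the contact system. The Reeb vector supplies the
  projection needed to write such a tensor with vectors of the kernel.\<close>

lemma ext_power_kernel_iff:
  assumes i: "i \<in> I" "p \<in> U i" and c: "c \<in> charts_at \<A> p"
  shows "t \<in> ext_power \<A> p k (contact_kernel \<A> I U \<gamma> p) \<longleftrightarrow>
    tensor_at p k t \<and> con (gam i c (snd c p)) (\<lambda>is. t (c, is)) = (\<lambda>is. 0)"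
proof (intro iffI conjI)
  assume t: "t \<in> ext_power \<A> p k (contact_kernel \<A> I U \<gamma> p)"
  show "tensor_at p k t"
    by (rule tensor_at_if_ext_power[OF t]) (auto simp: contact_kernel_def)
  let ?K = "{t. con (gam i c (snd c p)) (\<lambda>is. t (c, is)) = (\<lambda>is. 0)}"
  have wedge: "con (gam i c (snd c p)) (lwedge vs) = (\<lambda>is. 0)"
    if "\<And>v. v \<in> set vs \<Longrightarrow> (\<Sum>a\<in>UNIV. gam i c (snd c p) a * v a) = 0" for vs
    using that
  proof (induction vs)
    case Nil
    show ?case by (simp add: con_def fun_eq_iff)
  next
    case (Cons v vs)
    then show ?case by (intro HOL.ext) (simp add: con_ext ext_zero)
  qed
  have "ext_power \<A> p k (contact_kernel \<A> I U \<gamma> p) \<subseteq> ?K"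
    unfolding ext_power_def
  proof (rule cfun.span_minimal)
    show "{wedge \<A> p vs |vs. length vs = k \<and> set vs \<subseteq> contact_kernel \<A> I U \<gamma> p} \<subseteq> ?K"
    proof
      fix t assume "t \<in> {wedge \<A> p vs |vs. length vs = k \<and> set vs \<subseteq> contact_kernel \<A> I U \<gamma> p}"
      then obtain vs where vs: "t = wedge \<A> p vs" "set vs \<subseteq> contact_kernel \<A> I U \<gamma> p" by blast
      have "con (gam i c (snd c p)) (\<lambda>is. wedge \<A> p vs (c, is)) = (\<lambda>is. 0)"
        unfolding wedge_eq_lwedge[OF c]
      proof (rule wedge)
        fix v assume "v \<in> set (map (\<lambda>v a. v c $ a) vs)"
        then obtain u where "u \<in> contact_kernel \<A> I U \<gamma> p" "v = (\<lambda>a. u c $ a)" using vs(2) by auto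
        then show "(\<Sum>a\<in>UNIV. gam i c (snd c p) a * v a) = 0"
          using i c by (auto simp: contact_kernel_def pairing_def gam_chart)
      qed
      then show "t \<in> ?K" unfolding mem_Collect_eq vs(1) .
    qed
    show "cfun.subspace ?K"
    proof (rule cfun.subspaceI)
      show "0 \<in> ?K" by (simp add: con_def fun_eq_iff)
      show "s + t \<in> ?K" if "s \<in> ?K" "t \<in> ?K" for s t
        using that by (simp add: con_add fun_eq_iff)
      show "cscale x t \<in> ?K" if "t \<in> ?K" for x t
        using that by (simp add: con_cmult fun_eq_iff cscale_def)
    qed
  qed
  then show "con (gam i c (snd c p)) (\<lambda>is. t (c, is)) = (\<lambda>is. 0)" using t by blast
next
  assume t: "tensor_at p k t \<and> con (gam i c (snd c p)) (\<lambda>is. t (c, is)) = (\<lambda>is. 0)"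
  interpret contact_point "gam i c (snd c p)" "om (gam i c) (snd c p)" "reebf i c (snd c p)" "bivf i c (snd c p)" n
    by (rule contact_point_gam[OF i c])
  show "t \<in> ext_power \<A> p k (contact_kernel \<A> I U \<gamma> p)"
    by (rule ext_power_if_tensor_at[where E = "reebf i c (snd c p)", OF conjunct1[OF t] c conjunct2[OF t]])
       (auto simp: \<gamma>_E intro: in_contact_kernel[OF i c])
qed

lemma point_cases:
  assumes "p \<in> topspace M"
  obtains i c where "i \<in> I" "p \<in> U i" "c \<in> charts_at \<A> p"
proof -
  obtain c where "c \<in> \<A>" "p \<in> fst c" using chart_cover assms by blast
  moreover obtain i where "i \<in> I" "p \<in> U i" using cover_U assms by blast
  ultimately show ?thesis using that by (auto simp: charts_at_iff)
qed

end

section \<open>Holomorphic sections form sheaves\<close>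

context complex_mfd
begin

lemma holo_sections_iff:
  "s \<in> holo_sections \<A> E W \<longleftrightarrow> (\<forall>p\<in>W. s p \<in> E p) \<and> (\<forall>p. p \<notin> W \<longrightarrow> s p = 0) \<and>
     (\<forall>c\<in>\<A>. \<forall>is. \<forall>z\<in>dom c W. cdiff (\<lambda>z. s (chart_inv c z) (c, is)) z)"
  unfolding holo_sections_def holo_on_iff_cdiff dom_def by simp

lemma cdiff_restr:
  assumes "c \<in> \<A>" "openin M V" "z \<in> dom c V"
  shows "cdiff (\<lambda>z. restr V s (chart_inv c z) b) z \<longleftrightarrow> cdiff (\<lambda>z. s (chart_inv c z) b) z"
  using assms by (intro cdiff_cong_open[of "dom c V"] open_dom) (auto simp: restr_def in_dom)

lemma csheaf_holo_sections:
  assumes E: "\<And>p. p \<in> topspace M \<Longrightarrow> cfun.subspace (E p)"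
  shows "csheaf M (holo_sections \<A> E)"
proof (rule csheafI)
  have E': "cfun.subspace (E p)" if "openin M W" "p \<in> W" for W p
    using that openin_subset[OF that(1)] by (intro E) auto
  show "0 \<in> holo_sections \<A> E W" if W: "openin M W" for W
    using cfun.subspace_0[OF E'[OF W]] by (simp add: holo_sections_iff)
  show "s x = 0" if "s \<in> holo_sections \<A> E W" "x \<notin> W" for W s x
    using that by (simp add: holo_sections_iff)
  show "s + t \<in> holo_sections \<A> E W" if W: "openin M W" and s: "s \<in> holo_sections \<A> E W" and t: "t \<in> holo_sections \<A> E W" for W s t
    using s t cfun.subspace_add[OF E'[OF W]] by (auto simp: holo_sections_iff intro!: cdiff_add)
  show "sscale x s \<in> holo_sections \<A> E W" if W: "openin M W" and s: "s \<in> holo_sections \<A> E W" for W x s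
    unfolding holo_sections_iff
  proof (intro conjI ballI allI impI)
    show "sscale x s p \<in> E p" if "p \<in> W" for p
      using cfun.subspace_scale[OF E'[OF W that]] s that by (simp add: holo_sections_iff sscale_def)
    show "sscale x s p = 0" if "p \<notin> W" for p
      using s that by (simp add: holo_sections_iff sscale_def)
    show "cdiff (\<lambda>z. sscale x s (chart_inv c z) (c, is)) z" if "c \<in> \<A>" "z \<in> dom c W" for c "is" z
      using s that by (simp add: holo_sections_iff sscale_def cscale_def cdiff_mult)
  qed
  show "restr V s \<in> holo_sections \<A> E V" if V: "openin M V" "V \<subseteq> W" and s: "s \<in> holo_sections \<A> E W" for W V s
    unfolding holo_sections_iff
  proof (intro conjI ballI allI impI)
    show "restr V s p \<in> E p" if "p \<in> V" for p
      using that V s by (auto simp: restr_def holo_sections_iff)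
    show "restr V s p = 0" if "p \<notin> V" for p using that by (simp add: restr_def)
    show "cdiff (\<lambda>z. restr V s (chart_inv c z) (c, is)) z" if i: "c \<in> \<A>" "z \<in> dom c V" for c "is" z
    proof -
      have "z \<in> dom c V" "z \<in> dom c W" using i V(2) by (auto simp: dom_def)
      then show ?thesis using i V(1) s by (simp add: cdiff_restr holo_sections_iff)
    qed
  qed
next
  fix \<U> :: "'a set set" and s
  assume op: "\<forall>V\<in>\<U>. openin M V" and zero: "\<forall>x. x \<notin> \<Union>\<U> \<longrightarrow> s x = 0"
    and loc: "\<forall>V\<in>\<U>. restr V s \<in> holo_sections \<A> E V"
  show "s \<in> holo_sections \<A> E (\<Union> \<U>)"
    unfolding holo_sections_iff
  proof (intro conjI ballI allI impI)
    fix p assume "p \<in> \<Union> \<U>"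
    then obtain V where V: "V \<in> \<U>" "p \<in> V" by blast
    then have "restr V s p \<in> E p" using loc by (simp add: holo_sections_iff)
    then show "s p \<in> E p" using V by (simp add: restr_def)
  next
    show "s p = 0" if "p \<notin> \<Union> \<U>" for p using zero that by blast
  next
    fix c "is" z assume i: "c \<in> \<A>" and z: "z \<in> dom c (\<Union> \<U>)"
    obtain V where V: "V \<in> \<U>" "z \<in> dom c V" "z \<in> dom c V" using z by (auto simp: dom_def)
    then have "cdiff (\<lambda>z. restr V s (chart_inv c z) (c, is)) z" using loc i by (simp add: holo_sections_iff)
    then show "cdiff (\<lambda>z. s (chart_inv c z) (c, is)) z"
      by (rule iffD1[OF cdiff_restr[OF i bspec[OF op V(1)] V(2)]])
  qed
qed

lemma holo_twisted_sections_iff: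
  "s \<in> holo_twisted_sections \<A> I U f E W \<longleftrightarrow> (\<forall>p\<in>W. s p \<in> twisted_fibre I U f E p) \<and> (\<forall>p. p \<notin> W \<longrightarrow> s p = 0) \<and>
     (\<forall>i\<in>I. \<forall>c\<in>\<A>. \<forall>is. \<forall>z\<in>dom c (W \<inter> U i). cdiff (\<lambda>z. s (chart_inv c z) (i, c, is)) z)"
  unfolding holo_twisted_sections_def holo_on_iff_cdiff dom_def by simp

lemma subspace_twisted_fibre:
  assumes "cfun.subspace (E p)" shows "cfun.subspace (twisted_fibre I U f E p)"
proof (rule cfun.subspaceI)
  have "(\<lambda>b. 0) \<in> E p" using cfun.subspace_0[OF assms] by (simp add: zero_fun_def)
  then show "0 \<in> twisted_fibre I U f E p" by (simp add: twisted_fibre_def)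
next
  fix s t assume s: "s \<in> twisted_fibre I U f E p" and t: "t \<in> twisted_fibre I U f E p"
  have "(\<lambda>b. s (i, b) + t (i, b)) \<in> E p" if i: "i \<in> I" "p \<in> U i" for i
  proof -
    have "(\<lambda>b. s (i, b)) \<in> E p" "(\<lambda>b. t (i, b)) \<in> E p"
      using s t i unfolding twisted_fibre_def by blast+
    from cfun.subspace_add[OF assms this] show ?thesis unfolding plus_fun_def .
  qed
  moreover have "s (i, b) + t (i, b) = f i j p * (s (j, b) + t (j, b))" if "i \<in> I" "j \<in> I" "p \<in> U i \<inter> U j" for i j b
  proof -
    have "s (i, b) = f i j p * s (j, b)" "t (i, b) = f i j p * t (j, b)"
      using s t that unfolding twisted_fibre_def by blast+
    then show ?thesis by (simp only: distrib_left)
  qed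
  moreover have "s (i, b) + t (i, b) = 0" if "\<not> (i \<in> I \<and> p \<in> U i)" for i b
  proof -
    have "s (i, b) = 0" "t (i, b) = 0" using s t that unfolding twisted_fibre_def by blast+
    then show ?thesis by simp
  qed
  ultimately show "s + t \<in> twisted_fibre I U f E p"
    unfolding twisted_fibre_def mem_Collect_eq plus_fun_def by blast
next
  fix x s assume s: "s \<in> twisted_fibre I U f E p"
  have "(\<lambda>b. x * s (i, b)) \<in> E p" if i: "i \<in> I" "p \<in> U i" for i
  proof -
    have "(\<lambda>b. s (i, b)) \<in> E p" using s i unfolding twisted_fibre_def by blast
    from cfun.subspace_scale[OF assms this] show ?thesis unfolding cscale_def .
  qed
  moreover have "x * s (i, b) = f i j p * (x * s (j, b))" if "i \<in> I" "j \<in> I" "p \<in> U i \<inter> U j" for i j b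
  proof -
    have "s (i, b) = f i j p * s (j, b)" using s that unfolding twisted_fibre_def by blast
    then show ?thesis by (simp only: mult.left_commute)
  qed
  moreover have "x * s (i, b) = 0" if "\<not> (i \<in> I \<and> p \<in> U i)" for i b
  proof -
    have "s (i, b) = 0" using s that unfolding twisted_fibre_def by blast
    then show ?thesis by simp
  qed
  ultimately show "cscale x s \<in> twisted_fibre I U f E p"
    unfolding twisted_fibre_def mem_Collect_eq cscale_def by blast
qed

lemma csheaf_holo_twisted_sections:
  assumes E: "\<And>p. p \<in> topspace M \<Longrightarrow> cfun.subspace (E p)"
  shows "csheaf M (holo_twisted_sections \<A> I U f E)"
proof (rule csheafI)
  have E': "cfun.subspace (twisted_fibre I U f E p)" if "openin M W" "p \<in> W" for W p
    using that openin_subset[OF that(1)] by (intro subspace_twisted_fibre E) auto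
  show "0 \<in> holo_twisted_sections \<A> I U f E W" if W: "openin M W" for W
    using cfun.subspace_0[OF E'[OF W]] by (simp add: holo_twisted_sections_iff)
  show "s x = 0" if "s \<in> holo_twisted_sections \<A> I U f E W" "x \<notin> W" for W s x
    using that by (simp add: holo_twisted_sections_iff)
  show "s + t \<in> holo_twisted_sections \<A> I U f E W" if W: "openin M W" and s: "s \<in> holo_twisted_sections \<A> I U f E W" and t: "t \<in> holo_twisted_sections \<A> I U f E W" for W s t
    using s t cfun.subspace_add[OF E'[OF W]] by (auto simp: holo_twisted_sections_iff intro!: cdiff_add)
  show "sscale x s \<in> holo_twisted_sections \<A> I U f E W" if W: "openin M W" and s: "s \<in> holo_twisted_sections \<A> I U f E W" for W x s
    unfolding holo_twisted_sections_iff
  proof (intro conjI ballI allI impI)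
    show "sscale x s p \<in> twisted_fibre I U f E p" if "p \<in> W" for p
      using cfun.subspace_scale[OF E'[OF W that]] s that by (simp add: holo_twisted_sections_iff sscale_def)
    show "sscale x s p = 0" if "p \<notin> W" for p
      using s that by (simp add: holo_twisted_sections_iff sscale_def)
    show "cdiff (\<lambda>z. sscale x s (chart_inv c z) (i, c, is)) z" if "i \<in> I" "c \<in> \<A>" "z \<in> dom c (W \<inter> U i)" for i c "is" z
      using s that by (simp add: holo_twisted_sections_iff sscale_def cscale_def cdiff_mult)
  qed
  show "restr V s \<in> holo_twisted_sections \<A> I U f E V" if V: "openin M V" "V \<subseteq> W" and s: "s \<in> holo_twisted_sections \<A> I U f E W" for W V s
    unfolding holo_twisted_sections_iff
  proof (intro conjI ballI allI impI)
    show "restr V s p \<in> twisted_fibre I U f E p" if "p \<in> V" for p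
      using that V s by (auto simp: restr_def holo_twisted_sections_iff)
    show "restr V s p = 0" if "p \<notin> V" for p using that by (simp add: restr_def)
    show "cdiff (\<lambda>z. restr V s (chart_inv c z) (i, c, is)) z" if i: "i \<in> I" "c \<in> \<A>" "z \<in> dom c (V \<inter> U i)" for i c "is" z
    proof -
      have "z \<in> dom c V" "z \<in> dom c (W \<inter> U i)" using i V(2) by (auto simp: dom_def)
      then show ?thesis using i V(1) s by (simp add: cdiff_restr holo_twisted_sections_iff)
    qed
  qed
next
  fix \<U> :: "'a set set" and s
  assume op: "\<forall>V\<in>\<U>. openin M V" and zero: "\<forall>x. x \<notin> \<Union>\<U> \<longrightarrow> s x = 0"
    and loc: "\<forall>V\<in>\<U>. restr V s \<in> holo_twisted_sections \<A> I U f E V"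
  show "s \<in> holo_twisted_sections \<A> I U f E (\<Union> \<U>)"
    unfolding holo_twisted_sections_iff
  proof (intro conjI ballI allI impI)
    fix p assume "p \<in> \<Union> \<U>"
    then obtain V where V: "V \<in> \<U>" "p \<in> V" by blast
    then have "restr V s p \<in> twisted_fibre I U f E p" using loc by (simp add: holo_twisted_sections_iff)
    then show "s p \<in> twisted_fibre I U f E p" using V by (simp add: restr_def)
  next
    show "s p = 0" if "p \<notin> \<Union> \<U>" for p using zero that by blast
  next
    fix i c "is" z assume i: "i \<in> I" "c \<in> \<A>" and z: "z \<in> dom c (\<Union> \<U> \<inter> U i)"
    obtain V where V: "V \<in> \<U>" "z \<in> dom c V" "z \<in> dom c (V \<inter> U i)" using z by (auto simp: dom_def)
    then have "cdiff (\<lambda>z. restr V s (chart_inv c z) (i, c, is)) z" using loc i by (simp add: holo_twisted_sections_iff)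
    then show "cdiff (\<lambda>z. s (chart_inv c z) (i, c, is)) z"
      by (rule iffD1[OF cdiff_restr[OF i(2) bspec[OF op V(1)] V(2)]])
  qed
qed

end

section \<open>The global splitting\<close>

text \<open>Locality of a differential operator; it gives the compatibility of the splitting with
  restriction.\<close>

lemma split_op_cong:
  assumes "open Z" "z \<in> Z" "\<And>y. y \<in> Z \<Longrightarrow> x y = x' y"
  shows "split_op n w E p x z is = split_op n w E p x' z is"
proof -
  have "dvg y z = dvg y' z" if "\<And>v. v \<in> Z \<Longrightarrow> y v = y' v" for y y' :: "_ \<Rightarrow> 'a tensor"
  proof
    fix "is"
    have "pd c (\<lambda>z. y z (c # is)) z = pd c (\<lambda>z. y' z (c # is)) z" for c
      using that by (intro pd_cong_open[OF assms(1,2)]) simp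
    then show "dvg y z is = dvg y' z is" by (simp add: dvg_def)
  qed
  from this[of x x'] this[of "\<lambda>z. lef (p z) (x z)" "\<lambda>z. lef (p z) (x' z)"]
  show ?thesis using assms by (simp add: split_op_def)
qed

context contact_domain
begin

context
  fixes x y :: "complex ^ 'm \<Rightarrow> 'm tensor" and z
  assumes z: "z \<in> Z"
    and x: "\<And>is. cdiff (\<lambda>z. x z is) z" and y: "\<And>is. cdiff (\<lambda>z. y z is) z"
begin

lemma split_op_add: "sop (\<lambda>z is. x z is + y z is) z is = sop x z is + sop y z is"
proof -
  have dvg_add: "dvg (\<lambda>z is. u z is + v z is) z is = dvg u z is + dvg v z is"
    if "\<And>is. cdiff (\<lambda>z. u z is) z" "\<And>is. cdiff (\<lambda>z. v z is) z" for u v "is"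
    using that by (simp add: dvg_def pd_add sum.distrib)
  have "dvg (\<lambda>z. lef (p z) (\<lambda>is. x z is + y z is)) z is =
      dvg (\<lambda>z. lef (p z) (x z)) z is + dvg (\<lambda>z. lef (p z) (y z)) z is" for "is"
    unfolding lef_add[abs_def] using cdiff_p[OF z] x y by (intro dvg_add cdiff_lef)
  then show ?thesis
    by (simp add: split_op_def dvg_add[OF x y] ext_add con_add lef_add lef_cmult algebra_simps)
qed

lemma split_op_cmult: "sop (\<lambda>z is. k * x z is) z is = k * sop x z is"
proof -
  have dvg_cmult: "dvg (\<lambda>z is. k * u z is) z is = k * dvg u z is"
    if "\<And>is. cdiff (\<lambda>z. u z is) z" for u "is"
    using that by (simp add: dvg_def pd_cmult sum_distrib_left)
  have "dvg (\<lambda>z. lef (p z) (\<lambda>is. k * x z is)) z is = k * dvg (\<lambda>z. lef (p z) (x z)) z is" for "is"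
    unfolding lef_cmult[abs_def] using cdiff_p[OF z] x by (intro dvg_cmult cdiff_lef)
  then show ?thesis
    by (simp add: split_op_def dvg_cmult[OF x] ext_cmult con_cmult lef_add lef_cmult algebra_simps)
qed

end

end

context contact_mfd
begin

text \<open>The component, with respect to \<open>\<gamma> i\<close> and the chart \<open>c\<close>,
  of the inverse of \<gamma> after \<open>S\<close> applied to \<open>u\<close>. The parameter is
  the scalar that appears in \<open>con_sop\<close>.\<close>

definition pot :: "nat \<Rightarrow> 'i \<Rightarrow> ('a, 'm) chart \<Rightarrow> ('a, 'i \<times> ('a, 'm) tensor_index) sect \<Rightarrow> complex ^ 'm \<Rightarrow> 'm tensor" where
  "pot q i c u z = resolve (of_nat n) (om (gam i c) z) (bivf i c z) q ((of_nat n + 2) * (of_nat q + 1))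
     (\<lambda>is. u (chart_inv c z) (i, c, is))"

definition lift :: "nat \<Rightarrow> 'i \<Rightarrow> ('a, 'm) chart \<Rightarrow> ('a, 'i \<times> ('a, 'm) tensor_index) sect \<Rightarrow> complex ^ 'm \<Rightarrow> 'm tensor" where
  "lift q i c u = split_op n (om (gam i c)) (\<lambda>z. reebf i c z) (\<lambda>z. bivf i c z) (pot q i c u)"

text \<open>From \<open>2 * r \<le> q\<close> the right side is at most \<open>r * (n + 2)\<close>,
  which is below \<open>(q + 1) * (n + 2)\<close>. The comparison is made in the integers because
  \<open>n - q\<close> may be negative.\<close>

lemma resolve_parameter:
  assumes "2 * r \<le> q"
  shows "(of_nat n + 2) * (of_nat q + 1) \<noteq> (of_nat r * (of_nat n - of_nat q + 1 + of_nat r) :: complex)"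
proof
  assume "(of_nat n + 2) * (of_nat q + 1) = (of_nat r * (of_nat n - of_nat q + 1 + of_nat r) :: complex)"
  then have "of_int ((int n + 2) * (int q + 1)) = (of_int (int r * (int n - int q + 1 + int r)) :: complex)"
    by simp
  then have "(int n + 2) * (int q + 1) = int r * (int n - int q + 1 + int r)"
    by (simp only: of_int_eq_iff)
  also have "\<dots> \<le> int r * (int n + 2)" using assms by (intro mult_left_mono) auto
  also have "\<dots> < (int q + 1) * (int n + 2)" using assms by (intro mult_strict_right_mono) auto
  finally show False by (simp add: mult.commute)
qed

lemma chart_point: "c \<in> \<A> \<Longrightarrow> z \<in> dom c W \<Longrightarrow> c \<in> charts_at \<A> (chart_inv c z) \<and> chart_inv c z \<in> W \<and> snd c (chart_inv c z) = z"
  by (auto simp: in_dom charts_at_iff chart_inv_in chart_chart_inv)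

abbreviation "Lsections q W \<equiv> O_L_ext_kernel \<A> I U \<gamma> f q W"

lemma Lsections_iff:
  "u \<in> Lsections q W \<longleftrightarrow>
    (\<forall>p\<in>W. u p \<in> twisted_fibre I U f (\<lambda>p. ext_power \<A> p q (contact_kernel \<A> I U \<gamma> p)) p) \<and> (\<forall>p. p \<notin> W \<longrightarrow> u p = 0) \<and>
     (\<forall>i\<in>I. \<forall>c\<in>\<A>. \<forall>is. \<forall>z\<in>dom c (W \<inter> U i). cdiff (\<lambda>z. u (chart_inv c z) (i, c, is)) z)"
  unfolding O_L_ext_kernel_def holo_twisted_sections_iff ..

context
  fixes W :: "'a set" and u :: "('a, 'i \<times> ('a, 'm) tensor_index) sect" and q :: nat
  assumes W: "openin M W" and u: "u \<in> Lsections q W"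
begin

lemma twisted_component:
  assumes "p \<in> W" "i \<in> I" "p \<in> U i"
  shows "(\<lambda>b. u p (i, b)) \<in> ext_power \<A> p q (contact_kernel \<A> I U \<gamma> p)"
  using u assms unfolding Lsections_iff twisted_fibre_def by blast

lemma twisted_gauge:
  assumes "p \<in> W" "i \<in> I" "j \<in> I" "p \<in> U i" "p \<in> U j"
  shows "u p (i, b) = f i j p * u p (j, b)"
  using u assms unfolding Lsections_iff twisted_fibre_def by blast

lemma twisted_tensor:
  assumes "p \<in> W" "i \<in> I" "p \<in> U i" "c \<in> charts_at \<A> p"
  shows "tensor_at p q (\<lambda>b. u p (i, b))" "con (gam i c (snd c p)) (\<lambda>is. u p (i, c, is)) = (\<lambda>is. 0)"
  using ext_power_kernel_iff[OF assms(2-4), of "\<lambda>b. u p (i, b)" q] twisted_component[OF assms(1-3)] by simp_all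

context
  fixes i c
  assumes i: "i \<in> I" and c: "c \<in> \<A>"
begin

lemma contact_domain_section: "contact_domain (dom c (W \<inter> U i)) (gam i c) (\<lambda>z. reebf i c z) (\<lambda>z. bivf i c z) n"
  using W open_U[OF i] c by (intro contact_domain_subset[OF contact_domain_gam[OF i c]] open_dom dom_mono) auto

lemma cdiff_section: "z \<in> dom c (W \<inter> U i) \<Longrightarrow> cdiff (\<lambda>z. u (chart_inv c z) (i, c, is)) z"
  using u i c unfolding Lsections_iff by blast

lemma section_tens:
  assumes "z \<in> dom c (W \<inter> U i)"
  shows "tens q (\<lambda>is. u (chart_inv c z) (i, c, is))" "con (gam i c z) (\<lambda>is. u (chart_inv c z) (i, c, is)) = (\<lambda>is. 0)"
proof -
  define p where "p = chart_inv c z"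
  have p: "p \<in> W" "p \<in> U i" "c \<in> charts_at \<A> p" "snd c p = z"
    using chart_point[OF c assms] by (auto simp: p_def)
  show "tens q (\<lambda>is. u (chart_inv c z) (i, c, is))"
    using tensor_at_tens[OF twisted_tensor(1)[OF p(1) i p(2,3)] p(3)] by (simp add: p_def)
  show "con (gam i c z) (\<lambda>is. u (chart_inv c z) (i, c, is)) = (\<lambda>is. 0)"
    using twisted_tensor(2)[OF p(1) i p(2,3)] unfolding p(4) by (simp add: p_def)
qed

lemma cdiff_pot:
  assumes "z \<in> dom c (W \<inter> U i)" shows "cdiff (\<lambda>z. pot q i c u z is) z"
  unfolding pot_def
  using assms contact_domain.cdiff_om[OF contact_domain_section] contact_domain.cdiff_p[OF contact_domain_section] cdiff_section
  by (intro cdiff_resolve)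

lemma pot_spec:
  assumes z: "z \<in> dom c (W \<inter> U i)"
  shows "tens q (pot q i c u z)" "con (gam i c z) (pot q i c u z) = (\<lambda>is. 0)"
    "lef (bivf i c z) (lam (om (gam i c) z) (pot q i c u z)) is + (of_nat n + 2) * (of_nat q + 1) * pot q i c u z is
      = u (chart_inv c z) (i, c, is)"
  using contact_point.resolve[OF contact_domain.contact_point[OF contact_domain_section z] section_tens[OF z] resolve_parameter]
  unfolding pot_def[symmetric] by blast+

lemma cdiff_lift: "z \<in> dom c (W \<inter> U i) \<Longrightarrow> cdiff (\<lambda>z. lift q i c u z is) z"
  unfolding lift_def by (rule contact_domain.cdiff_sop[OF contact_domain_section cdiff_pot])

lemma tens_lift: "z \<in> dom c (W \<inter> U i) \<Longrightarrow> tens (Suc q) (lift q i c u z)"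
  unfolding lift_def by (rule contact_domain.tens_sop[OF contact_domain_section cdiff_pot pot_spec(1)])

lemma con_lift:
  assumes z: "z \<in> dom c (W \<inter> U i)" shows "con (gam i c z) (lift q i c u z) is = u (chart_inv c z) (i, c, is)"
  unfolding lift_def
  using contact_domain.con_sop[OF contact_domain_section cdiff_pot pot_spec(1,2) z] pot_spec(3)[OF z] by simp

end

text \<open>The components of a section of the twisted bundle and the contact forms change by the
  same factor \<open>f i j\<close>. This is the joint rescaling under which \<open>split_op\<close>
  is invariant, and the reason for the twist by L.\<close>

lemma lift_gauge:
  assumes i: "i \<in> I" and j: "j \<in> I" and c: "c \<in> \<A>" and z: "z \<in> dom c (W \<inter> U i \<inter> U j)"
  shows "lift q i c u z is = lift q j c u z is"
  unfolding lift_def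
proof (rule split_op_gauge)
  let ?Z = "dom c (W \<inter> U i \<inter> U j)" and ?h = "\<lambda>z. f i j (chart_inv c z)"
  have sub: "?Z \<subseteq> dom c (W \<inter> U i)" "?Z \<subseteq> dom c (W \<inter> U j)" "?Z \<subseteq> dom c (U i \<inter> U j)" by (auto simp: dom_def)
  have op: "open ?Z" using W open_U[OF i] open_U[OF j] by (intro open_dom[OF c]) auto
  show dj: "contact_domain ?Z (gam j c) (\<lambda>z. reebf j c z) (\<lambda>z. bivf j c z) n"
    by (rule contact_domain_subset[OF contact_domain_section[OF j c] op sub(2)])
  show di: "contact_domain ?Z (gam i c) (\<lambda>z. reebf i c z) (\<lambda>z. bivf i c z) n"
    by (rule contact_domain_subset[OF contact_domain_section[OF i c] op sub(1)])
  show h: "cdiff ?h z" if "z \<in> ?Z" for z using cdiff_f[OF i j c] that sub by blast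
  show g: "gam i c z a = ?h z * gam j c z a" if "z \<in> ?Z" for z a using gam_gauge[OF i j c] that sub by blast
  show "cdiff (\<lambda>z. pot q j c u z is) z" if "z \<in> ?Z" for z "is" using cdiff_pot[OF j c] that sub by blast
  show "tens q (pot q j c u z)" "con (gam j c z) (pot q j c u z) = (\<lambda>is. 0)" if "z \<in> ?Z" for z
    using pot_spec(1,2)[OF j c] that sub by blast+
  show "pot q i c u y is = ?h y * pot q j c u y is" if y: "y \<in> ?Z" for y "is"
  proof -
    have yj: "y \<in> dom c (W \<inter> U j)" using y sub by blast
    have "(\<lambda>is. u (chart_inv c y) (i, c, is)) = (\<lambda>is. ?h y * u (chart_inv c y) (j, c, is))"
      using chart_point[OF c y] twisted_gauge[OF _ i j] by auto
    then have "pot q i c u y is = ?h y * resolve (of_nat n) (om (gam i c) y) (bivf i c y) q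
        ((of_nat n + 2) * (of_nat q + 1)) (\<lambda>is. u (chart_inv c y) (j, c, is)) is"
      by (simp add: pot_def resolve_cmult)
    also have "resolve (of_nat n) (om (gam i c) y) (bivf i c y) q
        ((of_nat n + 2) * (of_nat q + 1)) (\<lambda>is. u (chart_inv c y) (j, c, is)) is = pot q j c u y is"
      unfolding pot_def
      by (rule contact_point.resolve_gauge[OF contact_domain.contact_point[OF dj y]
            contact_domain_gauge(1,2,4)[OF dj di h g y] section_tens[OF j c yj]])
    finally show ?thesis .
  qed
qed (rule z)

lemma lift_push:
  assumes p: "p \<in> W" and i: "i \<in> I" "p \<in> U i" and cp: "c \<in> charts_at \<A> p" and dp: "d \<in> charts_at \<A> p"
  shows "lift q i d u (snd d p) is = push (jac c d (snd c p)) (lift q i c u (snd c p)) is"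
proof -
  have c: "c \<in> \<A>" "p \<in> fst c" and d: "d \<in> \<A>" "p \<in> fst d" using cp dp by (auto simp: charts_at_iff)
  let ?Z = "dom c (W \<inter> U i \<inter> fst d)" and ?Z' = "dom d (W \<inter> U i \<inter> fst c)"
  have sub: "?Z \<subseteq> dom c (W \<inter> U i)" "?Z' \<subseteq> dom d (W \<inter> U i)" by (auto simp: dom_def)
  have op: "open ?Z" "open ?Z'"
    using W open_U[OF i(1)] chart_open[OF c(1)] chart_open[OF d(1)] by (auto intro!: open_dom c d)
  have pt: "c \<in> charts_at \<A> (chart_inv c z)" "d \<in> charts_at \<A> (chart_inv c z)" "chart_inv c z \<in> W" "chart_inv c z \<in> U i"
    "snd c (chart_inv c z) = z" "snd d (chart_inv c z) = transition c d z" "transition c d z \<in> ?Z'"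
    "chart_inv d (transition c d z) = chart_inv c z" if "z \<in> ?Z" for z
    using that c d chart_point[OF c(1) that]
    by (auto simp: charts_at_iff transition_def in_dom[OF d(1)] chart_inv_chart)
  \<comment> \<open>The inverse Jacobian is the Jacobian of the reverse transition at the image
    point; composing transitions gives the two matrix identities.\<close>
  interpret coord_change ?Z ?Z' "transition c d" "jac c d" "\<lambda>z. jac d c (transition c d z)"
  proof
    show "open ?Z" "open ?Z'" by (fact op)+
    show "transition c d z \<in> ?Z'" if "z \<in> ?Z" for z by (rule pt(7)[OF that])
    show "cdiff (\<lambda>z. transition c d z $ b) z" if "z \<in> ?Z" for z b
      using that c d by (intro cdiff_transition) (auto simp: dom_def)
    show "jac c d z b a = pd a (\<lambda>z. transition c d z $ b) z" for z b a by (simp add: jac_def)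
    show "(\<Sum>a\<in>UNIV. jac c d z b a * jac d c (transition c d z) a e) = delta b e" if "z \<in> ?Z" for z b e
      using jac_compose[OF pt(2)[OF that] pt(1)[OF that] pt(2)[OF that], of b e] jac_refl[OF pt(2)[OF that]]
      unfolding pt(5,6)[OF that] by simp
    show "(\<Sum>b\<in>UNIV. jac d c (transition c d z) a b * jac c d z b e) = delta a e" if "z \<in> ?Z" for z a e
      using jac_compose[OF pt(1)[OF that] pt(2)[OF that] pt(1)[OF that], of a e] jac_refl[OF pt(1)[OF that]]
      unfolding pt(5,6)[OF that] by simp
  qed
  have dc: "contact_domain ?Z (gam i c) (\<lambda>z. reebf i c z) (\<lambda>z. bivf i c z) n"
    by (rule contact_domain_subset[OF contact_domain_section[OF i(1) c(1)] op(1) sub(1)])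
  have dd: "contact_domain ?Z' (gam i d) (\<lambda>z. reebf i d z) (\<lambda>z. bivf i d z) n"
    by (rule contact_domain_subset[OF contact_domain_section[OF i(1) d(1)] op(2) sub(2)])
  have g: "gam i c z a = (\<Sum>b\<in>UNIV. gam i d (transition c d z) b * jac c d z b a)" if "z \<in> ?Z" for z a
    using gam_push[OF i(1) pt(4,1,2)[OF that]] unfolding pt(5,6)[OF that] .
  have z: "snd c p \<in> ?Z" using p i c d by (intro chart_in_dom) auto
  have "split_op n (om (gam i d)) (\<lambda>z. reebf i d z) (\<lambda>z. bivf i d z) (pot q i d u) (transition c d (snd c p)) is
    = push (jac c d (snd c p)) (split_op n (om (gam i c)) (\<lambda>z. reebf i c z) (\<lambda>z. bivf i c z) (pot q i c u) (snd c p)) is"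
  proof (rule split_op_push[OF dc dd g])
    show "cdiff (\<lambda>z. pot q i c u z is) z" if "z \<in> ?Z" for z "is" using cdiff_pot[OF i(1) c(1)] that sub by blast
    show "cdiff (\<lambda>z. pot q i d u z is) z" if "z \<in> ?Z'" for z "is" using cdiff_pot[OF i(1) d(1)] that sub by blast
    show "tens q (pot q i c u z)" "con (gam i c z) (pot q i c u z) = (\<lambda>is. 0)" if "z \<in> ?Z" for z
      using pot_spec(1,2)[OF i(1) c(1)] that sub by blast+
    show "pot q i d u (transition c d y) is = push (jac c d y) (pot q i c u y) is" if y: "y \<in> ?Z" for y "is"
    proof -
      have "(\<lambda>is. u (chart_inv d (transition c d y)) (i, d, is)) = push (jac c d y) (\<lambda>is. u (chart_inv c y) (i, c, is))"
        using tensor_at_push[OF twisted_tensor(1)[OF pt(3)[OF y] i(1) pt(4,1)[OF y]] pt(1,2)[OF y]]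
        unfolding pt(5,8)[OF y] by blast
      then show ?thesis
        unfolding pot_def
        using resolve_push[of "om (gam i c) y" "jac c d y" "om (gam i d) (transition c d y)"
            "bivf i d (transition c d y)" "bivf i c y"]
          contact_domain_push(1)[OF dc dd g y] contact_domain_push(3)[OF dc dd g y] by simp
    qed
  qed (auto intro: z)
  then show ?thesis by (simp add: lift_def transition_chart c)
qed

end

text \<open>The index is chosen point by point without regard to holomorphy.
  \<open>splitting_eq_lift\<close> replaces it by one index on a whole neighbourhood.\<close>

definition splitting :: "nat \<Rightarrow> ('a, 'i \<times> ('a, 'm) tensor_index, ('a, 'm) tensor_index) presheaf_map" where
  "splitting q W u p = (\<lambda>(c, is). if p \<in> W \<and> c \<in> charts_at \<A> p
     then lift q (SOME i. i \<in> I \<and> p \<in> U i) c u (snd c p) is else 0)"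

lemma splitting_eq_lift:
  assumes W: "openin M W" and u: "u \<in> Lsections q W"
    and p: "p \<in> W" and i: "i \<in> I" "p \<in> U i" and c: "c \<in> charts_at \<A> p"
  shows "splitting q W u p (c, is) = lift q i c u (snd c p) is"
proof -
  define j where "j = (SOME i. i \<in> I \<and> p \<in> U i)"
  have j: "j \<in> I" "p \<in> U j" using someI[of "\<lambda>i. i \<in> I \<and> p \<in> U i" i] i by (auto simp: j_def)
  have "snd c p \<in> dom c (W \<inter> U j \<inter> U i)" using p i j c by (intro chart_in_dom) (auto simp: charts_at_iff)
  from lift_gauge[OF W u j(1) i(1) _ this] show ?thesis
    using p c by (simp add: splitting_def charts_at_iff flip: j_def)
qed

lemma contract_eq_con:
  "c \<in> charts_at \<A> p \<Longrightarrow> contract (\<gamma> i p) t (c, is) = con (gam i c (snd c p)) (\<lambda>is. t (c, is)) is"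
  by (simp add: contract_def con_def gam_chart)

lemma splitting_in:
  assumes W: "openin M W" and u: "u \<in> Lsections q W"
  shows "splitting q W u \<in> O_ext_tangent \<A> (Suc q) W"
  unfolding O_ext_tangent_def holo_sections_iff
proof (intro conjI ballI allI impI)
  fix p assume p: "p \<in> W"
  then have pM: "p \<in> topspace M" using openin_subset[OF W] by blast
  obtain i where i: "i \<in> I" "p \<in> U i" using point_cases[OF pM] by metis
  have "tensor_at p (Suc q) (splitting q W u p)"
  proof (rule tensor_atI)
    show "splitting q W u p (c, is) = 0" if "c \<notin> charts_at \<A> p" for c "is" using that by (simp add: splitting_def)
    show "tens (Suc q) (\<lambda>is. splitting q W u p (c, is))" if c: "c \<in> charts_at \<A> p" for c
      unfolding splitting_eq_lift[OF W u p i c]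
      using c p i by (intro tens_lift[OF W u i(1)] chart_in_dom) (auto simp: charts_at_iff)
    show "splitting q W u p (d, is) = push (jac c d (snd c p)) (\<lambda>is. splitting q W u p (c, is)) is"
      if c: "c \<in> charts_at \<A> p" and d: "d \<in> charts_at \<A> p" for c d "is"
      unfolding splitting_eq_lift[OF W u p i c] splitting_eq_lift[OF W u p i d] by (rule lift_push[OF W u p i c d])
  qed
  then show "splitting q W u p \<in> ext_power \<A> p (Suc q) (tangent_space \<A> p)"
    by (simp add: ext_power_tangent_iff[OF pM])
next
  show "splitting q W u p = 0" if "p \<notin> W" for p using that by (auto simp: splitting_def fun_eq_iff)
next
  fix c "is" z assume c: "c \<in> \<A>" and z: "z \<in> dom c W"
  note zp = chart_point[OF c z]
  have "chart_inv c z \<in> topspace M" using zp openin_subset[OF W] by blast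
  then obtain i where i: "i \<in> I" "chart_inv c z \<in> U i" using point_cases by metis
  have z': "z \<in> dom c (W \<inter> U i)" using z i by (simp add: in_dom[OF c])
  have "cdiff (\<lambda>z. splitting q W u (chart_inv c z) (c, is)) z \<longleftrightarrow> cdiff (\<lambda>z. lift q i c u z is) z"
  proof (rule cdiff_cong_open[OF _ z'])
    show "open (dom c (W \<inter> U i))" using W open_U[OF i(1)] by (intro open_dom[OF c]) auto
    show "splitting q W u (chart_inv c y) (c, is) = lift q i c u y is" if "y \<in> dom c (W \<inter> U i)" for y
      using chart_point[OF c that] splitting_eq_lift[OF W u _ i(1), of "chart_inv c y" c "is"] by simp
  qed
  then show "cdiff (\<lambda>z. splitting q W u (chart_inv c z) (c, is)) z"
    using cdiff_lift[OF W u i(1) c z'] by simp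
qed

lemma contact_map_splitting:
  assumes W: "openin M W" and u: "u \<in> Lsections q W"
  shows "contact_map I U \<gamma> W (splitting q W u) = u"
proof (intro HOL.ext)
  fix p and b :: "'i \<times> ('a, 'm) tensor_index"
  obtain i c "is" where b: "b = (i, c, is)" by (cases b) auto
  show "contact_map I U \<gamma> W (splitting q W u) p b = u p b"
  proof (cases "p \<in> W")
    case False
    then have "splitting q W u p = (\<lambda>_. 0)" by (auto simp: splitting_def fun_eq_iff)
    then show ?thesis using False u by (simp add: contact_map_def b contract_def Lsections_iff)
  next
    case p: True
    show ?thesis
    proof (cases "i \<in> I \<and> p \<in> U i")
      case False
      then have "u p b = 0" using u p unfolding Lsections_iff twisted_fibre_def b by blast
      then show ?thesis using False by (auto simp: contact_map_def b)
    next
      case i: True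
      show ?thesis
      proof (cases "c \<in> charts_at \<A> p")
        case False
        obtain d where d: "d \<in> charts_at \<A> p" using point_cases openin_subset[OF W] p by blast
        have "u p b = 0"
          using tensor_at_outside[OF twisted_tensor(1)[OF W u p _ _ d] False] i by (simp add: b)
        then show ?thesis using False i by (simp add: contact_map_def b contract_def splitting_def)
      next
        case c: True
        have z: "snd c p \<in> dom c (W \<inter> U i)" using c p i by (intro chart_in_dom) (auto simp: charts_at_iff)
        have "contact_map I U \<gamma> W (splitting q W u) p b = con (gam i c (snd c p)) (lift q i c u (snd c p)) is"
          using i splitting_eq_lift[OF W u p _ _ c, of i] by (simp add: contact_map_def b contract_eq_con[OF c])
        also have "\<dots> = u p b"
          using con_lift[OF W u _ _ z] i c by (simp add: b charts_at_iff chart_inv_chart)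
        finally show ?thesis .
      qed
    qed
  qed
qed

lemma sheaf_hom_splitting: "sheaf_hom M (\<lambda>W. Lsections q W) (O_ext_tangent \<A> (Suc q)) (splitting q)"
  unfolding sheaf_hom_def
proof (intro allI impI conjI ballI)
  fix W assume W: "openin M W"
  show "splitting q W ` Lsections q W \<subseteq> O_ext_tangent \<A> (Suc q) W" using splitting_in[OF W] by blast
  have L: "csheaf M (\<lambda>W. Lsections q W)"
    unfolding O_L_ext_kernel_def by (intro csheaf_holo_twisted_sections open_U) (simp add: ext_power_def)
  have outside: "splitting q W s p (c, is) = 0" if "\<not> (p \<in> W \<and> c \<in> charts_at \<A> p)" for W s p c "is"
    using that by (auto simp: splitting_def)
  fix s assume s: "s \<in> Lsections q W"
  have at: "P" if "p \<in> W" "\<And>i. i \<in> I \<Longrightarrow> p \<in> U i \<Longrightarrow> P" for p P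
    using that openin_subset[OF W] point_cases by (metis subsetD)
  show "splitting q W (s + t) = splitting q W s + splitting q W t" if t: "t \<in> Lsections q W" for t
  proof (intro HOL.ext)
    fix p and b :: "('a, 'm) tensor_index"
    obtain c "is" where b: "b = (c, is)" by (cases b)
    show "splitting q W (s + t) p b = (splitting q W s + splitting q W t) p b"
    proof (cases "p \<in> W \<and> c \<in> charts_at \<A> p")
      case True
      then have p: "p \<in> W" and c: "c \<in> charts_at \<A> p" by auto
      show ?thesis
      proof (rule at[OF p])
        fix i assume i: "i \<in> I" "p \<in> U i"
        have cA: "c \<in> \<A>" using c by (simp add: charts_at_iff)
        have z: "snd c p \<in> dom c (W \<inter> U i)" using c p i by (intro chart_in_dom) (auto simp: charts_at_iff)
        have "pot q i c (s + t) = (\<lambda>z is. pot q i c s z is + pot q i c t z is)"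
          by (intro HOL.ext) (simp add: pot_def resolve_add)
        then have "lift q i c (s + t) (snd c p) is = lift q i c s (snd c p) is + lift q i c t (snd c p) is"
          unfolding lift_def
          using contact_domain.split_op_add[OF contact_domain_section[OF W s i(1) cA] z
              cdiff_pot[OF W s i(1) cA z] cdiff_pot[OF W t i(1) cA z]] by simp
        then show ?thesis
          using splitting_eq_lift[OF W _ p i c] s t csheaf_add[OF L W s t] by (simp add: b)
      qed
    next
      case False
      show ?thesis by (simp add: b outside[OF False])
    qed
  qed
  show "splitting q W (sscale k s) = sscale k (splitting q W s)" for k
  proof (intro HOL.ext)
    fix p and b :: "('a, 'm) tensor_index"
    obtain c "is" where b: "b = (c, is)" by (cases b)
    show "splitting q W (sscale k s) p b = sscale k (splitting q W s) p b"
    proof (cases "p \<in> W \<and> c \<in> charts_at \<A> p")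
      case True
      then have p: "p \<in> W" and c: "c \<in> charts_at \<A> p" by auto
      show ?thesis
      proof (rule at[OF p])
        fix i assume i: "i \<in> I" "p \<in> U i"
        have cA: "c \<in> \<A>" using c by (simp add: charts_at_iff)
        have z: "snd c p \<in> dom c (W \<inter> U i)" using c p i by (intro chart_in_dom) (auto simp: charts_at_iff)
        have "pot q i c (sscale k s) = (\<lambda>z is. k * pot q i c s z is)"
          by (intro HOL.ext) (simp add: pot_def resolve_cmult sscale_def cscale_def)
        then have "lift q i c (sscale k s) (snd c p) is = k * lift q i c s (snd c p) is"
          unfolding lift_def
          using contact_domain.split_op_cmult[OF contact_domain_section[OF W s i(1) cA] z
              cdiff_pot[OF W s i(1) cA z] cdiff_pot[OF W s i(1) cA z]] by simp
        then show ?thesis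
          using splitting_eq_lift[OF W _ p i c] s csheaf_sscale[OF L W s] by (simp add: b sscale_def cscale_def)
      qed
    next
      case False
      show ?thesis by (simp add: b outside[OF False] sscale_def cscale_def)
    qed
  qed
  show "splitting q V (restr V s) = restr V (splitting q W s)" if V: "openin M V \<and> V \<subseteq> W" for V
  proof (intro HOL.ext)
    fix p and b :: "('a, 'm) tensor_index"
    obtain c "is" where b: "b = (c, is)" by (cases b)
    have V': "openin M V" "V \<subseteq> W" using V by auto
    show "splitting q V (restr V s) p b = restr V (splitting q W s) p b"
    proof (cases "p \<in> V \<and> c \<in> charts_at \<A> p")
      case True
      then have p: "p \<in> V" "p \<in> W" and c: "c \<in> charts_at \<A> p" using V' by auto
      show ?thesis
      proof (rule at[OF p(2)])
        fix i assume i: "i \<in> I" "p \<in> U i"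
        have cA: "c \<in> \<A>" using c by (simp add: charts_at_iff)
        have z: "snd c p \<in> dom c V" using c p by (intro chart_in_dom) (auto simp: charts_at_iff)
        have "lift q i c (restr V s) (snd c p) is = lift q i c s (snd c p) is"
          unfolding lift_def
        proof (rule split_op_cong[OF open_dom[OF cA V'(1)] z])
          show "pot q i c (restr V s) y = pot q i c s y" if "y \<in> dom c V" for y
            using chart_point[OF cA that] by (simp add: pot_def restr_def)
        qed
        then show ?thesis
          using splitting_eq_lift[OF W s p(2) i c] splitting_eq_lift[OF V'(1) csheaf_restr[OF L W V' s] p(1) i c] p
          by (simp add: b restr_def)
      qed
    next
      case False
      then show ?thesis
        using V' outside[of p V c "restr V s" "is"] outside[of p W c s "is"] by (auto simp: b restr_def)
    qed
  qed
qed

section \<open>Inclusion and contact map as maps of sheaves\<close>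

lemma O_ext_kernel_eq:
  assumes W: "openin M W"
  shows "O_ext_kernel \<A> I U \<gamma> k W = sheaf_kernel (O_ext_tangent \<A> k) (contact_map I U \<gamma>) W"
proof -
  have fibre: "t \<in> ext_power \<A> p k (contact_kernel \<A> I U \<gamma> p) \<longleftrightarrow>
      t \<in> ext_power \<A> p k (tangent_space \<A> p) \<and> (\<forall>i\<in>I. p \<in> U i \<longrightarrow> contract (\<gamma> i p) t = 0)"
    if p: "p \<in> topspace M" for t p
  proof -
    obtain j d where j: "j \<in> I" "p \<in> U j" and d: "d \<in> charts_at \<A> p" using point_cases[OF p] .
    show ?thesis
    proof (intro iffI conjI ballI impI)
      assume t: "t \<in> ext_power \<A> p k (contact_kernel \<A> I U \<gamma> p)"
      then have ta: "tensor_at p k t" using ext_power_kernel_iff[OF j d] by blast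
      then show "t \<in> ext_power \<A> p k (tangent_space \<A> p)" by (simp add: ext_power_tangent_iff[OF p])
      fix i assume i: "i \<in> I" "p \<in> U i"
      show "contract (\<gamma> i p) t = 0"
      proof
        fix b :: "('a, 'm) tensor_index"
        obtain c "is" where b: "b = (c, is)" by (cases b)
        show "contract (\<gamma> i p) t b = 0 b"
        proof (cases "c \<in> charts_at \<A> p")
          case True
          then have "con (gam i c (snd c p)) (\<lambda>is. t (c, is)) = (\<lambda>is. 0)" using t ext_power_kernel_iff[OF i True] by blast
          then show ?thesis using fun_cong by (fastforce simp: b contract_eq_con[OF True])
        next
          case False
          then show ?thesis using tensor_at_outside[OF ta False] by (simp add: b contract_def)
        qed
      qed
    next
      assume t: "t \<in> ext_power \<A> p k (tangent_space \<A> p) \<and> (\<forall>i\<in>I. p \<in> U i \<longrightarrow> contract (\<gamma> i p) t = 0)"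
      have "contract (\<gamma> j p) t = 0" using t j by blast
      then have "con (gam j d (snd d p)) (\<lambda>is. t (d, is)) is = 0" for "is"
        using contract_eq_con[OF d, of j t "is"] by simp
      then show "t \<in> ext_power \<A> p k (contact_kernel \<A> I U \<gamma> p)"
        using t unfolding ext_power_kernel_iff[OF j d] ext_power_tangent_iff[OF p] by blast
    qed
  qed
  have W': "p \<in> topspace M" if "p \<in> W" for p using that openin_subset[OF W] by blast
  have cm: "contact_map I U \<gamma> W s = 0 \<longleftrightarrow> (\<forall>p\<in>W. \<forall>i\<in>I. p \<in> U i \<longrightarrow> contract (\<gamma> i p) (s p) = 0)"
    if "\<forall>p. p \<notin> W \<longrightarrow> s p = 0" for s
  proof -
    have "contract (\<gamma> i p) (s p) = 0" if "p \<notin> W" for i p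
      using \<open>\<forall>p. p \<notin> W \<longrightarrow> s p = 0\<close> that by (auto simp: contract_def fun_eq_iff)
    then show ?thesis by (force simp: contact_map_def fun_eq_iff)
  qed
  show ?thesis
    unfolding O_ext_kernel_def O_ext_tangent_def sheaf_kernel_def
    using fibre[OF W'] cm by (auto simp: holo_sections_iff)
qed

lemma contact_map_in:
  assumes W: "openin M W" and s: "s \<in> O_ext_tangent \<A> (Suc q) W"
  shows "contact_map I U \<gamma> W s \<in> Lsections q W"
  unfolding Lsections_iff
proof (intro conjI ballI allI impI)
  fix p assume p: "p \<in> W"
  then have pM: "p \<in> topspace M" using openin_subset[OF W] by blast
  have ta: "tensor_at p (Suc q) (s p)"
    using s p unfolding O_ext_tangent_def holo_sections_iff ext_power_tangent_iff[OF pM, symmetric] by blast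
  have comp: "contract (\<gamma> i p) (s p) \<in> ext_power \<A> p q (contact_kernel \<A> I U \<gamma> p)" if i: "i \<in> I" "p \<in> U i" for i
  proof -
    obtain c where c: "c \<in> charts_at \<A> p" using point_cases[OF pM] by metis
    have "tensor_at p q (contract (\<gamma> i p) (s p))"
    proof (rule tensor_atI)
      show "contract (\<gamma> i p) (s p) (c, is) = 0" if "c \<notin> charts_at \<A> p" for c "is"
        using tensor_at_outside[OF ta that] by (simp add: contract_def)
      show "tens q (\<lambda>is. contract (\<gamma> i p) (s p) (c, is))" if "c \<in> charts_at \<A> p" for c
        unfolding contract_eq_con[OF that] by (rule tens_con[OF tensor_at_tens[OF ta that]])
      show "contract (\<gamma> i p) (s p) (d, is) = push (jac c d (snd c p)) (\<lambda>is. contract (\<gamma> i p) (s p) (c, is)) is"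
        if c: "c \<in> charts_at \<A> p" and d: "d \<in> charts_at \<A> p" for c d "is"
      proof -
        have "(\<lambda>is. s p (d, is)) = push (jac c d (snd c p)) (\<lambda>is. s p (c, is))"
          using tensor_at_push[OF ta c d] by blast
        moreover have "gam i c (snd c p) = (\<lambda>a. \<Sum>b\<in>UNIV. gam i d (snd d p) b * jac c d (snd c p) b a)"
          using gam_push[OF i c d] by blast
        ultimately show ?thesis unfolding contract_eq_con[OF c] contract_eq_con[OF d] by (simp add: con_push)
      qed
    qed
    \<comment> \<open>Two contractions with the same covector give zero: by \<open>con_con\<close>
      the result equals its negative. Hence the contact map takes values in the kernel.\<close>
    moreover have "con (gam i c (snd c p)) (\<lambda>is. contract (\<gamma> i p) (s p) (c, is)) is = 0" for "is"
      unfolding contract_eq_con[OF c]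
      using con_con[OF tensor_at_tens[OF ta c], of "gam i c (snd c p)" "gam i c (snd c p)" "is"] by simp
    ultimately show ?thesis unfolding ext_power_kernel_iff[OF i c] by blast
  qed
  show "contact_map I U \<gamma> W s p \<in> twisted_fibre I U f (\<lambda>p. ext_power \<A> p q (contact_kernel \<A> I U \<gamma> p)) p"
    unfolding twisted_fibre_def mem_Collect_eq
  proof (intro conjI ballI allI impI)
    show "(\<lambda>b. contact_map I U \<gamma> W s p (i, b)) \<in> ext_power \<A> p q (contact_kernel \<A> I U \<gamma> p)" if "i \<in> I" "p \<in> U i" for i
      using comp[OF that] that by (simp add: contact_map_def)
    show "contact_map I U \<gamma> W s p (i, b) = 0" if "\<not> (i \<in> I \<and> p \<in> U i)" for i b
      using that by (auto simp: contact_map_def)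
    show "contact_map I U \<gamma> W s p (i, b) = f i j p * contact_map I U \<gamma> W s p (j, b)"
      if i: "i \<in> I" and j: "j \<in> I" and pij: "p \<in> U i \<inter> U j" for i j b
    proof -
      obtain c "is" where b: "b = (c, is)" by (cases b)
      have "contract (\<gamma> i p) (s p) (c, is) = f i j p * contract (\<gamma> j p) (s p) (c, is)"
      proof (cases "c \<in> charts_at \<A> p")
        case True
        then show ?thesis using \<gamma>_f[OF i j pij True] by (simp add: contract_def sum_distrib_left mult.assoc)
      next
        case False
        then show ?thesis using tensor_at_outside[OF ta False] by (simp add: contract_def)
      qed
      then show ?thesis using i j pij by (simp add: contact_map_def b)
    qed
  qed
next
  show "contact_map I U \<gamma> W s p = 0" if "p \<notin> W" for p
    using s that by (auto simp: O_ext_tangent_def holo_sections_iff contact_map_def contract_def fun_eq_iff)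
next
  fix i c "is" z assume i: "i \<in> I" and c: "c \<in> \<A>" and z: "z \<in> dom c (W \<inter> U i)"
  have zW: "z \<in> dom c W" and zU: "z \<in> gdom i c" using z by (auto simp: dom_def)
  have "cdiff (\<lambda>z. contact_map I U \<gamma> W s (chart_inv c z) (i, c, is)) z \<longleftrightarrow>
      cdiff (\<lambda>z. con (gam i c z) (\<lambda>is. s (chart_inv c z) (c, is)) is) z"
  proof (rule cdiff_cong_open[OF _ z])
    show "open (dom c (W \<inter> U i))" using W open_U[OF i] by (intro open_dom[OF c]) auto
    show "contact_map I U \<gamma> W s (chart_inv c y) (i, c, is) = con (gam i c y) (\<lambda>is. s (chart_inv c y) (c, is)) is"
      if "y \<in> dom c (W \<inter> U i)" for y
      using chart_point[OF c that] i by (simp add: contact_map_def contract_eq_con)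
  qed
  moreover have "cdiff (\<lambda>z. con (gam i c z) (\<lambda>is. s (chart_inv c z) (c, is)) is) z"
    using s c zW cdiff_gam[OF i c zU] by (intro cdiff_con) (auto simp: O_ext_tangent_def holo_sections_iff)
  ultimately show "cdiff (\<lambda>z. contact_map I U \<gamma> W s (chart_inv c z) (i, c, is)) z" by simp
qed

lemma sheaf_hom_contact_map: "sheaf_hom M (O_ext_tangent \<A> (Suc q)) (\<lambda>W. Lsections q W) (contact_map I U \<gamma>)"
  unfolding sheaf_hom_def
proof (intro allI impI conjI ballI)
  fix W assume W: "openin M W"
  show "contact_map I U \<gamma> W ` O_ext_tangent \<A> (Suc q) W \<subseteq> Lsections q W" using contact_map_in[OF W] by blast
  show "contact_map I U \<gamma> W (s + t) = contact_map I U \<gamma> W s + contact_map I U \<gamma> W t" for s t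
    by (auto simp: contact_map_def fun_eq_iff contract_linear)
  show "contact_map I U \<gamma> W (sscale k s) = sscale k (contact_map I U \<gamma> W s)" for k s
    by (auto simp: contact_map_def fun_eq_iff sscale_def contract_linear) (auto simp: cscale_def)
  show "contact_map I U \<gamma> V (restr V s) = restr V (contact_map I U \<gamma> W s)" for V s
    by (auto simp: contact_map_def fun_eq_iff restr_def contract_def)
qed

end

theorem theorem1p1:
  fixes M :: "'a topology"
    and \<A> :: "('a, 'm::finite) chart set"
    and I :: "'i set"
    and U :: "'i \<Rightarrow> 'a set"
    and \<gamma> :: "'i \<Rightarrow> 'a \<Rightarrow> ('a, 'm) tvec"
    and f :: "'i \<Rightarrow> 'i \<Rightarrow> 'a \<Rightarrow> complex"
    and n k :: nat
  assumes "complex_contact_manifold M \<A> n I U \<gamma> f"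
    and "1 \<le> k" and "k \<le> 2 * n + 1"
  shows "split_short_exact_sheaf_sequence M
           (O_ext_kernel \<A> I U \<gamma> k) inclusion_map
           (O_ext_tangent \<A> k) (contact_map I U \<gamma>)
           (O_L_ext_kernel \<A> I U \<gamma> f (k - 1))
         \<and> (\<forall>i\<in>{0..2 * n + 1}.
              short_exact_in_cohomology M i
                (O_ext_kernel \<A> I U \<gamma> k) inclusion_map
                (O_ext_tangent \<A> k) (contact_map I U \<gamma>)
                (O_L_ext_kernel \<A> I U \<gamma> f (k - 1)))"
proof -
  interpret contact_mfd M \<A> n I U \<gamma> f
  proof
    show "complex_manifold M \<A>" using assms(1) unfolding complex_contact_manifold_def by (rule conjunct1)
  qed (rule assms(1))
  \<comment> \<open>Since \<open>k\<close> is positive, the truncated difference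
    \<open>k - 1\<close> is the true degree \<open>q\<close> of the third sheaf.\<close>
  obtain q where k: "k = Suc q" using assms(2) by (cases k) auto
  have F: "csheaf M (O_ext_kernel \<A> I U \<gamma> (Suc q))"
    unfolding O_ext_kernel_def by (rule csheaf_holo_sections) (simp add: ext_power_def)
  have G: "csheaf M (O_ext_tangent \<A> (Suc q))"
    unfolding O_ext_tangent_def by (rule csheaf_holo_sections) (simp add: ext_power_def)
  have H: "csheaf M (O_L_ext_kernel \<A> I U \<gamma> f q)"
    unfolding O_L_ext_kernel_def
    by (rule csheaf_holo_twisted_sections) (simp_all add: ext_power_def open_U)
  note split = split_short_exact_in_cohomology[OF F G H O_ext_kernel_eq sheaf_hom_contact_map
      sheaf_hom_splitting contact_map_splitting]
  show ?thesis
    unfolding k diff_Suc_1 by (intro conjI ballI split)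
qed

end
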